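(* For every $r\geq0$, the family $(\mathfrak{g}_\pi)_{\pi\vdash r}$ is a $\mathbb{Z}$-basis of $\mathcal{Z}^{(r)}_\infty$.
   Context: For a partition $\lambda$, $|\lambda|$ is its size, $\ell(\lambda)$ its length, and $\lambda-\mathbf{1}$ is the partition obtained by subtracting $1$ from each part and discarding zeros. A permutation of cycle type $\lambda$ has reduced cycle type $\lambda-\mathbf{1}$. For any partition $\lambda$, $C_\lambda(n)\in\mathbb{Z}\mathfrak{S}_n$ is the sum of all permutations in $\mathfrak{S}_n$ of reduced cycle type $\lambda$ (it is $0$ if $|\lambda|+\ell(\lambda)>n$). In the center of $\mathbb{Z}\mathfrak{S}_n$ write $C_\lambda(n)C_\mu(n)=\sum_{|\kappa|+\ell(\kappa)\leq n}\rho^\kappa_{\lambda,\mu}(n)C_\kappa(n)$. It is known (Farahat–Higman) that $\rho^\kappa_{\lambda,\mu}(n)=0$ if $|\kappa|>|\lambda|+|\mu|$, and that if $|\kappa|=|\lambda|+|\mu|$ then $\rho^\kappa_{\lambda,\mu}(n)$ does not depend on $n\geq|\kappa|+\ell(\kappa)$; this value is denoted $\rho^\kappa_{\lambda,\mu}$. The graded Farahat–Higman algebra $\mathcal{Z}_\infty$ is the commutative graded $\mathbb{Z}$-algebra that is free as a $\mathbb{Z}$-module with basis $(\mathfrak{c}_\lambda)$ indexed by all partitions, with product $\mathfrak{c}_\lambda\mathfrak{c}_\mu=\sum_{\kappa\vdash|\lambda|+|\mu|}\rho^\kappa_{\lambda,\mu}\mathfrak{c}_\kappa$ (it is the graded projective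 limit of the graded algebras associated with the centers of $\mathbb{Z}\mathfrak{S}_n$ for the filtration $\deg C_\lambda(n)=|\lambda|$). Its degree-$r$ component is $\mathcal{Z}^{(r)}_\infty=\mathrm{Span}_{\mathbb{Z}}\{\mathfrak{c}_\lambda:\lambda\vdash r\}$. For $r\geq1$ put $\mathfrak{f}_r=\sum_{\lambda\vdash r}\mathfrak{c}_\lambda$, and $\mathfrak{f}_0=\mathfrak{c}_\emptyset=1$. For any partition $\pi$ put $\mathfrak{g}_\pi=\mathfrak{c}_{\pi-\mathbf{1}}\,\mathfrak{f}_{\ell(\pi)}\in\mathcal{Z}_\infty^{(|\pi|)}$. *)

theory Defs
  imports
    "HOL-Library.Multiset"
    "HOL-Library.Poly_Mapping"
    "HOL-Combinatorics.Combinatorics"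
begin

section \<open>Partitions\<close>

typedef partition = "{P :: nat multiset. 0 \<notin># P}"
  morphisms parts Partition
  by (rule exI[of _ "{#}"]) simp

setup_lifting type_definition_partition

lift_definition psize :: "partition \<Rightarrow> nat" is "\<lambda>P. sum_mset P" .

lift_definition plength :: "partition \<Rightarrow> nat" is "\<lambda>P. size P" .

lift_definition empty_partition :: partition is "{#}" by simp

definition partitions_of :: "nat \<Rightarrow> partition set" where
  "partitions_of r = {\<pi>. psize \<pi> = r}"

definition decrement_parts :: "nat multiset \<Rightarrow> nat multiset" where
  "decrement_parts P = filter_mset (\<lambda>k. k \<noteq> 0) (image_mset (\<lambda>k. k - 1) P)"

lift_definition minus_one :: "partition \<Rightarrow> partition" is decrement_parts
  by (simp add: decrement_parts_def)

lemma finite_partitions_of: "finite (partitions_of r)"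
proof -
  have size_le: "size P \<le> sum_mset P" if "0 \<notin># P" for P :: "nat multiset"
    using that by (induction P) auto
  have "parts ` partitions_of r \<subseteq> (\<Union>k\<le>r. {P. size P = k \<and> set_mset P \<subseteq> {..r}})"
  proof
    fix P assume "P \<in> parts ` partitions_of r"
    then obtain \<pi> where P: "P = parts \<pi>" "psize \<pi> = r"
      by (auto simp: partitions_of_def)
    then have "0 \<notin># P" and s: "sum_mset P = r"
      using parts[of \<pi>] by (simp_all add: psize.rep_eq)
    then have "size P \<le> r" using size_le by force
    moreover have "set_mset P \<subseteq> {..r}"
      using s sum_mset.remove by fastforce
    ultimately show "P \<in> (\<Union>k\<le>r. {P. size P = k \<and> set_mset P \<subseteq> {..r}})"
      by blast
  qed
  moreover have "finite (\<Union>k\<le>r. {P :: nat multiset. size P = k \<and> set_mset P \<subseteq> {..r}})"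
  proof (intro finite_UN_I finite_atMost)
    fix k
    have "{P :: nat multiset. size P = k \<and> set_mset P \<subseteq> {..r}}
        \<subseteq> mset ` {xs. set xs \<subseteq> {..r} \<and> length xs = k}"
    proof
      fix P :: "nat multiset" assume P: "P \<in> {P. size P = k \<and> set_mset P \<subseteq> {..r}}"
      obtain xs where "mset xs = P" using ex_mset by blast
      with P show "P \<in> mset ` {xs. set xs \<subseteq> {..r} \<and> length xs = k}" by auto
    qed
    then show "finite {P :: nat multiset. size P = k \<and> set_mset P \<subseteq> {..r}}"
      by (rule finite_subset) (simp add: finite_lists_length_eq)
  qed
  ultimately have "finite (parts ` partitions_of r)" by (rule finite_subset)
  then show ?thesis
    by (rule finite_imageD) (simp add: inj_on_def parts_inject)
qed

section \<open>Class sums in the group ring of the symmetric group\<close>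

definition cycle_type :: "nat \<Rightarrow> (nat \<Rightarrow> nat) \<Rightarrow> nat multiset" where
  "cycle_type n p = image_mset card (mset_set (orbit p ` {1..n}))"

lift_definition reduced_cycle_type :: "nat \<Rightarrow> (nat \<Rightarrow> nat) \<Rightarrow> partition"
  is "\<lambda>n p. decrement_parts (cycle_type n p)"
  by (simp add: decrement_parts_def)

text \<open>
  Elements of \<open>\<int>\<SS>\<^sub>n\<close> are finitely supported integer combinations of permutations of
  \<open>{1..n}\<close> inside the free \<open>\<int>\<close>-module on all functions \<open>nat \<Rightarrow> nat\<close>; the product is
  the bilinear extension of composition.
\<close>

definition group_ring_mult ::
    "((nat \<Rightarrow> nat) \<Rightarrow>\<^sub>0 int) \<Rightarrow> ((nat \<Rightarrow> nat) \<Rightarrow>\<^sub>0 int) \<Rightarrow> ((nat \<Rightarrow> nat) \<Rightarrow>\<^sub>0 int)" where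
  "group_ring_mult x y = frag_extend (\<lambda>s. frag_extend (\<lambda>t. frag_of (s \<circ> t)) y) x"

definition class_sum :: "nat \<Rightarrow> partition \<Rightarrow> ((nat \<Rightarrow> nat) \<Rightarrow>\<^sub>0 int)" where
  "class_sum n \<nu> = (\<Sum>p | p permutes {1..n} \<and> reduced_cycle_type n p = \<nu>. frag_of p)"

definition partitions_within :: "nat \<Rightarrow> partition set" where
  "partitions_within n = {\<kappa>. psize \<kappa> + plength \<kappa> \<le> n}"

lemma finite_partitions_within: "finite (partitions_within n)"
  by (rule finite_subset[of _ "\<Union>r\<le>n. partitions_of r"])
     (auto simp: partitions_within_def partitions_of_def finite_partitions_of[unfolded partitions_of_def])

text \<open>
  The structure constant \<open>\<rho>\<^sup>\<kappa>\<close> of \<open>\<nu>\<close> and \<open>\<mu>\<close> at \<open>n\<close>: the coefficient family is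
  unique once it is set to zero at those \<open>\<kappa>\<close> whose class sum vanishes.
\<close>

definition rho_at :: "nat \<Rightarrow> partition \<Rightarrow> partition \<Rightarrow> partition \<Rightarrow> int" where
  "rho_at n \<nu> \<mu> = (THE a.
     (\<forall>\<kappa>. \<kappa> \<notin> partitions_within n \<longrightarrow> a \<kappa> = 0) \<and>
     group_ring_mult (class_sum n \<nu>) (class_sum n \<mu>) =
       (\<Sum>\<kappa>\<in>partitions_within n. frag_cmul (a \<kappa>) (class_sum n \<kappa>)))"

text \<open>
  The stable structure constant; meaningful only if \<open>psize \<kappa> = psize \<nu> + psize \<mu>\<close>, the
  only case in which it is used below.
\<close>

definition rho :: "partition \<Rightarrow> partition \<Rightarrow> partition \<Rightarrow> int" where
  "rho \<nu> \<mu> \<kappa> = (THE c. \<forall>n \<ge> psize \<kappa> + plength \<kappa>. rho_at n \<nu> \<mu> \<kappa> = c)"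

section \<open>The graded Farahat--Higman algebra\<close>

type_synonym fh_algebra = "partition \<Rightarrow>\<^sub>0 int"

definition fh_c :: "partition \<Rightarrow> fh_algebra" where
  "fh_c \<nu> = frag_of \<nu>"

definition fh_mult :: "fh_algebra \<Rightarrow> fh_algebra \<Rightarrow> fh_algebra" where
  "fh_mult x y = frag_extend (\<lambda>\<nu>. frag_extend (\<lambda>\<mu>.
     \<Sum>\<kappa>\<in>partitions_of (psize \<nu> + psize \<mu>). frag_cmul (rho \<nu> \<mu> \<kappa>) (fh_c \<kappa>)) y) x"

global_interpretation int_module: module "frag_cmul :: int \<Rightarrow> fh_algebra \<Rightarrow> fh_algebra"
  by unfold_locales (simp_all add: frag_cmul_distrib frag_cmul_distrib2)

definition fh_degree :: "nat \<Rightarrow> fh_algebra set" where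
  "fh_degree r = int_module.span (fh_c ` partitions_of r)"

definition fh_f :: "nat \<Rightarrow> fh_algebra" where
  "fh_f r = (if r = 0 then fh_c empty_partition else (\<Sum>\<nu>\<in>partitions_of r. fh_c \<nu>))"

definition fh_g :: "partition \<Rightarrow> fh_algebra" where
  "fh_g \<pi> = fh_mult (fh_c (minus_one \<pi>)) (fh_f (plength \<pi>))"

end

theory Submission
  imports Defs
begin

text \<open>
  In the group ring of \<open>\<SS>\<^sub>n\<close>, \<open>n = 2 r\<close>, filtered by \<open>n\<close> minus the number of cycles, let \<open>m\<^sub>\<nu>\<close>
  be the monomial symmetric function of the Jucys--Murphy elements
  \<open>J\<^sub>b = \<Sum>\<^bsub>a < b\<^esub> (a b)\<close>. The top degree part of \<open>m\<^sub>\<nu>\<close> counts monotone minimal factorizations,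
  which makes \<open>m\<^sub>\<nu>\<close> equal to \<open>\<cc>\<^sub>\<nu>\<close> plus a combination of the \<open>\<cc>\<^sub>\<kappa>\<close> with fewer parts. So the \<open>m\<^sub>\<nu>\<close>
  are again a basis, and \<open>\<cc>\<^sub>\<nu>\<close> is \<open>m\<^sub>\<nu>\<close> plus terms \<open>m\<^sub>\<kappa>\<close> with fewer parts. As \<open>\<ff>\<^sub>l\<close> is the
  elementary symmetric function \<open>e\<^sub>l\<close> of the \<open>J\<^sub>b\<close>, and a monomial in \<open>m\<^sub>\<nu> e\<^sub>l\<close> has at least \<open>l\<close>
  variables, with exactly \<open>l\<close> only if \<open>1\<close> is added to every exponent, \<open>\<gg>\<^sub>\<pi>\<close> equals \<open>m\<^sub>\<pi>\<close> plus
  terms \<open>m\<^sub>\<rho>\<close> where \<open>\<rho>\<close> has more parts than \<open>\<pi>\<close>, or equally many but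
  \<open>\<rho> - \<one>\<close> has fewer parts than \<open>\<pi> - \<one>\<close>. Both changes of basis are unitriangular.
\<close>

section \<open>Orbits, transpositions and conjugacy\<close>

text \<open>The size \<open>2 * r\<close> is chosen because
  \<open>plength \<kappa> \<le> psize \<kappa>\<close>: every class of degree \<open>r\<close> is
  then nonempty, and all structure constants into degree \<open>r\<close> have reached their stable
  values. Graded identities become identities in one group ring modulo elements of smaller length.
  Two obstacles shape the rest. A single monomial in the \<open>JM b\<close> is in general not
  central, so coefficients can be compared class by class only once the symmetrized sums are known
  to commute with every permutation. And the structure constants are given by \<open>THE\<close>, so
  each must be identified with a number of factorizations of a fixed permutation; this number does
  not depend on \<open>n\<close>, because in a factorization with additive lengths both factors fix
  every point that the product fixes. The expansion of a class sum in the elements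
  \<open>mon\<close> holds only up to smaller length; after multiplication by \<open>len_sum\<close>
  this error is still below degree \<open>r\<close>, and the projection kills it. Ranks of
  partitions are natural numbers, so that both changes of basis are instances of the same two
  statements about families of vectors; the unit diagonal entries replace division.\<close>

lemma orbit_eq_of_mem:
  assumes "p permutes A" "finite A" "y \<in> orbit p x"
  shows "orbit p y = orbit p x"
  using orbit_cyclic_eq3[OF cyclic_on_orbit[OF assms(1,2)] assms(3)] .

lemma self_mem_orbit:
  assumes "p permutes A" "finite A"
  shows "x \<in> orbit p x"
  using assms permutation_permutes permutation_self_in_orbit by metis

lemma finite_orbit_permutes:
  assumes "p permutes A" "finite A"
  shows "finite (orbit p x)"
  by (rule finite_orbit[OF self_mem_orbit[OF assms]])

lemma orbit_disjoint_or_eq: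
  assumes "p permutes A" "finite A"
  shows "orbit p x \<inter> orbit p y = {} \<or> orbit p x = orbit p y"
  using orbit_eq_of_mem[OF assms] by blast

text \<open>The new permutation sends \<open>a\<close> to \<open>p b\<close> and then follows the
  \<open>p\<close>-cycle of \<open>b\<close> all the way round, since \<open>a\<close> does not lie
  on that cycle.\<close>

lemma orbit_comp_transpose_superset:
  assumes b: "b \<notin> orbit p a" and p: "p permutes A" "finite A"
  shows "orbit p b \<subseteq> orbit (p \<circ> transpose a b) a"
proof
  fix y assume "y \<in> orbit p b"
  then show "y \<in> orbit (p \<circ> transpose a b) a"
  proof induction
    case base
    have "p b = (p \<circ> transpose a b) a" by simp
    then show ?case using orbit.base by metis
  next
    case (step y)
    show ?case
    proof (cases "y = b")
      case True
      have "p b = (p \<circ> transpose a b) a" by simp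
      then show ?thesis using orbit.base True by metis
    next
      case False
      have "y \<noteq> a"
        using step.hyps b orbit_eq_of_mem[OF p] self_mem_orbit[OF p] by metis
      with False have "p y = (p \<circ> transpose a b) y" by simp
      then show ?thesis using orbit.step[OF step.IH] by metis
    qed
  qed
qed

lemma orbit_comp_transpose_merge:
  assumes p: "p permutes A" "finite A" and ab: "a \<in> A" "b \<in> A" and b: "b \<notin> orbit p a"
  shows "orbit (p \<circ> transpose a b) a = orbit p a \<union> orbit p b"
    and "orbit (p \<circ> transpose a b) b = orbit p a \<union> orbit p b"
proof -
  let ?q = "p \<circ> transpose a b"
  have q: "?q permutes A"
    using p(1) permutes_compose[OF permutes_swap_id[OF ab]] by blast
  have a: "a \<notin> orbit p b"
    using b orbit_eq_of_mem[OF p] self_mem_orbit[OF p] by metis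
  have 1: "orbit p b \<subseteq> orbit ?q a"
    by (rule orbit_comp_transpose_superset[OF b p])
  have 2: "orbit p a \<subseteq> orbit ?q b"
    using orbit_comp_transpose_superset[OF a p] by (simp add: transpose_commute)
  have 3: "orbit ?q a = orbit ?q b"
    using 1 self_mem_orbit[OF p] orbit_eq_of_mem[OF q p(2)] by blast
  have "orbit ?q a \<subseteq> orbit p a \<union> orbit p b"
  proof
    fix y assume "y \<in> orbit ?q a"
    then show "y \<in> orbit p a \<union> orbit p b"
    proof induction
      case base
      then show ?case by (auto intro: orbit.base)
    next
      case (step y)
      then show ?case
        by (cases "y = a"; cases "y = b") (auto intro: orbit.intros)
    qed
  qed
  with 1 2 3 show "orbit ?q a = orbit p a \<union> orbit p b"
    and "orbit ?q b = orbit p a \<union> orbit p b" by auto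
qed

lemma orbit_comp_transpose_other:
  assumes p: "p permutes A" "finite A" and x: "x \<notin> orbit p a" "x \<notin> orbit p b"
  shows "orbit (p \<circ> transpose a b) x = orbit p x"
proof (rule orbit_cong)
  show "x \<in> orbit p x" by (rule self_mem_orbit[OF p])
  fix s assume "s \<in> orbit p x"
  then have "s \<noteq> a" "s \<noteq> b"
    using x orbit_eq_of_mem[OF p] self_mem_orbit[OF p] by metis+
  then show "(p \<circ> transpose a b) s = p s" by simp
qed

text \<open>The arc of the cycle from \<open>p a\<close> to \<open>b\<close> is closed up by the
  transposition, which sends \<open>b\<close> back to \<open>p a\<close>; the point \<open>a\<close>
  stays outside the arc.\<close>

lemma orbit_comp_transpose_split:
  assumes p: "p permutes A" "finite A" and ab: "a \<in> A" "b \<in> A" "a \<noteq> b" and b: "b \<in> orbit p a"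
  shows "b \<notin> orbit (p \<circ> transpose a b) a"
proof -
  let ?q = "p \<circ> transpose a b"
  have q: "?q permutes A"
    using p(1) permutes_compose[OF permutes_swap_id[OF ab(1,2)]] by blast
  define k where "k = (LEAST k. 0 < k \<and> (p ^^ k) a = b)"
  have ex: "\<exists>k. 0 < k \<and> (p ^^ k) a = b" using b by (auto simp: orbit_altdef)
  have k: "0 < k" "(p ^^ k) a = b"
    unfolding k_def using LeastI_ex[OF ex] by auto
  have least: "k \<le> j" if "0 < j" "(p ^^ j) a = b" for j
    unfolding k_def using that by (intro Least_le) auto
  \<comment> \<open>\<open>k\<close> is the first time at which \<open>b\<close> is reached from
    \<open>a\<close>; by minimality the arc does not return to \<open>a\<close> before
    \<open>b\<close>.\<close>
  define Y where "Y = (\<lambda>i. (p ^^ i) a) ` {1..k}"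
  have aY: "a \<notin> Y"
  proof
    assume "a \<in> Y"
    then obtain i where i: "1 \<le> i" "i \<le> k" "(p ^^ i) a = a" by (auto simp: Y_def)
    have "i \<noteq> k" using i k ab by auto
    then have "i < k" using i by simp
    have "(p ^^ (k - i)) ((p ^^ i) a) = (p ^^ k) a"
      using i(2) by (metis comp_apply funpow_add le_add_diff_inverse2)
    then have "(p ^^ (k - i)) a = b" using i k by simp
    with least[of "k - i"] \<open>i < k\<close> i show False by simp
  qed
  have closed: "?q y \<in> Y" if "y \<in> Y" for y
  proof -
    from that obtain i where i: "1 \<le> i" "i \<le> k" "y = (p ^^ i) a" by (auto simp: Y_def)
    show ?thesis
    proof (cases "y = b")
      case True
      then have "?q y = (p ^^ 1) a" by simp
      then show ?thesis unfolding Y_def using k(1) by (intro image_eqI[of _ _ 1]) auto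
    next
      case False
      have "y \<noteq> a" using that aY by blast
      with False have "?q y = (p ^^ Suc i) a" using i by simp
      moreover have "i \<noteq> k" using False i k by auto
      ultimately show ?thesis using i unfolding Y_def by (intro image_eqI[of _ _ "Suc i"]) auto
    qed
  qed
  have bY: "b \<in> Y" using k by (force simp: Y_def)
  have "orbit ?q b \<subseteq> Y"
  proof
    fix y assume "y \<in> orbit ?q b"
    then show "y \<in> Y"
    proof induction
      case base
      show ?case by (rule closed[OF bY])
    next
      case (step y)
      show ?case by (rule closed[OF step.IH])
    qed
  qed
  then have "a \<notin> orbit ?q b" using aY by blast
  then show ?thesis using orbit_eq_of_mem[OF q p(2)] self_mem_orbit[OF q p(2)] by metis
qed

lemma comp_transpose_permutes:
  assumes "p permutes A" "a \<in> A" "b \<in> A"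
  shows "p \<circ> transpose a b permutes A"
  by (rule permutes_compose[OF permutes_swap_id[OF assms(2,3)] assms(1)])

lemma cycle_type_comp_transpose:
  assumes p: "p permutes {1..n}" and ab: "a \<in> {1..n}" "b \<in> {1..n}" and b: "b \<notin> orbit p a"
  shows "\<exists>M. cycle_type n p = add_mset (card (orbit p a)) (add_mset (card (orbit p b)) M) \<and>
             cycle_type n (p \<circ> transpose a b) = add_mset (card (orbit p a) + card (orbit p b)) M"
proof -
  let ?A = "{1..n}" and ?q = "p \<circ> transpose a b"
  have f: "finite {1..n}" by simp
  note P = p f
  have q: "?q permutes ?A" by (rule comp_transpose_permutes[OF p ab])
  have ne: "orbit p a \<noteq> orbit p b" using b self_mem_orbit[OF P] by metis
  have dj: "orbit p a \<inter> orbit p b = {}" using orbit_disjoint_or_eq[OF P] ne by metis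
  \<comment> \<open>The cycles that avoid both \<open>a\<close> and \<open>b\<close> are common to
    the two permutations, and their lengths form the remainder \<open>M\<close>.\<close>
  define R where "R = orbit p ` {x \<in> ?A. x \<notin> orbit p a \<and> x \<notin> orbit p b}"
  have 1: "orbit p ` ?A = insert (orbit p a) (insert (orbit p b) R)"
  proof -
    have "orbit p x \<in> insert (orbit p a) (insert (orbit p b) R)" if "x \<in> ?A" for x
      using that orbit_eq_of_mem[OF P, of x] unfolding R_def by auto
    moreover have "R \<subseteq> orbit p ` ?A" unfolding R_def by (intro image_mono) blast
    ultimately show ?thesis using ab by (intro subset_antisym) (simp_all add: image_subset_iff del: atLeastAtMost_iff)
  qed
  have out: "x \<in> orbit p a \<Longrightarrow> orbit ?q x = orbit p a \<union> orbit p b"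
            "x \<in> orbit p b \<Longrightarrow> orbit ?q x = orbit p a \<union> orbit p b" for x
    using orbit_eq_of_mem[OF q f, of x] orbit_comp_transpose_merge[OF P ab b] by auto
  have 2: "orbit ?q ` ?A = insert (orbit p a \<union> orbit p b) R"
  proof
    show "orbit ?q ` ?A \<subseteq> insert (orbit p a \<union> orbit p b) R"
    proof
      fix X assume "X \<in> orbit ?q ` ?A"
      then obtain x where x: "x \<in> ?A" "X = orbit ?q x" by blast
      show "X \<in> insert (orbit p a \<union> orbit p b) R"
      proof (cases "x \<in> orbit p a \<or> x \<in> orbit p b")
        case True
        then show ?thesis using out x by auto
      next
        case False
        then have "X = orbit p x" using x orbit_comp_transpose_other[OF P, of x a b] by simp
        then show ?thesis using False x(1) unfolding R_def by blast
      qed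
    qed
    have "orbit p a \<union> orbit p b \<in> orbit ?q ` ?A"
      using orbit_comp_transpose_merge(1)[OF P ab b] ab by blast
    moreover have "R \<subseteq> orbit ?q ` ?A"
      using orbit_comp_transpose_other[OF P, of _ a b] unfolding R_def
      by (auto simp del: atLeastAtMost_iff intro: image_eqI[OF sym])
    ultimately show "insert (orbit p a \<union> orbit p b) R \<subseteq> orbit ?q ` ?A" by blast
  qed
  have Rx: "orbit p a \<notin> R" "orbit p b \<notin> R" "orbit p a \<union> orbit p b \<notin> R"
    using self_mem_orbit[OF P] unfolding R_def by auto
  have fR: "finite R" unfolding R_def by simp
  have card: "card (orbit p a \<union> orbit p b) = card (orbit p a) + card (orbit p b)"
    using dj finite_orbit_permutes[OF P] by (simp add: card_Un_disjoint)
  show ?thesis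
    by (rule exI[of _ "image_mset card (mset_set R)"])
       (use 1 2 Rx fR ne card in \<open>simp add: cycle_type_def\<close>)
qed

lemma sum_cycle_type:
  assumes "p permutes {1..n}"
  shows "sum_mset (cycle_type n p) = n"
proof -
  have P: "p permutes {1..n}" "finite {1..n}" using assms by auto
  have "sum_mset (cycle_type n p) = (\<Sum>X\<in>orbit p ` {1..n}. card X)"
    by (simp add: cycle_type_def sum_unfold_sum_mset)
  also have "\<dots> = card (\<Union>(orbit p ` {1..n}))"
    by (rule card_Union_disjoint[symmetric])
       (use orbit_disjoint_or_eq[OF P] finite_orbit_permutes[OF P] in \<open>auto simp: pairwise_def disjnt_def\<close>)
  also have "\<Union>(orbit p ` {1..n}) = {1..n}"
    using permutes_orbit_subset[OF assms] self_mem_orbit[OF P] by fast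
  finally show ?thesis by simp
qed

lemma zero_notin_cycle_type:
  assumes "p permutes {1..n}"
  shows "0 \<notin># cycle_type n p"
proof -
  have P: "p permutes {1..n}" "finite {1..n}" using assms by auto
  have "0 < card (orbit p x)" for x
    using finite_orbit_permutes[OF P, of x] orbit_nonempty[of p x] by (simp add: card_gt_0_iff)
  then have "0 \<notin> card ` orbit p ` {1..n}" by (metis imageE less_irrefl)
  then show ?thesis by (simp add: cycle_type_def)
qed

section \<open>Conjugacy and equality of cycle types\<close>

lemma card_preserving_bij:
  assumes "finite P" "finite Q" "image_mset g (mset_set P) = image_mset h (mset_set Q)"
  shows "\<exists>f. bij_betw f P Q \<and> (\<forall>x\<in>P. h (f x) = g x)"
  using assms
proof (induction P arbitrary: Q rule: finite_induct)
  case empty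
  then have "Q = {}" by (simp add: mset_set_empty_iff)
  then show ?case by (simp add: bij_betw_def)
next
  case (insert x P)
  then have "g x \<in># image_mset h (mset_set Q)" by (metis (no_types) finite.insertI finite_set_mset_mset_set image_eqI insertI1 set_image_mset)
  then obtain y where y: "y \<in> Q" "h y = g x" using insert.prems(1) by auto
  define Q' where "Q' = Q - {y}"
  have Q: "Q = insert y Q'" "y \<notin> Q'" "finite Q'" using y insert.prems(1) by (auto simp: Q'_def)
  have "image_mset g (mset_set P) = image_mset h (mset_set Q')"
    using insert.prems(2) insert.hyps Q y by simp
  from insert.IH[OF Q(3) this] obtain f where f: "bij_betw f P Q'" "\<forall>x\<in>P. h (f x) = g x" by blast
  have "bij_betw (f(x := y)) P Q'"
    using f(1) insert.hyps(2) by (subst bij_betw_cong[of P _ f]) auto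
  then have "bij_betw (f(x := y)) (insert x P) (insert y Q')"
    using notIn_Un_bij_betw[of x P "f(x := y)" Q'] insert.hyps(2) Q(2) by simp
  moreover have "\<forall>z\<in>insert x P. h ((f(x := y)) z) = g z" using f(2) y(2) by simp
  ultimately show ?case unfolding Q(1) by blast
qed

lemma funpow_eq_iff_mod_card_orbit:
  assumes p: "p permutes A" "finite A"
  shows "(p ^^ i) x = (p ^^ j) x \<longleftrightarrow> i mod card (orbit p x) = j mod card (orbit p x)"
proof -
  have x: "x \<in> orbit p x" by (rule self_mem_orbit[OF p])
  define d where "d = funpow_dist1 p x x"
  have d: "(p ^^ d) x = x" "0 < d" unfolding d_def using funpow_dist1_prop[OF x] by auto
  have inj: "inj_on (\<lambda>n. (p ^^ n) x) {0..<d}"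
    unfolding d_def by (rule inj_on_funpow_dist1[OF x])
  have "orbit p x = (\<lambda>n. (p ^^ n) x) ` {0..<d}"
    using orbit_altdef_bounded[OF d] by auto
  then have c: "card (orbit p x) = d" using card_image[OF inj] by simp
  have m: "(p ^^ i) x = (p ^^ (i mod d)) x" for i
    using funpow_mod_eq[OF d(1)] by metis
  show ?thesis
    unfolding c using inj_onD[OF inj, of "i mod d" "j mod d"] m d(2) by (metis atLeastLessThan_iff mod_less_divisor zero_le)
qed

text \<open>The conjugator writes the cycles of \<open>p\<close> above cycles of \<open>q\<close> of
  the same length: \<open>f\<close> matches the cycles, \<open>bs\<close> picks a base point on
  each, and the \<open>i\<close>-th iterate of a base point goes to the \<open>i\<close>-th iterate
  of the matched one.\<close>

lemma conjugate_of_cycle_type_eq: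
  assumes p: "p permutes {1..n}" and q: "q permutes {1..n}" and ct: "cycle_type n p = cycle_type n q"
  shows "\<exists>\<sigma>. \<sigma> permutes {1..n} \<and> \<sigma> \<circ> p = q \<circ> \<sigma>"
proof -
  let ?A = "{1..n}"
  have P: "p permutes ?A" "finite ?A" and Q: "q permutes ?A" "finite ?A" using p q by auto
  obtain f where f: "bij_betw f (orbit p ` ?A) (orbit q ` ?A)"
    and fc: "\<And>X. X \<in> orbit p ` ?A \<Longrightarrow> card (f X) = card X"
    using card_preserving_bij[of "orbit p ` ?A" "orbit q ` ?A" card card] ct
    by (auto simp: cycle_type_def)
  define bs where "bs X = (SOME x. x \<in> X)" for X :: "nat set"
  have bs: "bs (orbit g x) \<in> orbit g x" for g x
    unfolding bs_def by (rule someI_ex) (use orbit_nonempty in fast)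
  define idx where "idx y = (SOME i. (p ^^ i) (bs (orbit p y)) = y)" for y
  have idx: "(p ^^ idx y) (bs (orbit p y)) = y" for y
  proof -
    have "orbit p (bs (orbit p y)) = orbit p y" by (rule orbit_eq_of_mem[OF P bs])
    then have "y \<in> orbit p (bs (orbit p y))" using self_mem_orbit[OF P] by simp
    then have "\<exists>i. y = (p ^^ i) (bs (orbit p y))" unfolding orbit_altdef[of p "bs (orbit p y)"] by blast
    then have "\<exists>i. (p ^^ i) (bs (orbit p y)) = y" by metis
    then show ?thesis unfolding idx_def by (rule someI_ex)
  qed
  define s where "s y = (if y \<in> ?A then (q ^^ idx y) (bs (f (orbit p y))) else y)" for y
  have fo: "f (orbit p y) \<in> orbit q ` ?A" if "y \<in> ?A" for y
    using bij_betw_apply[OF f] that by blast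
  have bf: "bs (f (orbit p y)) \<in> f (orbit p y)" "orbit q (bs (f (orbit p y))) = f (orbit p y)" if "y \<in> ?A" for y
  proof -
    have "f (orbit p y) \<in> orbit q ` ?A" by (rule fo[OF that])
    then obtain z where "f (orbit p y) = orbit q z" by blast
    then show "bs (f (orbit p y)) \<in> f (orbit p y)" "orbit q (bs (f (orbit p y))) = f (orbit p y)"
      using bs[of q z] orbit_eq_of_mem[OF Q bs[of q z]] by simp_all
  qed
  have so: "s y \<in> f (orbit p y)" if "y \<in> ?A" for y
    using that funpow_in_orbit[OF self_mem_orbit[OF Q], of "idx y" "bs (f (orbit p y))"] bf(2)[OF that]
    by (simp add: s_def del: atLeastAtMost_iff)
  have foA: "f (orbit p y) \<subseteq> ?A" if "y \<in> ?A" for y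
    using fo[OF that] permutes_orbit_subset[OF q] by blast
  \<comment> \<open>The exponent \<open>idx\<close> is an arbitrary choice. Equal cycle lengths make
    exponents agree on one cycle exactly when they agree on the matched one, which gives both
    injectivity and the intertwining relation.\<close>
  have key: "(p ^^ i) (bs (orbit p y)) = (p ^^ j) (bs (orbit p y)) \<longleftrightarrow>
        (q ^^ i) (bs (f (orbit p y))) = (q ^^ j) (bs (f (orbit p y)))" if "y \<in> ?A" for i j y
    unfolding funpow_eq_iff_mod_card_orbit[OF P] funpow_eq_iff_mod_card_orbit[OF Q]
      orbit_eq_of_mem[OF P bs] bf(2)[OF that] fc[OF imageI[OF that]] by (rule refl)
  have inj: "inj_on s ?A"
  proof
    fix y z assume yz: "y \<in> ?A" "z \<in> ?A" "s y = s z"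
    obtain y' z' where yz': "f (orbit p y) = orbit q y'" "f (orbit p z) = orbit q z'"
      using fo[OF yz(1)] fo[OF yz(2)] by blast
    have "orbit q (s y) = f (orbit p y)" "orbit q (s y) = f (orbit p z)"
      unfolding yz' using so[OF yz(1)] so[OF yz(2)] yz(3) yz' by (auto intro!: orbit_eq_of_mem[OF Q])
    then have "f (orbit p y) = f (orbit p z)" by simp
    then have o: "orbit p y = orbit p z"
      using bij_betw_imp_inj_on[OF f] yz(1,2) by (meson imageI inj_onD)
    then have "(q ^^ idx y) (bs (f (orbit p y))) = (q ^^ idx z) (bs (f (orbit p y)))"
      using yz by (simp add: s_def del: atLeastAtMost_iff)
    then have "(p ^^ idx y) (bs (orbit p y)) = (p ^^ idx z) (bs (orbit p y))"
      using key[OF yz(1)] by simp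
    then show "y = z" using idx o by metis
  qed
  have "s ` ?A \<subseteq> ?A" using so foA by blast
  then have "bij_betw s ?A ?A" using inj by (simp add: bij_betw_def endo_inj_surj)
  then have sp: "s permutes ?A" by (rule bij_imp_permutes) (auto simp: s_def)
  moreover have "s \<circ> p = q \<circ> s"
  proof
    fix y
    show "(s \<circ> p) y = (q \<circ> s) y"
    proof (cases "y \<in> ?A")
      case False
      then show ?thesis using p q by (simp add: s_def permutes_not_in del: atLeastAtMost_iff)
    next
      case True
      have pA: "p y \<in> ?A" using p True by (simp add: permutes_in_image del: atLeastAtMost_iff)
      have o: "orbit p (p y) = orbit p y"
        by (rule orbit_eq_of_mem[OF P orbit.base])
      have "(p ^^ idx (p y)) (bs (orbit p y)) = (p ^^ Suc (idx y)) (bs (orbit p y))"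
        using idx[of "p y"] idx[of y] o by simp
      then have "(q ^^ idx (p y)) (bs (f (orbit p y))) = (q ^^ Suc (idx y)) (bs (f (orbit p y)))"
        unfolding key[OF True] .
      then show ?thesis using True pA o by (simp add: s_def del: atLeastAtMost_iff)
    qed
  qed
  ultimately show ?thesis by blast
qed

lemma cycle_type_conjugate:
  assumes p: "p permutes {1..n}" and q: "q permutes {1..n}"
    and s: "\<sigma> permutes {1..n}" "\<sigma> \<circ> p = q \<circ> \<sigma>"
  shows "cycle_type n p = cycle_type n q"
proof -
  let ?A = "{1..n}"
  have i: "inj \<sigma>" using s(1) permutes_inj by blast
  have fp: "\<sigma> ((p ^^ k) x) = (q ^^ k) (\<sigma> x)" for k x
  proof (induction k)
    case (Suc k)
    have "\<sigma> (p z) = q (\<sigma> z)" for z using s(2) by (metis comp_apply)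
    then show ?case using Suc by simp
  qed simp
  have o: "orbit q (\<sigma> x) = \<sigma> ` orbit p x" for x
  proof -
    have "orbit q (\<sigma> x) = {\<sigma> ((p ^^ k) x) |k. 0 < k}" unfolding orbit_altdef fp ..
    also have "\<dots> = \<sigma> ` orbit p x" unfolding orbit_altdef by blast
    finally show ?thesis .
  qed
  have "orbit q ` ?A = orbit q ` \<sigma> ` ?A" using permutes_image[OF s(1)] by simp
  also have "\<dots> = (\<lambda>X. \<sigma> ` X) ` orbit p ` ?A" by (simp only: image_image o)
  finally have e: "orbit q ` ?A = (\<lambda>X. \<sigma> ` X) ` orbit p ` ?A" .
  have "inj_on (\<lambda>X. \<sigma> ` X) (orbit p ` ?A)" using i by (simp add: inj_on_def inj_image_eq_iff)
  then have m: "mset_set (orbit q ` ?A) = image_mset (\<lambda>X. \<sigma> ` X) (mset_set (orbit p ` ?A))"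
    unfolding e by (rule image_mset_mset_set[symmetric])
  have "card (\<sigma> ` X) = card X" for X
    by (rule card_image[OF inj_on_subset[OF i subset_UNIV]])
  then show ?thesis
    unfolding cycle_type_def m by (simp add: image_mset.compositionality comp_def)
qed

section \<open>Length of a permutation\<close>

definition red_type :: "nat \<Rightarrow> (nat \<Rightarrow> nat) \<Rightarrow> nat multiset" where
  "red_type n p = decrement_parts (cycle_type n p)"

text \<open>On permutations of \<open>{1..n}\<close> this is \<open>n\<close> minus the number of
  cycles, hence the least number of transpositions whose product is \<open>p\<close>.\<close>

definition perm_len :: "nat \<Rightarrow> (nat \<Rightarrow> nat) \<Rightarrow> nat" where
  "perm_len n p = sum_mset (red_type n p)"

text \<open>The contribution of a cycle of length \<open>k + 1\<close> to the reduced type; a fixed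
  point leaves no part.\<close>

abbreviation atom :: "nat \<Rightarrow> nat multiset" where
  "atom k \<equiv> (if k = 0 then {#} else {#k#})"

lemma parts_reduced_cycle_type: "parts (reduced_cycle_type n p) = red_type n p"
  by (simp add: reduced_cycle_type.rep_eq red_type_def)

lemma psize_reduced_cycle_type: "psize (reduced_cycle_type n p) = perm_len n p"
  by (simp add: psize.rep_eq parts_reduced_cycle_type perm_len_def)

lemma plength_reduced_cycle_type: "plength (reduced_cycle_type n p) = size (red_type n p)"
  by (simp add: plength.rep_eq parts_reduced_cycle_type)

lemma decrement_parts_add_mset: "decrement_parts (add_mset k M) = atom (k - 1) + decrement_parts M"
  by (simp add: decrement_parts_def)

lemma card_orbit_pos:
  assumes "p permutes A" "finite A"
  shows "0 < card (orbit p x)"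
  using finite_orbit_permutes[OF assms] orbit_nonempty[of p x] by (simp add: card_gt_0_iff)

lemma card_orbit_eq_1_iff:
  assumes "p permutes A" "finite A"
  shows "card (orbit p x) = 1 \<longleftrightarrow> p x = x"
proof
  assume "card (orbit p x) = 1"
  then have "orbit p x = {x}" using self_mem_orbit[OF assms, of x] by (auto simp: card_1_singleton_iff)
  then show "p x = x" by (simp add: orbit_eq_singleton_iff)
next
  assume "p x = x"
  then have "orbit p x = {x}" by (simp add: orbit_eq_singleton_iff)
  then show "card (orbit p x) = 1" by simp
qed

text \<open>Cycles of lengths \<open>x + 1\<close> and \<open>y + 1\<close> join to length
  \<open>x + y + 2\<close>, with reduced part \<open>x + y + 1\<close>. This part is never zero,
  while the two old ones may be, whence \<open>atom\<close> on one side only.\<close>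

lemma red_type_merge:
  assumes p: "p permutes {1..n}" and ab: "a \<in> {1..n}" "b \<in> {1..n}" and b: "b \<notin> orbit p a"
  shows "\<exists>M. red_type n p = atom (card (orbit p a) - 1) + atom (card (orbit p b) - 1) + M \<and>
             red_type n (p \<circ> transpose a b) = add_mset (card (orbit p a) + card (orbit p b) - 1) M"
proof -
  have f: "finite {1..n}" by simp
  have "card (orbit p a) + card (orbit p b) - 1 \<noteq> 0"
    using card_orbit_pos[OF p f, of a] card_orbit_pos[OF p f, of b] by linarith
  then show ?thesis
    using cycle_type_comp_transpose[OF assms]
    by (auto simp: red_type_def decrement_parts_add_mset ac_simps)
qed

lemma perm_len_merge:
  assumes p: "p permutes {1..n}" and ab: "a \<in> {1..n}" "b \<in> {1..n}" and b: "b \<notin> orbit p a"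
  shows "perm_len n (p \<circ> transpose a b) = Suc (perm_len n p)"
proof -
  have f: "finite {1..n}" by simp
  obtain M where "red_type n p = atom (card (orbit p a) - 1) + atom (card (orbit p b) - 1) + M"
    "red_type n (p \<circ> transpose a b) = add_mset (card (orbit p a) + card (orbit p b) - 1) M"
    using red_type_merge[OF assms] by blast
  moreover obtain x y where "card (orbit p a) = Suc x" "card (orbit p b) = Suc y"
    using card_orbit_pos[OF p f, of a] card_orbit_pos[OF p f, of b] gr0_implies_Suc by metis
  ultimately show ?thesis by (simp add: perm_len_def)
qed

lemma perm_len_split:
  assumes p: "p permutes {1..n}" and ab: "a \<in> {1..n}" "b \<in> {1..n}" "a \<noteq> b" and b: "b \<in> orbit p a"
  shows "perm_len n p = Suc (perm_len n (p \<circ> transpose a b))"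
proof -
  let ?q = "p \<circ> transpose a b"
  have "b \<notin> orbit ?q a" by (rule orbit_comp_transpose_split[OF p _ ab b]) simp
  from perm_len_merge[OF comp_transpose_permutes[OF p ab(1,2)] ab(1,2) this]
  show ?thesis by (simp add: comp_assoc)
qed

lemma perm_len_comp_transpose_le:
  assumes p: "p permutes {1..n}" and ab: "a \<in> {1..n}" "b \<in> {1..n}"
  shows "perm_len n (p \<circ> transpose a b) \<le> Suc (perm_len n p)"
proof (cases "a = b")
  case False
  then show ?thesis
    using perm_len_merge[OF assms] perm_len_split[OF assms(1,2,3)] by (cases "b \<in> orbit p a") auto
qed simp

lemma not_mem_orbit_of_perm_len:
  assumes p: "p permutes {1..n}" and ab: "a \<in> {1..n}" "b \<in> {1..n}" "a \<noteq> b"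
    and l: "perm_len n (p \<circ> transpose a b) = Suc (perm_len n p)"
  shows "b \<notin> orbit p a"
  using perm_len_split[OF assms(1-4)] l by auto

text \<open>The transposition turns \<open>a = p b\<close> into a fixed point and shortens the cycle
  of \<open>b\<close> by one. Inductions on length descend through this step.\<close>

lemma perm_len_detach:
  assumes p: "p permutes {1..n}" and b: "p b = a" "a \<noteq> b"
  shows "perm_len n p = Suc (perm_len n (p \<circ> transpose a b))"
proof -
  have f: "finite {1..n}" by simp
  have bn: "b \<in> {1..n}" using b permutes_not_in[OF p] by blast
  have an: "a \<in> {1..n}" using b(1) bn permutes_in_image[OF p, of b] by blast
  have "a \<in> orbit p b" using b(1) orbit.base by metis
  then have "b \<in> orbit p a" using orbit_eq_of_mem[OF p f] self_mem_orbit[OF p f] by metis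
  from perm_len_split[OF p an bn b(2) this] show ?thesis .
qed

lemma zero_notin_red_type: "0 \<notin># red_type n p"
  by (simp add: red_type_def decrement_parts_def)

section \<open>Subadditivity of the length, and products with additive lengths\<close>

lemma perm_len_id: "perm_len n id = 0"
proof -
  have "orbit (id::nat \<Rightarrow> nat) x = {x}" for x by (simp add: orbit_eq_singleton_iff)
  then show ?thesis by (simp add: perm_len_def red_type_def decrement_parts_def cycle_type_def)
qed

lemma perm_len_eq_0_iff:
  assumes p: "p permutes {1..n}"
  shows "perm_len n p = 0 \<longleftrightarrow> p = id"
proof
  assume "perm_len n p = 0"
  show "p = id"
  proof (rule ccontr)
    assume "p \<noteq> id"
    then obtain b where "p b \<noteq> b" by (auto simp: fun_eq_iff)
    from perm_len_detach[OF p refl this] \<open>perm_len n p = 0\<close> show False by simp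
  qed
qed (simp add: perm_len_id)

lemma perm_len_comp_le:
  assumes s: "s permutes {1..n}" and t: "t permutes {1..n}"
  shows "perm_len n (s \<circ> t) \<le> perm_len n s + perm_len n t"
  using t
proof (induction "perm_len n t" arbitrary: t)
  case 0
  then have "t = id" using perm_len_eq_0_iff by metis
  then show ?case by simp
next
  case (Suc k)
  have "t \<noteq> id" using Suc.hyps(2) by (auto simp: perm_len_id)
  then obtain b where tb: "t b \<noteq> b" by (auto simp: fun_eq_iff)
  let ?t = "t \<circ> transpose (t b) b"
  have bn: "b \<in> {1..n}" using tb permutes_not_in[OF Suc.prems] by blast
  have an: "t b \<in> {1..n}" using bn permutes_in_image[OF Suc.prems, of b] by blast
  have t': "?t permutes {1..n}" by (rule comp_transpose_permutes[OF Suc.prems an bn])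
  have k: "k = perm_len n ?t" using perm_len_detach[OF Suc.prems refl tb] Suc.hyps(2) by simp
  have st: "s \<circ> ?t permutes {1..n}" by (rule permutes_compose[OF t' s])
  have "s \<circ> t = (s \<circ> ?t) \<circ> transpose (t b) b" by (simp add: comp_assoc)
  then have "perm_len n (s \<circ> t) \<le> Suc (perm_len n (s \<circ> ?t))"
    using perm_len_comp_transpose_le[OF st an bn] by (simp only:)
  then show ?case using Suc.hyps(1)[OF k t'] k Suc.hyps(2) by simp
qed

text \<open>If \<open>t\<close> moved \<open>x\<close>, both factors could be shortened at
  \<open>x\<close> without changing the product: the point is detached from its cycle in
  \<open>s\<close> and in \<open>t\<close>. Subadditivity would then give a product shorter by two.
  This is the source of stability in \<open>n\<close>.\<close>

lemma fixed_of_comp_fixed: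
  assumes s: "s permutes {1..n}" and t: "t permutes {1..n}"
    and l: "perm_len n (s \<circ> t) = perm_len n s + perm_len n t" and x: "(s \<circ> t) x = x"
  shows "t x = x" "s x = x"
proof -
  show "t x = x"
  proof (rule ccontr)
    assume tx: "t x \<noteq> x"
    define y z where "y = t x" and "z = inv t x"
    have z: "t z = x" using permutes_inverses(1)[OF t] by (simp add: z_def)
    have zx: "x \<noteq> z" using z tx by auto
    have y: "s y = x" "x \<noteq> y" using x tx by (auto simp: y_def)
    have xn: "x \<in> {1..n}" using tx permutes_not_in[OF t] by blast
    have yn: "y \<in> {1..n}" using y permutes_not_in[OF s, of y] by metis
    have zn: "z \<in> {1..n}" using z zx permutes_not_in[OF t, of z] by metis
    let ?t = "t \<circ> transpose x z" and ?s = "s \<circ> transpose x y"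
    have "?s \<circ> ?t = s \<circ> t"
    proof
      fix u
      have "transpose x y (t (transpose x z u)) = t u"
        using z permutes_inj[OF t] unfolding y_def by (auto simp: transpose_def inj_eq split: if_splits)
      then show "(?s \<circ> ?t) u = (s \<circ> t) u" by simp
    qed
    moreover have "perm_len n (?s \<circ> ?t) \<le> perm_len n ?s + perm_len n ?t"
      by (intro perm_len_comp_le comp_transpose_permutes s t xn yn zn)
    ultimately show False
      using perm_len_detach[OF s y] perm_len_detach[OF t z zx] l by simp
  qed
  with x show "s x = x" by simp
qed

section \<open>Independence of \<open>n\<close>, and existence of permutations of a given reduced
  type\<close>

lemma red_type_Suc:
  assumes p: "p permutes {1..n}"
  shows "red_type (Suc n) p = red_type n p"
proof -
  have f: "finite {1..n}" by simp
  have "Suc n \<notin> {1..n}" by simp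
  then have "p (Suc n) = Suc n" using permutes_not_in[OF p] by blast
  then have o: "orbit p (Suc n) = {Suc n}" by (simp add: orbit_eq_singleton_iff)
  have "{Suc n} \<noteq> orbit p x" if "x \<in> {1..n}" for x
    using self_mem_orbit[OF p f, of x] that by (metis \<open>Suc n \<notin> {1..n}\<close> singletonD)
  then have "{Suc n} \<notin> orbit p ` {1..n}" by blast
  then have "cycle_type (Suc n) p = add_mset 1 (cycle_type n p)"
    unfolding cycle_type_def by (simp add: atLeastAtMostSuc_conv o)
  then show ?thesis by (simp add: red_type_def decrement_parts_add_mset)
qed

lemma permutes_mono_interval:
  assumes "p permutes {1..m}" "m \<le> n"
  shows "p permutes {1..(n::nat)}"
  by (rule permutes_subset[OF assms(1)]) (use assms(2) in auto)

lemma red_type_mono: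
  assumes "p permutes {1..m}" "m \<le> n"
  shows "red_type n p = red_type m p"
  using assms(2)
proof (induction n rule: dec_induct)
  case (step k)
  then show ?case using red_type_Suc[OF permutes_mono_interval[OF assms(1), of k]] by simp
qed simp

lemma reduced_cycle_type_mono:
  assumes "p permutes {1..m}" "m \<le> n"
  shows "reduced_cycle_type n p = reduced_cycle_type m p"
  using red_type_mono[OF assms] by (simp add: parts_inject[symmetric] parts_reduced_cycle_type)

lemma red_type_add_cycle:
  assumes w: "w permutes {1..m}"
  shows "\<exists>w'. w' permutes {1..m + k + 1} \<and> card (orbit w' (m + 1)) = k + 1 \<and>
    red_type (m + k + 1) w' = atom k + red_type m w"
proof (induction k)
  case 0
  have "w permutes {1..m + 1}" by (rule permutes_mono_interval[OF w]) simp
  moreover have "w (m + 1) = m + 1" using permutes_not_in[OF w] by simp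
  ultimately show ?case using red_type_Suc[OF w] card_orbit_eq_1_iff[of w "{1..m+1}" "m+1"] by auto
next
  case (Suc k)
  then obtain u where u: "u permutes {1..m + k + 1}" "card (orbit u (m + 1)) = k + 1"
    "red_type (m + k + 1) u = atom k + red_type m w" by blast
  let ?N = "m + Suc k + 1"
  have N: "u permutes {1..?N}" by (rule permutes_mono_interval[OF u(1)]) simp
  have fixed: "u ?N = ?N" by (rule permutes_not_in[OF u(1)]) simp
  then have oN: "orbit u ?N = {?N}" by (simp add: orbit_eq_singleton_iff)
  have nin: "?N \<notin> orbit u (m + 1)"
    using permutes_orbit_subset[OF u(1), of "m + 1"] by auto
  have in1: "m + 1 \<in> {1..?N}" "?N \<in> {1..?N}" by auto
  let ?v = "u \<circ> transpose (m + 1) ?N"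
  have "orbit ?v (m + 1) = orbit u (m + 1) \<union> orbit u ?N"
    by (rule orbit_comp_transpose_merge(1)[OF N _ in1 nin]) simp
  then have c: "card (orbit ?v (m + 1)) = Suc k + 1"
    using u(2) oN nin finite_orbit_permutes[OF N] by simp
  obtain M where M: "red_type ?N u = atom (card (orbit u (m + 1)) - 1) + atom (card (orbit u ?N) - 1) + M"
    "red_type ?N ?v = add_mset (card (orbit u (m + 1)) + card (orbit u ?N) - 1) M"
    using red_type_merge[OF N in1 nin] by blast
  have "red_type ?N u = atom k + red_type m w" using u(3) red_type_Suc[OF u(1)] by simp
  moreover have "red_type ?N u = atom k + M" using M(1) unfolding u(2) oN by simp
  ultimately have "M = red_type m w" by simp
  then have "red_type ?N ?v = atom (Suc k) + red_type m w" using M(2) unfolding u(2) oN by simp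
  then show ?case using c comp_transpose_permutes[OF N in1] by blast
qed

text \<open>A reduced part \<open>k\<close> occupies \<open>k + 1\<close> points, so
  \<open>sum_mset P + size P\<close> points are just enough.\<close>

lemma exists_perm_of_red_type:
  assumes "0 \<notin># P" "sum_mset P + size P \<le> n"
  shows "\<exists>w. w permutes {1..n} \<and> red_type n w = P"
proof -
  have "\<exists>w. w permutes {1..sum_mset P + size P} \<and> red_type (sum_mset P + size P) w = P"
    using assms(1)
  proof (induction P)
    case empty
    show ?case
      by (rule exI[of _ id]) (simp add: red_type_def decrement_parts_def cycle_type_def id_def[symmetric])
  next
    case (add k P)
    then obtain w where w: "w permutes {1..sum_mset P + size P}" "red_type (sum_mset P + size P) w = P"
      by auto
    then show ?case using red_type_add_cycle[OF w(1), of k] add.prems by (auto simp: ac_simps)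
  qed
  then show ?thesis using red_type_mono[OF _ assms(2)] permutes_mono_interval[OF _ assms(2)] by metis
qed

lemma exists_perm_of_reduced_cycle_type:
  assumes "psize \<kappa> + plength \<kappa> \<le> n"
  shows "\<exists>w. w permutes {1..n} \<and> reduced_cycle_type n w = \<kappa>"
  using exists_perm_of_red_type[of "parts \<kappa>" n] assms parts[of \<kappa>]
  by (simp add: psize.rep_eq plength.rep_eq parts_inject[symmetric] parts_reduced_cycle_type)

lemma size_decrement_parts: "0 \<notin># P \<Longrightarrow> sum_mset (decrement_parts P) + size P = sum_mset P"
  by (induction P) (auto simp: decrement_parts_def)

text \<open>Only the parts equal to 1 are lost in passing to the reduced type, and the total size
  tells how many there were.\<close>

lemma cycle_type_eq_of_red_type:
  assumes "0 \<notin># P"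
  shows "P = image_mset Suc (decrement_parts P) + replicate_mset (sum_mset P - sum_mset (decrement_parts P) - size (decrement_parts P)) 1"
  using assms
proof (induction P)
  case (add k P)
  have le: "sum_mset (decrement_parts P) + size (decrement_parts P) \<le> sum_mset P"
    using add.prems size_decrement_parts[of P] size_filter_mset_lesseq[of _ "image_mset (\<lambda>k. k - 1) P"]
    by (simp add: decrement_parts_def) (metis add_le_cancel_left size_image_mset)
  show ?case
  proof (cases "k = 1")
    case True
    have "sum_mset (add_mset k P) - sum_mset (decrement_parts P) - size (decrement_parts P)
       = Suc (sum_mset P - sum_mset (decrement_parts P) - size (decrement_parts P))"
      using le True by simp
    then show ?thesis using add True by (simp add: decrement_parts_add_mset)
  next
    case False
    then have "k = Suc (k - 1)" "k - 1 \<noteq> 0" using add.prems by auto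
    then show ?thesis using add by (simp add: decrement_parts_add_mset)
  qed
qed (simp add: decrement_parts_def)

lemma cycle_type_eq_of_red_type_eq:
  assumes p: "p permutes {1..n}" and q: "q permutes {1..n}" and r: "red_type n p = red_type n q"
  shows "cycle_type n p = cycle_type n q"
  using cycle_type_eq_of_red_type[OF zero_notin_cycle_type[OF p]]
    cycle_type_eq_of_red_type[OF zero_notin_cycle_type[OF q]] r
    sum_cycle_type[OF p] sum_cycle_type[OF q]
  unfolding red_type_def by simp

lemma reduced_type_within:
  assumes p: "p permutes {1..n}"
  shows "reduced_cycle_type n p \<in> partitions_within n"
proof -
  have "size (red_type n p) \<le> size (cycle_type n p)"
    by (simp add: red_type_def decrement_parts_def) (metis size_filter_mset_lesseq size_image_mset)
  moreover have "perm_len n p + size (cycle_type n p) = n"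
    using size_decrement_parts[OF zero_notin_cycle_type[OF p]] sum_cycle_type[OF p]
    by (simp add: perm_len_def red_type_def)
  ultimately show ?thesis
    by (simp add: partitions_within_def psize_reduced_cycle_type plength_reduced_cycle_type)
qed

lemma conjugate_of_reduced_cycle_type_eq:
  assumes "p permutes {1..n}" "q permutes {1..n}" "reduced_cycle_type n p = reduced_cycle_type n q"
  shows "\<exists>\<sigma>. \<sigma> permutes {1..n} \<and> \<sigma> \<circ> p = q \<circ> \<sigma>"
proof (rule conjugate_of_cycle_type_eq[OF assms(1,2) cycle_type_eq_of_red_type_eq[OF assms(1,2)]])
  show "red_type n p = red_type n q"
    using assms(3) by (simp add: parts_reduced_cycle_type[symmetric])
qed

lemma reduced_cycle_type_conjugate:
  assumes "p permutes {1..n}" "q permutes {1..n}" "\<sigma> permutes {1..n}" "\<sigma> \<circ> p = q \<circ> \<sigma>"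
  shows "reduced_cycle_type n p = reduced_cycle_type n q"
  using cycle_type_conjugate[OF assms] by (simp add: parts_inject[symmetric] parts_reduced_cycle_type red_type_def)

section \<open>Jucys--Murphy elements\<close>

text \<open>
  The product of \<open>\<Rightarrow>\<^sub>0\<close> is convolution over an additive monoid, so composition is made
  the (noncommutative) addition of a copy of \<open>nat \<Rightarrow> nat\<close>.
\<close>

datatype endo = Endo "nat \<Rightarrow> nat"

instantiation endo :: monoid_add
begin

definition zero_endo :: endo where "0 = Endo id"

fun plus_endo :: "endo \<Rightarrow> endo \<Rightarrow> endo" where "Endo f + Endo g = Endo (f \<circ> g)"

instance
proof
  fix a b c :: endo
  show "a + b + c = a + (b + c)" by (cases a; cases b; cases c) (simp add: comp_assoc)
  show "0 + a = a" "a + 0 = a" by (cases a; simp add: zero_endo_def)+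
qed

end

type_synonym gring = "endo \<Rightarrow>\<^sub>0 int"

definition E :: "(nat \<Rightarrow> nat) \<Rightarrow> gring" where
  "E p = frag_of (Endo p)"

definition cf :: "gring \<Rightarrow> (nat \<Rightarrow> nat) \<Rightarrow> int" where
  "cf x w = poly_mapping.lookup x (Endo w)"

lemma gring_eqI: "(\<And>w. cf x w = cf y w) \<Longrightarrow> x = y"
  by (rule poly_mapping_eqI) (metis cf_def endo.exhaust)

lemma cf_add [simp]: "cf (x + y) w = cf x w + cf y w"
  and cf_diff [simp]: "cf (x - y) w = cf x w - cf y w"
  and cf_cmul [simp]: "cf (frag_cmul k x) w = k * cf x w"
  and cf_zero [simp]: "cf 0 w = 0"
  and cf_E: "cf (E p) w = (if p = w then 1 else 0)"
  by (simp_all add: cf_def lookup_add lookup_minus E_def)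

lemma cf_sum: "cf (sum f I) w = (\<Sum>i\<in>I. cf (f i) w)"
  by (simp add: cf_def lookup_sum)

lemma E_mult: "E p * E q = E (p \<circ> q)"
  by (simp add: E_def mult_single)

lemma E_id: "E id = 1"
  by (simp add: E_def zero_endo_def[symmetric])

lemma gring_expand: "x = (\<Sum>i\<in>Poly_Mapping.keys x. frag_cmul (poly_mapping.lookup x i) (frag_of i))"
  using frag_expansion[of x] by (simp add: frag_extend_def)

lemma frag_cmul_mult_left: "frag_cmul k x * y = frag_cmul k (x * y)" for x y :: gring
proof -
  have "frag_cmul k z = of_int k * z" for z :: gring
    by (induction k rule: int_induct[where k=0]) (simp_all add: frag_cmul_distrib frag_cmul_diff_distrib algebra_simps)
  then show ?thesis by (simp add: mult.assoc)
qed

lemma frag_cmul_mult_right: "x * frag_cmul k y = frag_cmul k (x * y)" for x y :: gring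
proof -
  have *: "frag_cmul k z = z * of_int k" for z :: gring
    by (induction k rule: int_induct[where k=0]) (simp_all add: frag_cmul_distrib frag_cmul_diff_distrib algebra_simps)
  show ?thesis by (simp add: * mult.assoc)
qed

lemma cf_mult_E:
  assumes "t \<circ> t' = id" "t' \<circ> t = id"
  shows "cf (x * E t) w = cf x (w \<circ> t')"
proof -
  have 1: "Endo w = i + Endo t \<longleftrightarrow> i = Endo (w \<circ> t')" for i
  proof (cases i)
    case (Endo p)
    have "p \<circ> t = w \<longleftrightarrow> p = w \<circ> t'"
      using assms by (metis comp_assoc comp_id)
    then show ?thesis using Endo by auto
  qed
  have "x * E t = (\<Sum>i\<in>Poly_Mapping.keys x. frag_cmul (poly_mapping.lookup x i) (frag_of (i + Endo t)))"
    by (subst (1) gring_expand) (simp add: sum_distrib_right frag_cmul_mult_left E_def mult_single)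
  then have "cf (x * E t) w = (\<Sum>i\<in>Poly_Mapping.keys x. if i = Endo (w \<circ> t') then poly_mapping.lookup x i else 0)"
    by (simp add: cf_def lookup_sum 1 if_distrib cong: if_cong)
  then show ?thesis by (simp add: cf_def in_keys_iff)
qed

lemma cf_E_mult:
  assumes "t \<circ> t' = id" "t' \<circ> t = id"
  shows "cf (E t * x) w = cf x (t' \<circ> w)"
proof -
  have 1: "Endo w = Endo t + i \<longleftrightarrow> i = Endo (t' \<circ> w)" for i
  proof (cases i)
    case (Endo p)
    have "t \<circ> p = w \<longleftrightarrow> p = t' \<circ> w"
      using assms by (metis comp_assoc id_comp)
    then show ?thesis using Endo by auto
  qed
  have "E t * x = (\<Sum>i\<in>Poly_Mapping.keys x. frag_cmul (poly_mapping.lookup x i) (frag_of (Endo t + i)))"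
    by (subst (1) gring_expand) (simp add: sum_distrib_left frag_cmul_mult_right E_def mult_single)
  then have "cf (E t * x) w = (\<Sum>i\<in>Poly_Mapping.keys x. if i = Endo (t' \<circ> w) then poly_mapping.lookup x i else 0)"
    by (simp add: cf_def lookup_sum 1 if_distrib cong: if_cong)
  then show ?thesis by (simp add: cf_def in_keys_iff)
qed

definition JM :: "nat \<Rightarrow> gring" where
  "JM b = (\<Sum>a\<in>{1..<b}. E (transpose a b))"

lemma cf_mult_JM: "cf (x * JM b) w = (\<Sum>a\<in>{1..<b}. cf x (w \<circ> transpose a b))"
  by (simp add: JM_def sum_distrib_left cf_sum cf_mult_E[OF transpose_comp_involutory transpose_comp_involutory])

lemma comp_transpose_bij:
  assumes "bij f"
  shows "f \<circ> transpose a b = transpose (f a) (f b) \<circ> f"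
  using transpose_comp_eq[OF assms, of "f a" "f b"] assms by (simp add: bij_is_inj)

text \<open>Conjugation by a transposition of points below \<open>c\<close> fixes \<open>c\<close>
  and only permutes the summands of \<open>JM c\<close>.\<close>

lemma E_transpose_commute_JM:
  assumes "1 \<le> a" "a < c" "1 \<le> b" "b < c"
  shows "E (transpose a b) * JM c = JM c * E (transpose a b)"
proof -
  let ?s = "transpose a b"
  have sc: "?s c = c" using assms by (simp add: transpose_def)
  have "?s \<circ> transpose d c = transpose (?s d) c \<circ> ?s" for d
    using comp_transpose_bij[OF bij_transpose, of a b d c] unfolding sc .
  then have "E ?s * JM c = (\<Sum>d\<in>{1..<c}. E (transpose (?s d) c) * E ?s)"
    unfolding JM_def sum_distrib_left E_mult by (simp only:)
  also have "\<dots> = (\<Sum>d\<in>{1..<c}. E (transpose d c) * E ?s)"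
  proof (rule sum.reindex_bij_betw[of ?s])
    have "?s permutes {1..<c}" by (rule permutes_swap_id) (use assms in auto)
    then show "bij_betw ?s {1..<c} {1..<c}" by (rule permutes_imp_bij)
  qed
  also have "\<dots> = JM c * E ?s" by (simp add: JM_def sum_distrib_right)
  finally show ?thesis .
qed

lemma JM_commute: "JM b * JM c = JM c * JM b"
proof -
  have *: "JM b * JM c = JM c * JM b" if "b < c" for b c
    unfolding JM_def[of b] sum_distrib_left sum_distrib_right
    by (rule sum.cong[OF refl]) (use that in \<open>auto intro!: E_transpose_commute_JM\<close>)
  show ?thesis using *[of b c] *[of c b] by (cases b c rule: linorder_cases) auto
qed

text \<open>Commutativity makes a product over a multiset of indices independent of the order of its
  factors.\<close>

global_interpretation JM: comp_fun_commute "\<lambda>b x. JM b * x"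
  by unfold_locales (simp add: fun_eq_iff mult.assoc[symmetric] JM_commute)

definition JMs :: "nat multiset \<Rightarrow> gring" where
  "JMs \<beta> = fold_mset (\<lambda>b x. JM b * x) 1 \<beta>"

lemma JMs_empty [simp]: "JMs {#} = 1"
  and JMs_add: "JMs (add_mset b \<beta>) = JM b * JMs \<beta>"
  by (simp_all add: JMs_def)

lemma JMs_union: "JMs (\<alpha> + \<beta>) = JMs \<alpha> * JMs \<beta>"
  by (induction \<alpha>) (simp_all add: JMs_add mult.assoc)

lemma JMs_add_right: "JMs (add_mset b \<beta>) = JMs \<beta> * JM b"
  using JMs_union[of \<beta> "{#b#}"] by (simp add: JMs_add)

lemma JMs_replicate: "JMs (replicate_mset k b) = JM b ^ k"
  by (induction k) (simp_all add: JMs_add)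

section \<open>Symmetric expressions in two neighbouring Jucys--Murphy elements\<close>

lemma commute_mult:
  fixes s :: "'a::semigroup_mult"
  assumes "s * u = u * s" "s * v = v * s"
  shows "s * (u * v) = (u * v) * s"
proof -
  have "s * (u * v) = (s * u) * v" by (simp only: mult.assoc)
  also have "\<dots> = u * (s * v)" by (simp only: assms(1) mult.assoc)
  also have "\<dots> = (u * v) * s" by (simp only: assms(2) mult.assoc)
  finally show ?thesis .
qed

text \<open>Newton's recursion for the power sums of two commuting elements.\<close>

lemma commute_two_variable_sum:
  fixes s x y :: "'a::ring_1"
  assumes e1: "s * (x + y) = (x + y) * s" and e2: "s * (x * y) = (x * y) * s" and xy: "x * y = y * x"
  shows "s * (x ^ a * y ^ b + x ^ b * y ^ a) = (x ^ a * y ^ b + x ^ b * y ^ a) * s"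
proof -
  have pw: "y ^ k * x = x * y ^ k" for k
    by (rule power_commuting_commutes) (rule xy[symmetric])
  have p: "s * (x ^ d + y ^ d) = (x ^ d + y ^ d) * s" for d
  proof (induction d rule: less_induct)
    case (less d)
    consider "d = 0" | "d = 1" | d' where "d = Suc (Suc d')"
      by (metis One_nat_def not0_implies_Suc)
    then show ?case
    proof cases
      case 3
      have r: "x ^ d + y ^ d = (x + y) * (x ^ Suc d' + y ^ Suc d') - x * y * (x ^ d' + y ^ d')"
      proof -
        have "y * x ^ Suc d' = x * y * x ^ d'" using xy by (simp add: mult.assoc[symmetric])
        moreover have "x * y ^ Suc d' = x * y * y ^ d'" by (simp add: mult.assoc)
        ultimately show ?thesis by (simp add: 3 distrib_left distrib_right)
      qed
      have i1: "s * (x ^ Suc d' + y ^ Suc d') = (x ^ Suc d' + y ^ Suc d') * s"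
        and i2: "s * (x ^ d' + y ^ d') = (x ^ d' + y ^ d') * s"
        by (rule less; simp add: 3)+
      show ?thesis unfolding r right_diff_distrib left_diff_distrib
        unfolding commute_mult[OF e1 i1] commute_mult[OF e2 i2] ..
    qed (use e1 in \<open>simp_all add: mult_2 mult_2_right\<close>)
  qed
  have e2k: "s * (x * y) ^ k = (x * y) ^ k * s" for k
    using power_commuting_commutes[of "x * y" s k] e2 by simp
  have xyk: "(x * y) ^ k = x ^ k * y ^ k" for k
  proof (induction k)
    case (Suc k)
    have "(x * y) ^ Suc k = x * (y * x ^ k) * y ^ k" using Suc by (simp add: mult.assoc)
    also have "y * x ^ k = x ^ k * y"
      by (rule power_commuting_commutes[OF xy, symmetric])
    finally show ?case by (simp add: mult.assoc)
  qed simp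
  \<comment> \<open>The smaller exponent is split off as a power of \<open>x * y\<close>; a power
    sum remains.\<close>
  have main: "s * (x ^ a * y ^ b + x ^ b * y ^ a) = (x ^ a * y ^ b + x ^ b * y ^ a) * s" if ab: "a \<le> b" for a b
  proof -
    obtain d where d: "b = a + d" using ab le_Suc_ex by blast
    have "x ^ a * y ^ b = (x * y) ^ a * y ^ d" by (simp add: d xyk power_add mult.assoc)
    moreover have "x ^ b * y ^ a = (x * y) ^ a * x ^ d"
    proof -
      have "x ^ d * y ^ a = y ^ a * x ^ d"
        by (rule power_commuting_commutes) (rule pw[symmetric])
      then show ?thesis by (simp add: d xyk power_add mult.assoc)
    qed
    ultimately have f: "x ^ a * y ^ b + x ^ b * y ^ a = (x * y) ^ a * (x ^ d + y ^ d)"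
      by (simp add: distrib_left add.commute)
    show ?thesis unfolding f by (rule commute_mult[OF e2k p])
  qed
  show ?thesis using main[of a b] main[of b a] by (cases "a \<le> b") (auto simp: add.commute)
qed

text \<open>The relations of the degenerate affine Hecke algebra: \<open>JM (Suc i)\<close> is the
  conjugate of \<open>JM i\<close> by the adjacent transposition, plus that transposition
  itself.\<close>

lemma E_transpose_Suc_mult_JM:
  assumes "1 \<le> i"
  shows "E (transpose i (Suc i)) * JM i = JM (Suc i) * E (transpose i (Suc i)) - 1"
    and "E (transpose i (Suc i)) * JM (Suc i) = JM i * E (transpose i (Suc i)) + 1"
proof -
  let ?s = "transpose i (Suc i)"
  have ss: "E ?s * E ?s = 1" by (simp add: E_mult E_id)
  have c: "?s \<circ> transpose a i = transpose a (Suc i) \<circ> ?s" if "a < i" for a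
    using that comp_transpose_bij[OF bij_transpose, of i "Suc i" a i] by simp
  have 1: "E ?s * JM i = (\<Sum>a\<in>{1..<i}. E (transpose a (Suc i))) * E ?s"
    unfolding JM_def sum_distrib_left sum_distrib_right E_mult
    by (rule sum.cong[OF refl]) (simp add: c)
  have 2: "JM (Suc i) = (\<Sum>a\<in>{1..<i}. E (transpose a (Suc i))) + E ?s"
    using assms by (simp add: JM_def atLeastLessThanSuc)
  show 3: "E ?s * JM i = JM (Suc i) * E ?s - 1"
    unfolding 1 2 by (simp add: distrib_right ss)
  have "JM (Suc i) = E ?s * JM i * E ?s + E ?s"
    unfolding 3 by (simp add: left_diff_distrib mult.assoc ss)
  then have "E ?s * JM (Suc i) = (E ?s * E ?s) * JM i * E ?s + E ?s * E ?s"
    by (simp add: distrib_left mult.assoc)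
  then show "E ?s * JM (Suc i) = JM i * E ?s + 1" by (simp add: ss)
qed

lemma E_transpose_Suc_commute_JM:
  assumes "1 \<le> i" "b \<noteq> i" "b \<noteq> Suc i"
  shows "E (transpose i (Suc i)) * JM b = JM b * E (transpose i (Suc i))"
proof (cases "b < i")
  case True
  have "transpose i (Suc i) \<circ> transpose a b = transpose a b \<circ> transpose i (Suc i)" if "a < b" for a
    using that True comp_transpose_bij[OF bij_transpose, of i "Suc i" a b] by simp
  then show ?thesis
    unfolding JM_def sum_distrib_left sum_distrib_right E_mult by (intro sum.cong) auto
next
  case False
  then show ?thesis using assms by (intro E_transpose_commute_JM) auto
qed

text \<open>Adding the image under the exchange of \<open>i\<close> and \<open>i + 1\<close> makes
  the monomial symmetric in \<open>JM i\<close> and \<open>JM (Suc i)\<close>, up to the factor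
  \<open>JMs \<gamma>\<close> in the other indices. The constants in the exchange relations cancel
  in the sum and in the product of the two elements, and this suffices.\<close>

lemma E_transpose_Suc_commute_JMs:
  assumes "1 \<le> i"
  shows "E (transpose i (Suc i)) * (JMs \<beta> + JMs (image_mset (transpose i (Suc i)) \<beta>)) =
         (JMs \<beta> + JMs (image_mset (transpose i (Suc i)) \<beta>)) * E (transpose i (Suc i))"
proof -
  let ?s = "transpose i (Suc i)" let ?x = "JM i" and ?y = "JM (Suc i)"
  define a b \<gamma> where "a = count \<beta> i" and "b = count \<beta> (Suc i)"
    and "\<gamma> = filter_mset (\<lambda>c. c \<noteq> i \<and> c \<noteq> Suc i) \<beta>"
  have \<beta>: "\<beta> = replicate_mset a i + replicate_mset b (Suc i) + \<gamma>"
    by (rule multiset_eqI) (simp add: a_def b_def \<gamma>_def)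
  have g: "image_mset ?s \<gamma> = \<gamma>"
  proof -
    have "image_mset ?s \<gamma> = image_mset (\<lambda>c. c) \<gamma>"
      by (rule image_mset_cong) (simp add: \<gamma>_def transpose_def)
    then show ?thesis by simp
  qed
  have sb: "image_mset ?s \<beta> = replicate_mset b i + replicate_mset a (Suc i) + \<gamma>"
    by (subst \<beta>) (simp add: g)
  have J: "JMs \<beta> + JMs (image_mset ?s \<beta>) = (?x ^ a * ?y ^ b + ?x ^ b * ?y ^ a) * JMs \<gamma>"
    unfolding sb by (subst \<beta>) (simp add: JMs_union JMs_replicate distrib_right)
  have sg: "E ?s * JMs \<gamma> = JMs \<gamma> * E ?s"
  proof -
    have "E ?s * JMs \<delta> = JMs \<delta> * E ?s" if "\<forall>c\<in>#\<delta>. c \<noteq> i \<and> c \<noteq> Suc i" for \<delta>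
      using that
    proof (induction \<delta>)
      case (add c \<delta>)
      then show ?case
        using E_transpose_Suc_commute_JM[OF assms, of c] by (simp add: JMs_add commute_mult)
    qed simp
    then show ?thesis by (simp add: \<gamma>_def)
  qed
  note sx = E_transpose_Suc_mult_JM[OF assms]
  have e1: "E ?s * (?x + ?y) = (?x + ?y) * E ?s"
    by (simp add: distrib_left distrib_right sx)
  have e2: "E ?s * (?x * ?y) = (?x * ?y) * E ?s"
  proof -
    have "E ?s * (?x * ?y) = (?y * E ?s - 1) * ?y" by (simp add: mult.assoc[symmetric] sx(1))
    also have "\<dots> = ?y * (E ?s * ?y) - ?y" by (simp add: left_diff_distrib mult.assoc)
    also have "\<dots> = ?y * ?x * E ?s" by (simp add: sx(2) distrib_left mult.assoc)
    finally show ?thesis by (simp add: JM_commute[of i "Suc i"])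
  qed
  show ?thesis unfolding J
    by (rule commute_mult[OF commute_two_variable_sum[OF e1 e2 JM_commute] sg])
qed

section \<open>Top degree coefficients\<close>

text \<open>The length filtration with a strict bound: degree at most \<open>d\<close> is
  \<open>below n (Suc d)\<close>, and \<open>below n 0\<close> leaves only zero. This is where the
  subtracted 1 in \<open>below_mult\<close> comes from.\<close>

definition below :: "nat \<Rightarrow> nat \<Rightarrow> gring \<Rightarrow> bool" where
  "below n d x \<longleftrightarrow> (\<forall>w. cf x w \<noteq> 0 \<longrightarrow> w permutes {1..n} \<and> perm_len n w < d)"

lemma belowD: "below n d x \<Longrightarrow> cf x w \<noteq> 0 \<Longrightarrow> w permutes {1..n} \<and> perm_len n w < d"
  by (simp add: below_def)

lemma below_zero: "below n d 0"
  by (simp add: below_def)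

lemma below_add: "below n d x \<Longrightarrow> below n d y \<Longrightarrow> below n d (x + y)"
  by (auto simp: below_def) (metis add_0)+

lemma below_sum: "(\<And>i. i \<in> I \<Longrightarrow> below n d (f i)) \<Longrightarrow> below n d (sum f I)"
  by (induction I rule: infinite_finite_induct) (auto intro: below_add below_zero)

lemma below_E: "p permutes {1..n} \<Longrightarrow> perm_len n p < d \<Longrightarrow> below n d (E p)"
  by (auto simp: below_def cf_E split: if_splits)

lemma below_mult:
  assumes x: "below n a x" and y: "below n b y"
  shows "below n (a + b - 1) (x * y)"
  unfolding below_def
proof (intro allI impI)
  fix w assume "cf (x * y) w \<noteq> 0"
  then have "Endo w \<in> Poly_Mapping.keys (x * y)" by (simp add: cf_def in_keys_iff)
  then obtain i j where ij: "Endo w = i + j" "i \<in> Poly_Mapping.keys x" "j \<in> Poly_Mapping.keys y"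
    using keys_mult[of x y] by blast
  obtain s t where st: "i = Endo s" "j = Endo t" by (metis endo.exhaust)
  have s: "s permutes {1..n}" "perm_len n s < a" and t: "t permutes {1..n}" "perm_len n t < b"
    using belowD[OF x, of s] belowD[OF y, of t] ij st by (auto simp: cf_def in_keys_iff)
  have w: "w = s \<circ> t" using ij st by simp
  show "w permutes {1..n} \<and> perm_len n w < a + b - 1"
    unfolding w using permutes_compose[OF t(1) s(1)] perm_len_comp_le[OF s(1) t(1)] s(2) t(2) by linarith
qed

lemma below_JM:
  assumes "b \<le> n"
  shows "below n 2 (JM b)"
  unfolding JM_def
proof (rule below_sum)
  fix a assume a: "a \<in> {1..<b}"
  then have ab: "a \<in> {1..n}" "b \<in> {1..n}" using assms by auto
  have "perm_len n (transpose a b) \<le> 1"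
    using perm_len_comp_transpose_le[OF permutes_id ab] by (simp add: perm_len_id)
  then show "below n 2 (E (transpose a b))"
    using permutes_swap_id[OF ab] by (intro below_E) auto
qed

lemma below_JMs:
  assumes "set_mset \<beta> \<subseteq> {1..n}"
  shows "below n (Suc (size \<beta>)) (JMs \<beta>)"
  using assms
proof (induction \<beta>)
  case empty
  show ?case using below_E[OF permutes_id, of n 1] by (simp add: perm_len_id E_id)
next
  case (add b \<beta>)
  then have "below n (2 + Suc (size \<beta>) - 1) (JM b * JMs \<beta>)"
    by (intro below_mult below_JM) auto
  then show ?case by (simp add: JMs_add)
qed

text \<open>A multiset of indices encodes a monomial in the \<open>JM b\<close>; its multiplicities
  are the exponents.\<close>

definition mult_type :: "nat multiset \<Rightarrow> nat multiset" where
  "mult_type \<beta> = image_mset (count \<beta>) (mset_set (set_mset \<beta>))"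

lemma sum_mult_type: "sum_mset (mult_type \<beta>) = size \<beta>"
  by (simp add: mult_type_def sum_unfold_sum_mset[symmetric] size_multiset_overloaded_eq)

lemma size_mult_type: "size (mult_type \<beta>) = card (set_mset \<beta>)"
  by (simp add: mult_type_def)

text \<open>Here \<open>N\<close> collects the exponents of the indices other than \<open>b\<close>.
  The form copies \<open>merge_fixed\<close>, so that a monomial and the cycles it creates can be
  compared factor by factor.\<close>

lemma mult_type_add_mset:
  "\<exists>N. mult_type \<beta> = atom (count \<beta> b) + N \<and> mult_type (add_mset b \<beta>) = add_mset (Suc (count \<beta> b)) N"
proof -
  let ?N = "image_mset (count \<beta>) (mset_set (set_mset \<beta> - {b}))"
  have "image_mset (count (add_mset b \<beta>)) (mset_set (set_mset \<beta> - {b})) = ?N"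
    by (rule image_mset_cong) simp
  moreover have "mset_set (insert b (set_mset \<beta>)) = add_mset b (mset_set (set_mset \<beta> - {b}))"
    by (metis Diff_insert_absorb finite_set_mset insert_Diff_single mset_set.insert_remove)
  moreover have "mult_type \<beta> = atom (count \<beta> b) + ?N"
  proof (cases "b \<in># \<beta>")
    case True
    then have "mset_set (set_mset \<beta>) = add_mset b (mset_set (set_mset \<beta> - {b}))"
      by (metis finite_set_mset mset_set.remove)
    then show ?thesis using True by (simp add: mult_type_def)
  qed (simp add: mult_type_def not_in_iff)
  ultimately show ?thesis by (intro exI[of _ ?N]) (simp add: mult_type_def)
qed

lemma mult_type_image_inj:
  assumes "inj f"
  shows "mult_type (image_mset f \<beta>) = mult_type \<beta>"
proof -
  have "mset_set (f ` set_mset \<beta>) = image_mset f (mset_set (set_mset \<beta>))"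
    by (rule image_mset_mset_set[symmetric]) (rule inj_on_subset[OF assms subset_UNIV])
  moreover have "count (image_mset f \<beta>) (f x) = count \<beta> x" for x
    using assms by (induction \<beta>) (auto simp: inj_eq)
  ultimately show ?thesis
    by (simp add: mult_type_def image_mset.compositionality comp_def)
qed

section \<open>Cycles created along a minimal monotone factorization\<close>

lemma merge_moves:
  assumes w: "w permutes {1..n::nat}" and ab: "a \<in> {1..n}" "b \<in> {1..n}" and b: "b \<notin> orbit w a"
  shows "(w \<circ> transpose a b) a \<noteq> a" "(w \<circ> transpose a b) b \<noteq> b"
    and "w x \<noteq> x \<Longrightarrow> (w \<circ> transpose a b) x \<noteq> x"
proof -
  have f: "finite {1..n}" by simp
  have "a \<notin> orbit w b" using b orbit_eq_of_mem[OF w f] self_mem_orbit[OF w f] by metis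
  then have "w b \<noteq> a" using orbit.base by metis
  then show 1: "(w \<circ> transpose a b) a \<noteq> a" by simp
  have "w a \<noteq> b" using b orbit.base by metis
  then show 2: "(w \<circ> transpose a b) b \<noteq> b" by simp
  show "(w \<circ> transpose a b) x \<noteq> x" if "w x \<noteq> x"
    using 1 2 that by (cases "x = a"; cases "x = b") auto
qed

text \<open>Every nontrivial one among the two old cycles is lost and one nontrivial cycle is
  gained.\<close>

lemma merge_size:
  assumes w: "w permutes {1..n}" and ab: "a \<in> {1..n}" "b \<in> {1..n}" and b: "b \<notin> orbit w a"
  shows "size (red_type n (w \<circ> transpose a b)) + (if w a = a then 0 else 1) + (if w b = b then 0 else 1)
    = Suc (size (red_type n w))"
proof -
  have f: "finite {1..n}" by simp
  obtain M where "red_type n w = atom (card (orbit w a) - 1) + atom (card (orbit w b) - 1) + M"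
    "red_type n (w \<circ> transpose a b) = add_mset (card (orbit w a) + card (orbit w b) - 1) M"
    using red_type_merge[OF assms] by blast
  moreover have "card (orbit w x) - 1 = 0 \<longleftrightarrow> w x = x" for x
    using card_orbit_eq_1_iff[OF w f, of x] card_orbit_pos[OF w f, of x] by linarith
  ultimately show ?thesis by simp
qed

lemma merge_fixed:
  assumes w: "w permutes {1..n}" and ab: "a \<in> {1..n}" "b \<in> {1..n}" and b: "b \<notin> orbit w a"
    and a: "w a = a"
  shows "card (orbit (w \<circ> transpose a b) b) = Suc (card (orbit w b))"
    and "\<exists>M. red_type n w = atom (card (orbit w b) - 1) + M \<and>
             red_type n (w \<circ> transpose a b) = add_mset (card (orbit w b)) M"
proof -
  have f: "finite {1..n}" by simp
  have o: "orbit w a = {a}" using a by (simp add: orbit_eq_singleton_iff)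
  have ao: "a \<notin> orbit w b" using b orbit_eq_of_mem[OF w f] self_mem_orbit[OF w f] by metis
  show "card (orbit (w \<circ> transpose a b) b) = Suc (card (orbit w b))"
    unfolding orbit_comp_transpose_merge(2)[OF w f ab b] o
    using ao finite_orbit_permutes[OF w f, of b] by simp
  show "\<exists>M. red_type n w = atom (card (orbit w b) - 1) + M \<and>
             red_type n (w \<circ> transpose a b) = add_mset (card (orbit w b)) M"
    using red_type_merge[OF w ab b] unfolding o by simp
qed

text \<open>The support of \<open>JMs \<beta>\<close> has length at most
  \<open>size \<beta>\<close>, and one transposition raises the length by at most one. Since
  \<open>w\<close> has the greatest possible length, both bounds are attained, so the last step
  merges two cycles.\<close>

lemma JMs_add_coeff:
  assumes \<beta>: "set_mset (add_mset b \<beta>) \<subseteq> {1..n}" and l: "perm_len n w = Suc (size \<beta>)"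
    and a: "1 \<le> a" "a < b" and cf: "cf (JMs \<beta>) (w \<circ> transpose a b) \<noteq> 0"
  shows "w \<circ> transpose a b permutes {1..n}" "perm_len n (w \<circ> transpose a b) = size \<beta>"
    and "b \<notin> orbit (w \<circ> transpose a b) a"
proof -
  let ?w = "w \<circ> transpose a b"
  have ab: "a \<in> {1..n}" "b \<in> {1..n}" using \<beta> a by auto
  have "below n (Suc (size \<beta>)) (JMs \<beta>)" by (rule below_JMs) (use \<beta> in auto)
  from belowD[OF this cf] show w: "?w permutes {1..n}" and "perm_len n ?w = size \<beta>"
    using perm_len_comp_transpose_le[OF _ ab, of ?w] l by (auto simp: comp_assoc)
  then show "b \<notin> orbit ?w a"
    using not_mem_orbit_of_perm_len[OF w ab] l a by (simp add: comp_assoc)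
qed

lemma JMs_add_coeff_obtain:
  assumes "cf (JMs (add_mset b \<beta>)) w \<noteq> 0"
  obtains a where "1 \<le> a" "a < b" "cf (JMs \<beta>) (w \<circ> transpose a b) \<noteq> 0"
proof -
  have "(\<Sum>a\<in>{1..<b}. cf (JMs \<beta>) (w \<circ> transpose a b)) \<noteq> 0"
    using assms by (simp add: JMs_add_right cf_mult_JM)
  then obtain a where "a \<in> {1..<b}" "cf (JMs \<beta>) (w \<circ> transpose a b) \<noteq> 0"
    using sum.not_neutral_contains_not_neutral by blast
  then show ?thesis using that by auto
qed

lemma max_index_mem_iff:
  fixes b :: nat
  assumes "\<forall>c\<in>#\<beta>. u c \<noteq> c" "\<forall>x. u x \<noteq> x \<longrightarrow> (\<exists>c\<in>#\<beta>. x \<le> c)" "\<forall>y\<in>#\<beta>. y \<le> b"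
  shows "b \<in># \<beta> \<longleftrightarrow> u b \<noteq> b"
proof
  assume "u b \<noteq> b"
  then obtain c where "c \<in># \<beta>" "b \<le> c" using assms(2) by blast
  with assms(3) have "c = b" by (simp add: order_antisym)
  with \<open>c \<in># \<beta>\<close> show "b \<in># \<beta>" by simp
qed (use assms(1) in blast)

text \<open>
  A monotone factorization of minimal length merges cycles at every step. Multiplying by
  \<open>(a b)\<close> with \<open>b\<close> at least as large as every index used before creates a nontrivial cycle
  only if \<open>b\<close> is new, which bounds the number of nontrivial cycles; in the case of equality
  every step attaches a fixed point \<open>a\<close> to the cycle of \<open>b\<close>.
\<close>

lemma JMs_top_coeff:
  assumes "set_mset \<beta> \<subseteq> {1..n}" "cf (JMs \<beta>) w \<noteq> 0" "perm_len n w = size \<beta>"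
  shows "(\<forall>b\<in>#\<beta>. w b \<noteq> b) \<and> (\<forall>x. w x \<noteq> x \<longrightarrow> (\<exists>b\<in>#\<beta>. x \<le> b)) \<and>
    size (red_type n w) \<le> card (set_mset \<beta>) \<and>
    (size (red_type n w) = card (set_mset \<beta>) \<longrightarrow> red_type n w = mult_type \<beta> \<and>
      (\<forall>b\<in>#\<beta>. (\<forall>y\<in>#\<beta>. y \<le> b) \<longrightarrow> card (orbit w b) = Suc (count \<beta> b)))"
  using assms
proof (induction \<beta> arbitrary: w rule: multiset_induct_max)
  case empty
  then have "w = id" by (auto simp: E_id[symmetric] cf_E split: if_splits)
  then have r: "red_type n w = {#}"
    using zero_notin_red_type[of n w] perm_len_id[of n] by (auto simp: perm_len_def sum_mset_0_iff)
      (metis multiset_nonemptyE)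
  have A: "\<forall>x. w x \<noteq> x \<longrightarrow> (\<exists>b\<in>#{#}. x \<le> b)" using \<open>w = id\<close> by simp
  show ?case by (intro conjI A) (simp_all add: r mult_type_def)
next
  case (add b \<beta>)
  obtain a where a: "1 \<le> a" "a < b" "cf (JMs \<beta>) (w \<circ> transpose a b) \<noteq> 0"
    using JMs_add_coeff_obtain[OF add.prems(2)] .
  define u where "u = w \<circ> transpose a b"
  have wu: "w = u \<circ> transpose a b" by (simp add: u_def comp_assoc)
  have l: "perm_len n w = Suc (size \<beta>)" using add.prems(3) by simp
  note C = JMs_add_coeff[OF add.prems(1) l a, folded u_def]
  have f: "finite {1..n}" by simp
  have ab: "a \<in> {1..n}" "b \<in> {1..n}" using add.prems(1) a by auto
  have \<beta>n: "set_mset \<beta> \<subseteq> {1..n}" using add.prems(1) by auto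
  note IH = add.IH[OF \<beta>n a(3)[folded u_def] C(2)]
  note mv = merge_moves[OF C(1) ab C(3), folded wu]
  have IH1: "\<forall>b\<in>#\<beta>. u b \<noteq> b" and IH2: "\<forall>x. u x \<noteq> x \<longrightarrow> (\<exists>b\<in>#\<beta>. x \<le> b)"
    and IH3: "size (red_type n u) \<le> card (set_mset \<beta>)"
    and IH4: "size (red_type n u) = card (set_mset \<beta>) \<Longrightarrow> red_type n u = mult_type \<beta>"
      "size (red_type n u) = card (set_mset \<beta>) \<Longrightarrow> b \<in># \<beta> \<Longrightarrow> card (orbit u b) = Suc (count \<beta> b)"
    using IH add.hyps by blast+
  have bm: "b \<in># \<beta> \<longleftrightarrow> u b \<noteq> b"
    by (rule max_index_mem_iff[OF IH1 IH2 add.hyps])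
  \<comment> \<open>The largest index \<open>b\<close> was moved before exactly if it had been used
    before, so the test for a trivial cycle at \<open>b\<close> becomes a test for a new index; this
    matches the count of distinct indices in \<open>cd\<close>.\<close>
  have sz: "size (red_type n w) + (if u a = a then 0 else 1) + (if b \<in># \<beta> then 1 else 0)
      = Suc (size (red_type n u))"
    using merge_size[OF C(1) ab C(3), folded wu] bm by (cases "u a = a"; cases "u b = b") simp_all
  have cd: "card (set_mset (add_mset b \<beta>)) = card (set_mset \<beta>) + (if b \<in># \<beta> then 0 else 1)"
    by (simp add: insert_absorb)
  have i: "\<forall>c\<in>#add_mset b \<beta>. w c \<noteq> c" using mv(2,3) IH1 by auto
  have ii: "\<exists>c\<in>#add_mset b \<beta>. x \<le> c" if "w x \<noteq> x" for x
  proof (cases "x = a \<or> x = b")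
    case True
    then show ?thesis using a by auto
  next
    case False
    then have "u x \<noteq> x" using that wu by auto
    then show ?thesis using IH2 by auto
  qed
  have iii: "size (red_type n w) \<le> card (set_mset (add_mset b \<beta>))"
    using sz cd IH3 by (auto split: if_splits)
  have iv: "red_type n w = mult_type (add_mset b \<beta>) \<and> card (orbit w b) = Suc (count (add_mset b \<beta>) b)"
    if eq: "size (red_type n w) = card (set_mset (add_mset b \<beta>))"
  proof -
    \<comment> \<open>A moved point \<open>a\<close> would cost one further cycle and make the bound
      strict.\<close>
    have ua: "u a = a" and equ: "size (red_type n u) = card (set_mset \<beta>)"
      using sz cd IH3 eq by (auto split: if_splits)
    \<comment> \<open>Before the step the cycle of \<open>b\<close> has one point more than the
      exponent of \<open>b\<close>; if \<open>b\<close> is new, this says that \<open>b\<close> is a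
      fixed point and the exponent is zero.\<close>
    have ou: "card (orbit u b) = Suc (count \<beta> b)"
    proof (cases "b \<in># \<beta>")
      case True
      then show ?thesis using IH4(2)[OF equ] by blast
    next
      case False
      then show ?thesis using bm card_orbit_eq_1_iff[OF C(1) f, of b] by (simp add: not_in_iff)
    qed
    obtain M where M: "red_type n u = atom (card (orbit u b) - 1) + M" "red_type n w = add_mset (card (orbit u b)) M"
      using merge_fixed(2)[OF C(1) ab C(3) ua, folded wu] by blast
    obtain N where N: "mult_type \<beta> = atom (count \<beta> b) + N"
      "mult_type (add_mset b \<beta>) = add_mset (Suc (count \<beta> b)) N"
      using mult_type_add_mset by blast
    have "red_type n u = mult_type \<beta>" by (rule IH4(1)[OF equ])
    then have "M = N" using M(1) N(1) unfolding ou by (simp only: diff_Suc_1 add_left_cancel)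
    then show ?thesis using M(2) N(2) ou merge_fixed(1)[OF C(1) ab C(3) ua, folded wu] by simp
  qed
  have mx: "c = b" if "c \<in># add_mset b \<beta>" "\<forall>y\<in>#add_mset b \<beta>. y \<le> c" for c
    using that add.hyps by (auto intro: order_antisym)
  show ?case
  proof (intro conjI impI)
    assume "size (red_type n w) = card (set_mset (add_mset b \<beta>))"
    note iv = iv[OF this]
    show "red_type n w = mult_type (add_mset b \<beta>)" using iv ..
    show "\<forall>c\<in>#add_mset b \<beta>. (\<forall>y\<in>#add_mset b \<beta>. y \<le> c) \<longrightarrow> card (orbit w c) = Suc (count (add_mset b \<beta>) c)"
      using mx iv by blast
  qed (use i ii iii in blast)+
qed

text \<open>Equality in the cycle count passes down to the shorter factorization and forces
  \<open>a\<close> to be fixed there, which means \<open>w b = a\<close>: the last transposition can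
  be read off from \<open>w\<close>.\<close>

lemma JMs_add_coeff_extremal:
  assumes \<beta>: "set_mset (add_mset b \<beta>) \<subseteq> {1..n}" and mx: "\<forall>y\<in>#\<beta>. y \<le> b"
    and l: "perm_len n w = Suc (size \<beta>)"
    and a: "1 \<le> a" "a < b" and cf: "cf (JMs \<beta>) (w \<circ> transpose a b) \<noteq> 0"
    and eq: "card (set_mset (add_mset b \<beta>)) = size (red_type n w)"
  shows "a = w b" "card (set_mset \<beta>) = size (red_type n (w \<circ> transpose a b))"
proof -
  define u where "u = w \<circ> transpose a b"
  have wu: "w = u \<circ> transpose a b" by (simp add: u_def comp_assoc)
  note C = JMs_add_coeff[OF \<beta> l a cf, folded u_def]
  have ab: "a \<in> {1..n}" "b \<in> {1..n}" using \<beta> a by auto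
  have \<beta>n: "set_mset \<beta> \<subseteq> {1..n}" using \<beta> by auto
  note T = JMs_top_coeff[OF \<beta>n cf[folded u_def] C(2)]
  have bm: "b \<in># \<beta> \<longleftrightarrow> u b \<noteq> b"
    by (rule max_index_mem_iff[OF _ _ mx]) (use T in blast)+
  have sz: "size (red_type n w) + (if u a = a then 0 else 1) + (if b \<in># \<beta> then 1 else 0)
      = Suc (size (red_type n u))"
    using merge_size[OF C(1) ab C(3), folded wu] bm by (cases "u a = a"; cases "u b = b") simp_all
  have cd: "card (set_mset (add_mset b \<beta>)) = card (set_mset \<beta>) + (if b \<in># \<beta> then 0 else 1)"
    by (simp add: insert_absorb)
  have "u a = a \<and> card (set_mset \<beta>) = size (red_type n u)"
    using sz cd T eq by (auto split: if_splits)
  then show "a = w b" "card (set_mset \<beta>) = size (red_type n (w \<circ> transpose a b))"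
    by (simp_all add: u_def)
qed

text \<open>An extremal monotone factorization is recovered from its product by running backwards:
  the last index is the largest point \<open>b\<close> moved by \<open>w\<close>, its partner is
  \<open>w b\<close>, and detaching this partner leaves a shorter instance.\<close>

lemma exists_unique_extremal_index:
  assumes "w permutes {1..n}"
  shows "\<exists>\<beta>. set_mset \<beta> \<subseteq> {1..n} \<and> size \<beta> = perm_len n w \<and> card (set_mset \<beta>) = size (red_type n w) \<and>
    cf (JMs \<beta>) w = 1 \<and>
    (\<forall>\<gamma>. set_mset \<gamma> \<subseteq> {1..n} \<longrightarrow> size \<gamma> = perm_len n w \<longrightarrow> card (set_mset \<gamma>) = size (red_type n w) \<longrightarrow>
      cf (JMs \<gamma>) w \<noteq> 0 \<longrightarrow> \<gamma> = \<beta>)"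
  using assms
proof (induction "perm_len n w" arbitrary: w)
  case 0
  then have w: "w = id" using perm_len_eq_0_iff by metis
  have r: "red_type n w = {#}"
    using zero_notin_red_type[of n w] 0(1) by (auto simp: perm_len_def sum_mset_0_iff)
      (metis multiset_nonemptyE)
  show ?case
    by (rule exI[of _ "{#}"]) (use r w in \<open>auto simp: perm_len_id E_id[symmetric] cf_E\<close>)
next
  case (Suc k)
  define S where "S = {x. w x \<noteq> x}"
  have SS: "S \<subseteq> {1..n}" using permutes_not_in[OF Suc.prems] unfolding S_def by blast
  have fS: "finite S" using SS finite_subset by blast
  have "w \<noteq> id" using Suc.hyps(2) by (auto simp: perm_len_id)
  then have "S \<noteq> {}" by (auto simp: S_def fun_eq_iff)
  define b where "b = Max S"
  define a where "a = w b"
  have bS: "b \<in> S" unfolding b_def using fS \<open>S \<noteq> {}\<close> by (rule Max_in)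
  have ble: "x \<le> b" if "w x \<noteq> x" for x
    unfolding b_def using fS that by (intro Max_ge) (auto simp: S_def)
  have aS: "a \<in> S" using bS permutes_inj[OF Suc.prems] unfolding S_def a_def by (auto simp: inj_eq)
  have ab: "a \<in> {1..n}" "b \<in> {1..n}" using aS bS SS by auto
  have "a \<noteq> b" using bS by (auto simp: S_def a_def)
  moreover have "a \<le> b" using aS ble by (auto simp: S_def)
  ultimately have alb: "1 \<le> a" "a < b" "a \<noteq> b" using ab by auto
  define u where "u = w \<circ> transpose a b"
  have wu: "w = u \<circ> transpose a b" by (simp add: u_def comp_assoc)
  have u: "u permutes {1..n}" unfolding u_def by (rule comp_transpose_permutes[OF Suc.prems ab])
  have lu: "perm_len n w = Suc (perm_len n u)"
    unfolding u_def by (rule perm_len_detach[OF Suc.prems]) (use alb in \<open>auto simp: a_def\<close>)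
  have ua: "u a = a" by (simp add: u_def a_def)
  have nb: "b \<notin> orbit u a"
    by (rule not_mem_orbit_of_perm_len[OF u ab alb(3)]) (use lu wu in simp)
  have "k = perm_len n u" using lu Suc.hyps(2) by simp
  from Suc.hyps(1)[OF this u] obtain \<beta> where \<beta>: "set_mset \<beta> \<subseteq> {1..n}" "size \<beta> = perm_len n u"
    "card (set_mset \<beta>) = size (red_type n u)" "cf (JMs \<beta>) u = 1"
    and uniq: "\<And>\<gamma>. set_mset \<gamma> \<subseteq> {1..n} \<Longrightarrow> size \<gamma> = perm_len n u \<Longrightarrow>
        card (set_mset \<gamma>) = size (red_type n u) \<Longrightarrow> cf (JMs \<gamma>) u \<noteq> 0 \<Longrightarrow> \<gamma> = \<beta>" by blast
  have T: "(\<forall>b\<in>#\<beta>. u b \<noteq> b) \<and> (\<forall>x. u x \<noteq> x \<longrightarrow> (\<exists>b\<in>#\<beta>. x \<le> b))"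
    using JMs_top_coeff[OF \<beta>(1) _ \<beta>(2)[symmetric]] \<beta>(4) by simp
  have mx: "\<forall>y\<in>#\<beta>. y \<le> b"
    using T ble merge_moves(3)[OF u ab nb, folded wu] by blast
  have bm: "b \<in># \<beta> \<longleftrightarrow> u b \<noteq> b"
    by (rule max_index_mem_iff[OF _ _ mx]) (use T in blast)+
  have cd: "card (set_mset (add_mset b \<beta>)) = size (red_type n w)"
  proof -
    have "card (set_mset (add_mset b \<beta>)) = card (set_mset \<beta>) + (if b \<in># \<beta> then 0 else 1)"
      by (simp add: insert_absorb)
    then show ?thesis using merge_size[OF u ab nb, folded wu] bm ua \<beta>(3) by (auto split: if_splits)
  qed
  have sub: "set_mset (add_mset b \<beta>) \<subseteq> {1..n}" using \<beta>(1) ab by auto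
  have lw: "perm_len n w = Suc (size \<beta>)" using lu \<beta>(2) by simp
  have "cf (JMs (add_mset b \<beta>)) w = (\<Sum>c\<in>{1..<b}. cf (JMs \<beta>) (w \<circ> transpose c b))"
    by (simp add: JMs_add_right cf_mult_JM)
  \<comment> \<open>Any other partner \<open>c\<close> with a nonzero coefficient would also have to
    equal \<open>w b\<close>.\<close>
  also have "\<dots> = (\<Sum>c\<in>{1..<b}. if c = a then 1 else 0)"
  proof (rule sum.cong[OF refl])
    fix c assume c: "c \<in> {1..<b}"
    show "cf (JMs \<beta>) (w \<circ> transpose c b) = (if c = a then 1 else 0)"
    proof (cases "c = a")
      case True
      then show ?thesis using \<beta>(4) by (simp add: u_def)
    next
      case False
      have "1 \<le> c" "c < b" using c by auto
      from JMs_add_coeff_extremal(1)[OF sub mx lw this _ cd] False show ?thesis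
        by (auto simp: a_def)
    qed
  qed
  also have "\<dots> = 1" using alb by simp
  finally have cf1: "cf (JMs (add_mset b \<beta>)) w = 1" .
  have un: "\<gamma> = add_mset b \<beta>" if \<gamma>: "set_mset \<gamma> \<subseteq> {1..n}" "size \<gamma> = perm_len n w"
    "card (set_mset \<gamma>) = size (red_type n w)" "cf (JMs \<gamma>) w \<noteq> 0" for \<gamma>
  proof -
    note G = JMs_top_coeff[OF \<gamma>(1,4) \<gamma>(2)[symmetric]]
    \<comment> \<open>Every index is a moved point, and every moved point lies below some index;
      hence the largest index of any competitor is \<open>b\<close> as well.\<close>
    have le: "\<forall>y\<in>#\<gamma>. y \<le> b" using G ble by blast
    have "w b \<noteq> b" using bS by (simp add: S_def)
    moreover have "b \<in># \<gamma> \<longleftrightarrow> w b \<noteq> b"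
      by (rule max_index_mem_iff[OF _ _ le]) (use G in blast)+
    ultimately have "b \<in># \<gamma>" by simp
    then obtain \<delta> where \<delta>: "\<gamma> = add_mset b \<delta>" by (metis mset_add)
    obtain c where c: "1 \<le> c" "c < b" "cf (JMs \<delta>) (w \<circ> transpose c b) \<noteq> 0"
      using JMs_add_coeff_obtain \<gamma>(4) unfolding \<delta> by blast
    have l: "perm_len n w = Suc (size \<delta>)" using \<gamma>(2) by (simp add: \<delta>)
    have le': "\<forall>y\<in>#\<delta>. y \<le> b" using le by (simp add: \<delta>)
    note X = JMs_add_coeff_extremal[OF \<gamma>(1)[unfolded \<delta>] le' l c \<gamma>(3)[unfolded \<delta>]]
    have "c = a" using X(1) by (simp add: a_def)
    have "\<delta> = \<beta>"
      by (rule uniq) (use X(2) c \<open>c = a\<close> \<gamma>(1) l lu in \<open>auto simp: \<delta> u_def\<close>)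
    then show ?thesis by (simp add: \<delta>)
  qed
  show ?case
    by (rule exI[of _ "add_mset b \<beta>"]) (use sub lw cd cf1 un in auto)
qed

section \<open>Monomial symmetric functions of the Jucys--Murphy elements\<close>

declare One_nat_def [simp del]

definition idx :: "nat \<Rightarrow> nat multiset \<Rightarrow> nat multiset set" where
  "idx n P = {\<beta>. set_mset \<beta> \<subseteq> {1..n} \<and> mult_type \<beta> = P}"

definition mon :: "nat \<Rightarrow> nat multiset \<Rightarrow> gring" where
  "mon n P = (\<Sum>\<beta>\<in>idx n P. JMs \<beta>)"

lemma finite_multisets_bounded: "finite {\<beta>. set_mset \<beta> \<subseteq> {1..n::nat} \<and> size \<beta> = r}"
  using finite_multisets_of_size[of "{1..n}" r] by (simp add: multisets_of_size_def)

lemma finite_idx: "finite (idx n P)"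
  by (rule finite_subset[OF _ finite_multisets_bounded[of n "sum_mset P"]])
     (auto simp: idx_def sum_mult_type[symmetric])

lemma below_mon: "below n (Suc (sum_mset P)) (mon n P)"
  unfolding mon_def
proof (rule below_sum)
  fix \<beta> assume "\<beta> \<in> idx n P"
  then show "below n (Suc (sum_mset P)) (JMs \<beta>)"
    using below_JMs[of \<beta> n] by (auto simp: idx_def sum_mult_type)
qed

text \<open>Each monomial of \<open>mon n P\<close> involves \<open>size P\<close> distinct indices,
  the bound for the number of nontrivial cycles in top degree; equality fixes the cycle
  lengths.\<close>

lemma cf_mon_nonzero:
  assumes "perm_len n w = sum_mset P" "cf (mon n P) w \<noteq> 0"
  shows "size (red_type n w) < size P \<or> red_type n w = P"
proof -
  obtain \<beta> where "\<beta> \<in> idx n P" "cf (JMs \<beta>) w \<noteq> 0"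
    using assms(2) sum.not_neutral_contains_not_neutral unfolding mon_def cf_sum by blast
  then have \<beta>: "set_mset \<beta> \<subseteq> {1..n}" "mult_type \<beta> = P" "cf (JMs \<beta>) w \<noteq> 0" by (auto simp: idx_def)
  have "perm_len n w = size \<beta>" using assms(1) \<beta>(2) by (simp add: sum_mult_type[symmetric])
  from JMs_top_coeff[OF \<beta>(1,3) this] show ?thesis
    using \<beta>(2) size_mult_type[of \<beta>] by (auto simp: order_less_le)
qed

text \<open>All monomials of \<open>mon n P\<close> have the degree and the number of indices of the
  extremal case, so exactly one of them reaches \<open>w\<close>, with coefficient 1.\<close>

lemma cf_mon_diagonal:
  assumes w: "w permutes {1..n}" "red_type n w = P"
  shows "cf (mon n P) w = 1"
proof -
  have l: "perm_len n w = sum_mset P" using w by (simp add: perm_len_def)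
  obtain \<beta> where \<beta>: "set_mset \<beta> \<subseteq> {1..n}" "size \<beta> = perm_len n w" "card (set_mset \<beta>) = size (red_type n w)"
      "cf (JMs \<beta>) w = 1"
    and u: "\<And>\<gamma>. set_mset \<gamma> \<subseteq> {1..n} \<Longrightarrow> size \<gamma> = perm_len n w \<Longrightarrow>
      card (set_mset \<gamma>) = size (red_type n w) \<Longrightarrow> cf (JMs \<gamma>) w \<noteq> 0 \<Longrightarrow> \<gamma> = \<beta>"
    using exists_unique_extremal_index[OF w(1)] by blast
  have "cf (JMs \<beta>) w \<noteq> 0" using \<beta>(4) by simp
  then have "mult_type \<beta> = P"
    using JMs_top_coeff[OF \<beta>(1) _ \<beta>(2)[symmetric]] \<beta>(3) w(2) by simp
  then have mem: "\<beta> \<in> idx n P" using \<beta>(1) by (simp add: idx_def)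
  have "cf (JMs \<gamma>) w = (if \<gamma> = \<beta> then 1 else 0)" if "\<gamma> \<in> idx n P" for \<gamma>
  proof (cases "\<gamma> = \<beta>")
    case False
    have "size \<gamma> = perm_len n w" "card (set_mset \<gamma>) = size (red_type n w)"
      using that w(2) l sum_mult_type[of \<gamma>] size_mult_type[of \<gamma>] by (simp_all add: idx_def)
    then show ?thesis using u[of \<gamma>] that False by (auto simp: idx_def)
  qed (use \<beta>(4) in simp)
  then have "cf (mon n P) w = (\<Sum>\<gamma>\<in>idx n P. if \<gamma> = \<beta> then 1 else 0)"
    unfolding mon_def cf_sum by (intro sum.cong) auto
  then show ?thesis using mem finite_idx by simp
qed

section \<open>Central elements and their expansion in class sums\<close>

definition central :: "nat \<Rightarrow> gring \<Rightarrow> bool" where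
  "central n x \<longleftrightarrow> (\<forall>\<sigma>. \<sigma> permutes {1..n} \<longrightarrow> E \<sigma> * x = x * E \<sigma>)"

lemma central_if_commute_adjacent:
  assumes "\<And>i. 1 \<le> i \<Longrightarrow> i < n \<Longrightarrow> E (transpose i (Suc i)) * x = x * E (transpose i (Suc i))"
  shows "central n x"
proof -
  have mult: "E (p \<circ> q) * x = x * E (p \<circ> q)" if "E p * x = x * E p" "E q * x = x * E q" for p q
    using commute_mult[of x "E p" "E q"] that by (simp add: E_mult)
  have less: "E (transpose a b) * x = x * E (transpose a b)" if "1 \<le> a" "Suc a \<le> b" "b \<le> n" for a b
    using that(2,3)
  proof (induction b rule: dec_induct)
    case base
    then show ?case using assms[of a] that(1) by simp
  next
    case (step b)
    let ?s = "transpose b (Suc b)"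
    \<comment> \<open>Conjugation by adjacent transpositions moves the right end outwards one point
      at a time.\<close>
    have t: "transpose a (Suc b) = ?s \<circ> transpose a b \<circ> ?s"
      using step.hyps by (auto simp: fun_eq_iff transpose_def)
    have s: "E ?s * x = x * E ?s" using step assms[of b] that(1) by simp
    have ih: "E (transpose a b) * x = x * E (transpose a b)" using step by simp
    show ?case unfolding t by (intro mult s ih)
  qed
  have tr: "E (transpose a b) * x = x * E (transpose a b)" if "a \<in> {1..n}" "b \<in> {1..n}" "a \<noteq> b" for a b
    using that less[of a b] less[of b a] by (cases a b rule: linorder_cases) (auto simp: transpose_commute)
  have "E \<sigma> * x = x * E \<sigma>" if "\<sigma> permutes {1..n}" for \<sigma>
    using that finite_atLeastAtMost
  proof (induction rule: permutes_induct)
    case id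
    show ?case unfolding E_id by simp
  next
    case (swap a b p)
    then show ?case by (intro mult tr)
  qed
  then show ?thesis by (simp add: central_def)
qed

lemma image_transpose_idx:
  assumes "a \<in> {1..n}" "b \<in> {1..n}"
  shows "bij_betw (image_mset (transpose a b)) (idx n P) (idx n P)"
proof (rule bij_betw_byWitness[where f' = "image_mset (transpose a b)"])
  show "\<forall>\<beta>\<in>idx n P. image_mset (transpose a b) (image_mset (transpose a b) \<beta>) = \<beta>"
    "\<forall>\<beta>\<in>idx n P. image_mset (transpose a b) (image_mset (transpose a b) \<beta>) = \<beta>"
    by (simp_all add: image_mset.compositionality)
  have "transpose a b ` S \<subseteq> {1..n}" if "S \<subseteq> {1..n}" for S
    using image_mono[OF that, of "transpose a b"] permutes_image[OF permutes_swap_id[OF assms]] by simp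
  then have "image_mset (transpose a b) \<beta> \<in> idx n P" if "\<beta> \<in> idx n P" for \<beta>
    using that by (simp add: idx_def mult_type_image_inj)
  then show "image_mset (transpose a b) ` idx n P \<subseteq> idx n P"
    "image_mset (transpose a b) ` idx n P \<subseteq> idx n P" by blast+
qed

text \<open>Exchanging \<open>i\<close> and \<open>i + 1\<close> permutes the monomials, so twice
  \<open>mon n P\<close> is a sum of symmetrized pairs, each commuting with the adjacent
  transposition. The factor 2 is cancelled coefficient by coefficient over the integers.\<close>

lemma central_mon: "central n (mon n P)"
proof (rule central_if_commute_adjacent)
  fix i assume i: "1 \<le> i" "i < n"
  let ?s = "transpose i (Suc i)"
  have "(\<Sum>\<beta>\<in>idx n P. JMs (image_mset ?s \<beta>)) = mon n P"
    unfolding mon_def by (rule sum.reindex_bij_betw[OF image_transpose_idx]) (use i in auto)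
  then have two: "mon n P + mon n P = (\<Sum>\<beta>\<in>idx n P. JMs \<beta> + JMs (image_mset ?s \<beta>))"
    by (simp add: sum.distrib mon_def)
  have "E ?s * (mon n P + mon n P) = (mon n P + mon n P) * E ?s"
    unfolding two sum_distrib_left sum_distrib_right E_transpose_Suc_commute_JMs[OF i(1)] ..
  then have e: "E ?s * mon n P + E ?s * mon n P = mon n P * E ?s + mon n P * E ?s"
    by (simp add: distrib_left distrib_right)
  show "E ?s * mon n P = mon n P * E ?s"
  proof (rule gring_eqI)
    fix w
    have "2 * cf (E ?s * mon n P) w = 2 * cf (mon n P * E ?s) w"
      using arg_cong[OF e, of "\<lambda>z. cf z w"] by simp
    then show "cf (E ?s * mon n P) w = cf (mon n P * E ?s) w" by simp
  qed
qed

lemma cf_central_conjugate: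
  assumes x: "central n x" and s: "\<sigma> permutes {1..n}" "\<sigma> \<circ> p = q \<circ> \<sigma>"
  shows "cf x p = cf x q"
proof -
  have i: "\<sigma> \<circ> inv \<sigma> = id" "inv \<sigma> \<circ> \<sigma> = id"
    using permutes_inv_o[OF s(1)] by auto
  have "cf (E \<sigma> * x) (\<sigma> \<circ> p) = cf x p"
    unfolding cf_E_mult[OF i] by (simp add: comp_assoc[symmetric] i)
  moreover have "cf (x * E \<sigma>) (q \<circ> \<sigma>) = cf x q"
    unfolding cf_mult_E[OF i] by (simp add: comp_assoc i)
  ultimately show ?thesis using x s by (simp add: central_def)
qed

text \<open>The counterpart of \<open>class_sum\<close> in the ring \<open>gring\<close>, where the
  convolution product is available.\<close>

definition class_el :: "nat \<Rightarrow> nat multiset \<Rightarrow> gring" where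
  "class_el n P = (\<Sum>p | p permutes {1..n} \<and> red_type n p = P. E p)"

lemma finite_perms_such_that: "finite {p. p permutes {1..n::nat} \<and> Q p}"
  by (rule finite_subset[OF _ finite_permutations[of "{1..n}"]]) auto

lemma cf_sum_perms:
  "cf (\<Sum>p | p permutes {1..n::nat} \<and> Q p. E p) w = (if w permutes {1..n} \<and> Q w then 1 else 0)"
  by (simp add: cf_sum cf_E finite_perms_such_that)

lemma cf_class_el: "cf (class_el n P) w = (if w permutes {1..n} \<and> red_type n w = P then 1 else 0)"
  by (simp add: class_el_def cf_sum_perms)

text \<open>The coefficient of a central element on a class is read at this one permutation. The
  value is arbitrary if no permutation of \<open>{1..n}\<close> has type \<open>P\<close>.\<close>

definition rep :: "nat \<Rightarrow> nat multiset \<Rightarrow> (nat \<Rightarrow> nat)" where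
  "rep n P = (SOME w. w permutes {1..n} \<and> red_type n w = P)"

lemma rep:
  assumes "w permutes {1..n}" "red_type n w = P"
  shows "rep n P permutes {1..n}" "red_type n (rep n P) = P"
  unfolding rep_def using someI[of "\<lambda>w. w permutes {1..n} \<and> red_type n w = P" w] assms by auto

lemma cf_central_rep:
  assumes x: "central n x" and w: "w permutes {1..n}"
  shows "cf x w = cf x (rep n (red_type n w))"
proof -
  note r = rep[OF w refl]
  have "reduced_cycle_type n w = reduced_cycle_type n (rep n (red_type n w))"
    by (simp add: parts_inject[symmetric] parts_reduced_cycle_type r(2))
  then show ?thesis
    using conjugate_of_reduced_cycle_type_eq[OF w r(1)] cf_central_conjugate[OF x] by blast
qed

definition types :: "nat \<Rightarrow> nat \<Rightarrow> nat multiset set" where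
  "types n a = red_type n ` {w. w permutes {1..n} \<and> perm_len n w = a}"

lemma finite_types: "finite (types n a)"
  by (simp add: types_def finite_perms_such_that)

lemma types_sum: "P \<in> types n a \<Longrightarrow> sum_mset P = a \<and> 0 \<notin># P"
  by (auto simp: types_def perm_len_def zero_notin_red_type)

lemma central_decompose:
  assumes x: "central n x" and b: "below n (Suc a) x"
  shows "below n a (x - (\<Sum>P\<in>types n a. frag_cmul (cf x (rep n P)) (class_el n P)))"
    (is "below n a (x - ?S)")
  unfolding below_def
proof (intro allI impI)
  fix w assume nz: "cf (x - ?S) w \<noteq> 0"
  have S: "cf ?S w = (if w permutes {1..n} \<and> perm_len n w = a then cf x (rep n (red_type n w)) else 0)"
  proof (cases "w permutes {1..n}")
    case True
    have "cf ?S w = (\<Sum>P\<in>types n a. if P = red_type n w then cf x (rep n P) else 0)"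
      using True by (auto simp: cf_sum cf_class_el intro!: sum.cong)
    also have "\<dots> = (if red_type n w \<in> types n a then cf x (rep n (red_type n w)) else 0)"
      by (simp add: finite_types)
    also have "red_type n w \<in> types n a \<longleftrightarrow> perm_len n w = a"
      using True types_sum[of "red_type n w" n a] by (auto simp: types_def perm_len_def)
    finally show ?thesis using True by simp
  qed (simp add: cf_sum cf_class_el)
  have w: "w permutes {1..n}"
    using nz S belowD[OF b, of w] by (auto split: if_splits)
  have "perm_len n w \<noteq> a" using nz S w cf_central_rep[OF x w] by auto
  moreover have "perm_len n w \<le> a"
    using nz S belowD[OF b, of w] by (cases "cf x w = 0") (auto split: if_splits)
  ultimately show "w permutes {1..n} \<and> perm_len n w < a" using w by simp
qed

global_interpretation gring_module: module "frag_cmul :: int \<Rightarrow> gring \<Rightarrow> gring"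
  by unfold_locales (simp_all add: frag_cmul_distrib frag_cmul_distrib2)

text \<open>By its top-degree coefficients \<open>mon n P\<close> is the class sum plus class sums
  with fewer parts, up to smaller length. Induction on the number of parts inverts this relation,
  and everything of smaller length is collected in the second set of generators.\<close>

lemma class_el_triangular:
  assumes "sum_mset P = a"
  shows "class_el n P - mon n P \<in>
    gring_module.span (mon n ` {Q. sum_mset Q = a \<and> 0 \<notin># Q \<and> size Q < size P} \<union> {x. below n a x})"
  using assms
proof (induction "size P" arbitrary: P rule: less_induct)
  case less
  let ?T = "\<lambda>k. mon n ` {Q. sum_mset Q = a \<and> 0 \<notin># Q \<and> size Q < k} \<union> {x. below n a x}"
  let ?c = "\<lambda>Q. cf (mon n P) (rep n Q)"
  define S where "S = (\<Sum>Q\<in>types n a - {P}. frag_cmul (?c Q) (class_el n Q))"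
  have b: "below n a (mon n P - (\<Sum>Q\<in>types n a. frag_cmul (?c Q) (class_el n Q)))"
    using central_decompose[OF central_mon] below_mon[of n P] less.prems by simp
  have "(\<Sum>Q\<in>types n a. frag_cmul (?c Q) (class_el n Q)) = class_el n P + S"
  proof (cases "P \<in> types n a")
    case True
    then obtain w where "w permutes {1..n}" "red_type n w = P" by (auto simp: types_def)
    then have "?c P = 1" using rep[of w n P] by (intro cf_mon_diagonal)
    then show ?thesis using True finite_types by (simp add: S_def sum.remove[of _ P])
  next
    \<comment> \<open>If \<open>n\<close> is too small for \<open>P\<close>, the class is empty and
      its sum is zero.\<close>
    case False
    then have "class_el n P = 0"
      using less.prems by (intro gring_eqI) (auto simp: cf_class_el types_def perm_len_def)
    then show ?thesis using False by (simp add: S_def)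
  qed
  then have b': "below n a (mon n P - (class_el n P + S))" using b by simp
  have S: "S \<in> gring_module.span (?T (size P))"
    unfolding S_def
  proof (rule gring_module.span_sum)
    fix Q assume Q: "Q \<in> types n a - {P}"
    then obtain w where "w permutes {1..n}" "red_type n w = Q" by (auto simp: types_def)
    note r = rep[OF this]
    note s = types_sum[of Q n a]
    show "frag_cmul (?c Q) (class_el n Q) \<in> gring_module.span (?T (size P))"
    proof (cases "?c Q = 0")
      case False
      have "perm_len n (rep n Q) = sum_mset P" using s Q r less.prems by (simp add: perm_len_def)
      then have lt: "size Q < size P" using cf_mon_nonzero[OF _ False] r(2) Q by auto
      have "mon n Q \<in> ?T (size P)" using lt s Q by auto
      moreover have "class_el n Q - mon n Q \<in> gring_module.span (?T (size P))"
        by (rule set_mp[OF gring_module.span_mono less.hyps[OF lt]]) (use lt s Q in auto)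
      ultimately have "mon n Q + (class_el n Q - mon n Q) \<in> gring_module.span (?T (size P))"
        by (rule gring_module.span_add[OF gring_module.span_base])
      then show ?thesis by (intro gring_module.span_scale) simp
    qed (simp add: gring_module.span_zero)
  qed
  have "mon n P - (class_el n P + S) \<in> gring_module.span (?T (size P))"
    using b' by (intro gring_module.span_base) simp
  then have "- (mon n P - (class_el n P + S)) - S \<in> gring_module.span (?T (size P))"
    by (rule gring_module.span_diff[OF gring_module.span_neg S])
  moreover have "- (mon n P - (class_el n P + S)) - S = class_el n P - mon n P" by simp
  ultimately show ?case by (simp only:)
qed

section \<open>Sums of all permutations of a given length, the lifts of \<open>fh_f\<close>\<close>

definition len_sum :: "nat \<Rightarrow> nat \<Rightarrow> gring" where
  "len_sum n l = (\<Sum>p | p permutes {1..n} \<and> perm_len n p = l. E p)"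

lemma cf_len_sum: "cf (len_sum n l) w = (if w permutes {1..n} \<and> perm_len n w = l then 1 else 0)"
  by (simp add: len_sum_def cf_sum_perms)

lemma perm_len_Suc: "p permutes {1..n} \<Longrightarrow> perm_len (Suc n) p = perm_len n p"
  by (simp add: perm_len_def red_type_Suc)

lemma permutes_Suc_iff: "p permutes {1..n} \<longleftrightarrow> p permutes {1..Suc n} \<and> p (Suc n) = Suc n"
proof
  assume "p permutes {1..n}"
  then show "p permutes {1..Suc n} \<and> p (Suc n) = Suc n"
    using permutes_mono_interval[of p n "Suc n"] permutes_not_in[of p "{1..n}" "Suc n"] by simp
next
  assume p: "p permutes {1..Suc n} \<and> p (Suc n) = Suc n"
  show "p permutes {1..n}"
    by (rule permutes_superset[of p "{1..Suc n}"]) (use p in \<open>auto simp: le_Suc_eq\<close>)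
qed

text \<open>A permutation of \<open>n + 1\<close> points either fixes the last point or is, in
  exactly one way, a permutation of \<open>n\<close> points times a transposition
  \<open>(a, n + 1)\<close>, and is then longer by one.\<close>

lemma len_sum_Suc: "len_sum (Suc n) l = len_sum n l + (if l = 0 then 0 else len_sum n (l - 1) * JM (Suc n))"
proof (rule gring_eqI)
  fix w :: "nat \<Rightarrow> nat"
  let ?N = "Suc n"
  let ?t = "\<lambda>a. w \<circ> transpose a ?N"
  have rec: "cf (len_sum n (l - 1) * JM ?N) w
      = (\<Sum>a\<in>{1..n}. if ?t a permutes {1..n} \<and> perm_len n (?t a) = l - 1 then 1 else 0)"
    by (simp add: cf_mult_JM cf_len_sum atLeastLessThanSuc_atLeastAtMost)
  have lift: "w permutes {1..?N}" if "?t a permutes {1..n}" "a \<in> {1..n}" for a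
  proof -
    have "?t a \<circ> transpose a ?N permutes {1..?N}"
      using that(2) by (intro comp_transpose_permutes permutes_mono_interval[OF that(1)]) auto
    then show ?thesis by (simp add: comp_assoc)
  qed
  show "cf (len_sum ?N l) w = cf (len_sum n l + (if l = 0 then 0 else len_sum n (l - 1) * JM ?N)) w"
  proof (cases "w permutes {1..?N}")
    case False
    then have "\<not> w permutes {1..n}" using permutes_Suc_iff by blast
    moreover have "\<not> ?t a permutes {1..n}" if "a \<in> {1..n}" for a using that lift False by blast
    ultimately show ?thesis using False by (simp add: cf_len_sum rec)
  next
    case w: True
    show ?thesis
    proof (cases "w ?N = ?N")
      case True
      have "\<not> ?t a permutes {1..n}" if "a \<in> {1..n}" for a
      proof
        assume "?t a permutes {1..n}"
        then have "w a = ?N" using permutes_Suc_iff[of "?t a" n] by simp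
        then have "a = ?N" using True permutes_inj[OF w] by (metis injD)
        then show False using that by simp
      qed
      then show ?thesis
        using True w permutes_Suc_iff[of w n] perm_len_Suc[of w n] by (simp add: cf_len_sum rec)
    next
      case False
      \<comment> \<open>The only possible partner: the remaining factor fixes \<open>n + 1\<close>
        exactly if \<open>w\<close> sends the partner to \<open>n + 1\<close>.\<close>
      define b where "b = inv w ?N"
      have wb: "w b = ?N" using permutes_inverses(1)[OF w] by (simp add: b_def)
      have bne: "b \<noteq> ?N" using wb False by auto
      have "b \<in> {1..?N}" using wb bne permutes_not_in[OF w, of b] by metis
      then have b: "b \<in> {1..n}" using bne by auto
      have tb: "?t b permutes {1..?N}" by (rule comp_transpose_permutes[OF w]) (use b in auto)
      have tbn: "?t b permutes {1..n}" using permutes_Suc_iff[of "?t b" n] tb wb by simp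
      have only: "a = b" if "a \<in> {1..n}" "?t a permutes {1..n}" for a
        using permutes_Suc_iff[of "?t a" n] that wb permutes_inj[OF w] by (simp add: inj_eq) (metis injD)
      have len: "perm_len ?N w = Suc (perm_len n (?t b))"
      proof -
        have "perm_len ?N w = Suc (perm_len ?N (w \<circ> transpose ?N b))"
          by (rule perm_len_detach[OF w wb]) (use bne in simp)
        then show ?thesis using perm_len_Suc[OF tbn] by (simp add: transpose_commute)
      qed
      have "(\<Sum>a\<in>{1..n}. if ?t a permutes {1..n} \<and> perm_len n (?t a) = l - 1 then 1 else 0)
          = (\<Sum>a\<in>{1..n}. if a = b then (if perm_len n (?t b) = l - 1 then 1 else 0) else (0::int))"
      proof (rule sum.cong[OF refl])
        fix a assume a: "a \<in> {1..n}"
        show "(if ?t a permutes {1..n} \<and> perm_len n (?t a) = l - 1 then 1 else 0)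
          = (if a = b then (if perm_len n (?t b) = l - 1 then 1 else 0) else (0::int))"
        proof (cases "a = b")
          case True
          then show ?thesis using tbn by simp
        next
          case False
          then have "\<not> ?t a permutes {1..n}" using only[OF a] by blast
          then show ?thesis using False by simp
        qed
      qed
      also have "\<dots> = (if perm_len n (?t b) = l - 1 then 1 else 0)" using b by simp
      finally have "cf (len_sum n (l - 1) * JM ?N) w = (if perm_len n (?t b) = l - 1 then 1 else 0)"
        unfolding rec .
      moreover have "\<not> w permutes {1..n}" using False permutes_Suc_iff by blast
      ultimately show ?thesis using w len by (cases l) (simp_all add: cf_len_sum)
    qed
  qed
qed

text \<open>
  Jucys: the elementary symmetric functions of the Jucys--Murphy elements sum all
  permutations of a given length, since every permutation has exactly one factorization
  into transpositions \<open>(a b)\<close>, \<open>a < b\<close>, with strictly increasing \<open>b\<close>.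
\<close>

lemma len_sum_eq_elementary:
  "len_sum n l = (\<Sum>S | S \<subseteq> {1..n} \<and> card S = l. JMs (mset_set S))"
proof (induction n arbitrary: l)
  case 0
  have 1: "{p. p permutes {1..0::nat} \<and> perm_len 0 p = l} = (if l = 0 then {id} else {})"
    by (auto simp: perm_len_id)
  have 2: "{S. S \<subseteq> {1..0::nat} \<and> card S = l} = (if l = 0 then {{}} else {})" by auto
  show ?case unfolding len_sum_def 1 2 by (simp add: E_id)
next
  case (Suc n)
  let ?N = "Suc n"
  let ?A = "{S. S \<subseteq> {1..n} \<and> card S = l}"
  have fin: "finite {S. S \<subseteq> {1..n::nat} \<and> card S = k}" for k
    by (rule finite_subset[of _ "Pow {1..n}"]) auto
  show ?case
  proof (cases "l = 0")
    case True
    have "{S. S \<subseteq> {1..m::nat} \<and> card S = 0} = {{}}" for m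
      using finite_subset[of _ "{1..m}"] by auto
    then show ?thesis using Suc[of 0] True by (simp add: len_sum_Suc)
  next
    case False
    let ?B = "{S. S \<subseteq> {1..n} \<and> card S = l - 1}"
    have split: "{S. S \<subseteq> {1..?N} \<and> card S = l} = ?A \<union> insert ?N ` ?B"
    proof (intro equalityI subsetI)
      fix S assume "S \<in> {S. S \<subseteq> {1..?N} \<and> card S = l}"
      then have S: "S \<subseteq> {1..?N}" "card S = l" by auto
      have fS: "finite S" using S(1) finite_subset by blast
      show "S \<in> ?A \<union> insert ?N ` ?B"
      proof (cases "?N \<in> S")
        case True
        then have "S = insert ?N (S - {?N})" by blast
        moreover have "S - {?N} \<in> ?B"
          using S fS True by (auto simp: subset_iff le_Suc_eq)
        ultimately show ?thesis by blast
      next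
        case False
        then have "S \<subseteq> {1..n}" using S(1) unfolding atLeastAtMostSuc_conv[of 1 n, simplified] by blast
        then show ?thesis using S(2) by simp
      qed
    next
      fix S assume "S \<in> ?A \<union> insert ?N ` ?B"
      then consider "S \<in> ?A" | S' where "S' \<in> ?B" "S = insert ?N S'" by blast
      then show "S \<in> {S. S \<subseteq> {1..?N} \<and> card S = l}"
      proof cases
        case 1
        then show ?thesis by (auto simp: subset_iff)
      next
        case 2
        have "finite S'" "?N \<notin> S'" using 2(1) finite_subset[of S' "{1..n}"] by auto
        then show ?thesis using 2 False by (auto simp: subset_iff)
      qed
    qed
    have dj: "?A \<inter> insert ?N ` ?B = {}" by auto
    have inj: "inj_on (insert ?N) ?B"
    proof
      fix S T assume "S \<in> ?B" "T \<in> ?B" and e: "insert ?N S = insert ?N T"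
      then have "?N \<notin> S" "?N \<notin> T" by auto
      with e show "S = T" by (metis insert_ident)
    qed
    have "(\<Sum>S | S \<subseteq> {1..?N} \<and> card S = l. JMs (mset_set S))
        = (\<Sum>S\<in>?A. JMs (mset_set S)) + (\<Sum>S\<in>?B. JMs (mset_set (insert ?N S)))"
      unfolding split by (subst sum.union_disjoint[OF _ _ dj]) (simp_all add: fin sum.reindex[OF inj])
    also have "(\<Sum>S\<in>?B. JMs (mset_set (insert ?N S))) = (\<Sum>S\<in>?B. JMs (mset_set S) * JM ?N)"
    proof (rule sum.cong[OF refl])
      fix S assume "S \<in> ?B"
      then have "finite S" "?N \<notin> S" using finite_subset[of S "{1..n}"] by auto
      then show "JMs (mset_set (insert ?N S)) = JMs (mset_set S) * JM ?N"
        by (simp add: JMs_add_right)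
    qed
    finally show ?thesis using False Suc[of l] Suc[of "l - 1"] by (simp add: len_sum_Suc sum_distrib_right)
  qed
qed

section \<open>Multiplication by an elementary symmetric function\<close>

text \<open>The ways in which the monomial \<open>\<beta>\<close> arises as a monomial of
  \<open>mon n \<mu>\<close> times a squarefree monomial of degree \<open>l\<close>; their number is
  the coefficient of \<open>\<beta>\<close> in the product with the elementary symmetric
  function.\<close>

definition add_ones :: "nat \<Rightarrow> nat multiset \<Rightarrow> nat \<Rightarrow> nat multiset \<Rightarrow> (nat multiset \<times> nat set) set" where
  "add_ones n \<mu> l \<beta> = {(\<alpha>, S). \<alpha> \<in> idx n \<mu> \<and> S \<subseteq> {1..n} \<and> card S = l \<and> \<alpha> + mset_set S = \<beta>}"

lemma finite_subsets_card: "finite {S. S \<subseteq> {1..n::nat} \<and> card S = l}"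
  by (rule finite_subset[of _ "Pow {1..n}"]) auto

lemma finite_add_ones: "finite (add_ones n \<mu> l \<beta>)"
  by (rule finite_subset[of _ "idx n \<mu> \<times> {S. S \<subseteq> {1..n} \<and> card S = l}"])
     (auto simp: add_ones_def finite_idx finite_subsets_card)

lemma card_add_ones_le:
  assumes s: "\<sigma> permutes {1..n}"
  shows "card (add_ones n \<mu> l \<beta>) \<le> card (add_ones n \<mu> l (image_mset \<sigma> \<beta>))"
proof (rule card_inj_on_le[where f = "map_prod (image_mset \<sigma>) (image \<sigma>)"])
  have i: "inj \<sigma>" by (rule permutes_inj[OF s])
  have inv: "image_mset (inv \<sigma>) (image_mset \<sigma> \<alpha>) = \<alpha>" "inv \<sigma> ` \<sigma> ` S = S" for \<alpha> S
    using permutes_inverses(2)[OF s] by (simp_all add: image_mset.compositionality comp_def image_image)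
  show "inj_on (map_prod (image_mset \<sigma>) (image \<sigma>)) (add_ones n \<mu> l \<beta>)"
    by (rule inj_on_inverseI[where g = "map_prod (image_mset (inv \<sigma>)) (image (inv \<sigma>))"])
       (auto simp: inv)
  have sub: "\<sigma> ` S \<subseteq> {1..n}" if "S \<subseteq> {1..n}" for S
    using image_mono[OF that, of \<sigma>] permutes_image[OF s] by simp
  have ms: "mset_set (\<sigma> ` S) = image_mset \<sigma> (mset_set S)" for S
    by (rule image_mset_mset_set[symmetric]) (rule inj_on_subset[OF i subset_UNIV])
  show "map_prod (image_mset \<sigma>) (image \<sigma>) ` add_ones n \<mu> l \<beta> \<subseteq> add_ones n \<mu> l (image_mset \<sigma> \<beta>)"
  proof
    fix z assume "z \<in> map_prod (image_mset \<sigma>) (image \<sigma>) ` add_ones n \<mu> l \<beta>"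
    then obtain \<alpha> S where z: "z = (image_mset \<sigma> \<alpha>, \<sigma> ` S)"
      and a: "set_mset \<alpha> \<subseteq> {1..n}" "mult_type \<alpha> = \<mu>" "S \<subseteq> {1..n}" "card S = l" "\<alpha> + mset_set S = \<beta>"
      by (auto simp: add_ones_def idx_def)
    have "card (\<sigma> ` S) = l" using a(4) card_image[OF inj_on_subset[OF i subset_UNIV]] by simp
    then show "z \<in> add_ones n \<mu> l (image_mset \<sigma> \<beta>)"
      unfolding z add_ones_def idx_def using a sub[OF a(1)] sub[OF a(3)]
      by (simp add: mult_type_image_inj[OF i] ms flip: a(5))
  qed
qed (rule finite_add_ones)

lemma card_add_ones_image:
  assumes s: "\<sigma> permutes {1..n}"
  shows "card (add_ones n \<mu> l (image_mset \<sigma> \<beta>)) = card (add_ones n \<mu> l \<beta>)"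
proof (rule antisym)
  have "image_mset (inv \<sigma>) (image_mset \<sigma> \<beta>) = \<beta>"
    using permutes_inverses(2)[OF s] by (simp add: image_mset.compositionality comp_def)
  then show "card (add_ones n \<mu> l (image_mset \<sigma> \<beta>)) \<le> card (add_ones n \<mu> l \<beta>)"
    using card_add_ones_le[OF permutes_inv[OF s], of \<mu> l "image_mset \<sigma> \<beta>"] by simp
qed (rule card_add_ones_le[OF s])

text \<open>The zeros pad the exponents to a vector of length \<open>n\<close>, so that monomials of
  the same type have exponent vectors that agree up to a permutation of all of
  \<open>{1..n}\<close>.\<close>

lemma image_count_interval:
  assumes "\<beta> \<in> idx n P"
  shows "image_mset (count \<beta>) (mset_set {1..n}) = P + replicate_mset (n - size P) 0"
proof -
  have b: "set_mset \<beta> \<subseteq> {1..n}" "mult_type \<beta> = P" using assms by (auto simp: idx_def)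
  let ?R = "{1..n} - set_mset \<beta>"
  have "{1..n} = set_mset \<beta> \<union> ?R" using b by blast
  then have "mset_set {1..n} = mset_set (set_mset \<beta>) + mset_set ?R"
    by (metis Diff_disjoint finite_Diff finite_atLeastAtMost finite_set_mset mset_set_Union)
  moreover have "image_mset (count \<beta>) (mset_set ?R) = image_mset (\<lambda>_. 0) (mset_set ?R)"
    by (rule image_mset_cong) (simp add: not_in_iff)
  moreover have "card ?R = n - size P"
    using b size_mult_type[of \<beta>] by (simp add: card_Diff_subset)
  ultimately show ?thesis using b(2) by (simp add: mult_type_def image_mset_const_eq)
qed

lemma idx_transitive:
  assumes "\<beta> \<in> idx n P" "\<gamma> \<in> idx n P"
  shows "\<exists>\<sigma>. \<sigma> permutes {1..n} \<and> image_mset \<sigma> \<beta> = \<gamma>"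
proof -
  have "image_mset (count \<beta>) (mset_set {1..n}) = image_mset (count \<gamma>) (mset_set {1..n})"
    using assms by (simp add: image_count_interval)
  then obtain s where s: "s permutes {1..n}" "\<forall>x\<in>{1..n}. count \<beta> x = count \<gamma> (s x)"
    by (rule image_mset_eq_implies_permutes[OF finite_atLeastAtMost])
  have c: "count \<beta> x = count \<gamma> (s x)" for x
  proof (cases "x \<in> {1..n}")
    case False
    then have "x \<notin># \<beta>" "x \<notin># \<gamma>" using assms unfolding idx_def by blast+
    then show ?thesis using permutes_not_in[OF s(1) False] by (simp add: not_in_iff)
  qed (use s in blast)
  have "image_mset s \<beta> = \<gamma>"
  proof (rule multiset_eqI)
    fix y
    obtain x where x: "y = s x" using permutes_surj[OF s(1)] by (metis surjD)
    have "count (image_mset s \<delta>) (s x) = count \<delta> x" for \<delta>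
      using permutes_inj[OF s(1)] by (induction \<delta>) (auto simp: inj_eq)
    then show "count (image_mset s \<beta>) y = count \<gamma> y" using c by (simp add: x)
  qed
  then show ?thesis using s(1) by blast
qed

lemma card_add_ones_type:
  assumes "\<beta> \<in> idx n P" "\<gamma> \<in> idx n P"
  shows "card (add_ones n \<mu> l \<beta>) = card (add_ones n \<mu> l \<gamma>)"
  using idx_transitive[OF assms] card_add_ones_image by metis

text \<open>Adding \<open>S\<close> raises each exponent on \<open>S\<close> by one. Indices of
  \<open>S\<close> outside \<open>\<alpha>\<close> get exponent 1, which decrementing discards
  again.\<close>

lemma decrement_mult_type_add_set:
  assumes "finite S" "set_mset \<alpha> \<subseteq> S"
  shows "decrement_parts (mult_type (\<alpha> + mset_set S)) = mult_type \<alpha>"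
proof -
  have set: "set_mset (\<alpha> + mset_set S) = S" using assms by auto
  have "image_mset (\<lambda>k. k - 1) (mult_type (\<alpha> + mset_set S)) = image_mset (count \<alpha>) (mset_set S)"
    unfolding mult_type_def set image_mset.compositionality
    using assms(1) by (intro image_mset_cong) (simp add: count_mset_set')
  then have "decrement_parts (mult_type (\<alpha> + mset_set S)) = image_mset (count \<alpha>) (mset_set {x\<in>S. count \<alpha> x \<noteq> 0})"
    using assms(1) by (simp add: decrement_parts_def filter_mset_image_mset)
  also have "{x\<in>S. count \<alpha> x \<noteq> 0} = set_mset \<alpha>" using assms(2) by (auto simp: count_eq_zero_iff)
  finally show ?thesis by (simp add: mult_type_def)
qed

text \<open>The squarefree factor uses only indices of \<open>\<beta>\<close>; if it has as many, it
  uses all of them, and the other factor is determined.\<close>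

lemma add_ones_nonempty:
  assumes "add_ones n \<mu> l \<beta> \<noteq> {}"
  shows "l \<le> card (set_mset \<beta>)"
    and "l = card (set_mset \<beta>) \<Longrightarrow> decrement_parts (mult_type \<beta>) = \<mu>"
proof -
  obtain \<alpha> S where a: "\<alpha> \<in> idx n \<mu>" "S \<subseteq> {1..n}" "card S = l" and b: "\<beta> = \<alpha> + mset_set S"
    using assms by (auto simp: add_ones_def)
  have fS: "finite S" using a(2) finite_subset by blast
  then have s: "S \<subseteq> set_mset \<beta>" by (simp add: b)
  then show "l \<le> card (set_mset \<beta>)" using a(3) card_mono by blast
  assume "l = card (set_mset \<beta>)"
  then have "S = set_mset \<beta>" using s a(3) by (simp add: card_subset_eq)
  then have "set_mset \<alpha> \<subseteq> S" using b by auto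
  from decrement_mult_type_add_set[OF fS this] show "decrement_parts (mult_type \<beta>) = \<mu>"
    using a(1) by (simp add: b idx_def)
qed

lemma add_ones_full:
  assumes \<beta>: "set_mset \<beta> \<subseteq> {1..n}" "card (set_mset \<beta>) = l" "decrement_parts (mult_type \<beta>) = \<mu>"
  shows "card (add_ones n \<mu> l \<beta>) = 1"
proof -
  define \<alpha> where "\<alpha> = \<beta> - mset_set (set_mset \<beta>)"
  have le: "mset_set (set_mset \<beta>) \<subseteq># \<beta>"
    by (simp add: mset_set_set_mset_msubset)
  have b: "\<beta> = \<alpha> + mset_set (set_mset \<beta>)" using le by (simp add: \<alpha>_def)
  have sub: "set_mset \<alpha> \<subseteq> set_mset \<beta>" unfolding \<alpha>_def by (meson in_diffD subsetI)
  have "decrement_parts (mult_type \<beta>) = mult_type \<alpha>"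
    using decrement_mult_type_add_set[OF finite_set_mset sub] b by simp
  then have idx: "\<alpha> \<in> idx n \<mu>" using \<beta> sub by (auto simp: idx_def)
  have "add_ones n \<mu> l \<beta> = {(\<alpha>, set_mset \<beta>)}"
  proof (intro equalityI subsetI)
    fix z assume "z \<in> add_ones n \<mu> l \<beta>"
    then obtain \<alpha>' S where z: "z = (\<alpha>', S)" and a: "S \<subseteq> {1..n}" "card S = l" and b': "\<beta> = \<alpha>' + mset_set S"
      by (auto simp: add_ones_def)
    have "finite S" using a(1) finite_subset by blast
    then have "S \<subseteq> set_mset \<beta>" by (simp add: b')
    then have S: "S = set_mset \<beta>" using a(2) \<beta>(2) by (simp add: card_subset_eq)
    have "\<alpha>' = \<alpha>" unfolding \<alpha>_def S[symmetric] by (simp add: b')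
    then show "z \<in> {(\<alpha>, set_mset \<beta>)}" by (simp add: z S)
  next
    fix z assume "z \<in> {(\<alpha>, set_mset \<beta>)}"
    then show "z \<in> add_ones n \<mu> l \<beta>" using idx \<beta> b by (simp add: add_ones_def)
  qed
  then show ?thesis by simp
qed

lemma frag_cmul_of_nat: "frag_cmul (int k) x = of_nat k * x" for x :: gring
  by (induction k) (simp_all add: frag_cmul_distrib algebra_simps)

text \<open>The number of decompositions is invariant under relabelling indices, so the product of
  the two symmetric sums regroups into monomial symmetric functions. Support and leading coefficient
  come from \<open>add_ones_nonempty\<close> and \<open>add_ones_full\<close>.\<close>

lemma mon_mult_len_sum:
  "\<exists>c. mon n \<mu> * len_sum n l =
      (\<Sum>P\<in>mult_type ` {\<beta>. set_mset \<beta> \<subseteq> {1..n} \<and> size \<beta> = sum_mset \<mu> + l}. frag_cmul (c P) (mon n P)) \<and>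
    (\<forall>P\<in>mult_type ` {\<beta>. set_mset \<beta> \<subseteq> {1..n} \<and> size \<beta> = sum_mset \<mu> + l}.
      (c P \<noteq> 0 \<longrightarrow> l \<le> size P \<and> (size P = l \<longrightarrow> decrement_parts P = \<mu>)) \<and>
      (size P = l \<longrightarrow> decrement_parts P = \<mu> \<longrightarrow> c P = 1))"
proof -
  let ?B = "{\<beta>. set_mset \<beta> \<subseteq> {1..n} \<and> size \<beta> = sum_mset \<mu> + l}"
  let ?D = "idx n \<mu> \<times> {S. S \<subseteq> {1..n} \<and> card S = l}"
  let ?N = "\<lambda>\<beta>. card (add_ones n \<mu> l \<beta>)"
  \<comment> \<open>The count is taken at an arbitrary monomial of type \<open>P\<close>; it depends
    on the type alone.\<close>
  define c where "c P = int (?N (SOME \<beta>. \<beta> \<in> idx n P))" for P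
  have c: "c P = int (?N \<beta>)" if "\<beta> \<in> idx n P" for \<beta> P
    unfolding c_def using card_add_ones_type[OF someI[of "\<lambda>\<beta>. \<beta> \<in> idx n P" \<beta>] that] that by simp
  have fD: "finite ?D" by (simp add: finite_idx finite_subsets_card)
  have fB: "finite ?B" by (rule finite_multisets_bounded)
  have sub: "(\<lambda>(\<alpha>, S). \<alpha> + mset_set S) ` ?D \<subseteq> ?B"
  proof
    fix \<beta> assume "\<beta> \<in> (\<lambda>(\<alpha>, S). \<alpha> + mset_set S) ` ?D"
    then obtain \<alpha> S where b: "\<beta> = \<alpha> + mset_set S" "\<alpha> \<in> idx n \<mu>" "S \<subseteq> {1..n}" "card S = l" by auto
    have "finite S" using b(3) finite_subset by blast
    then show "\<beta> \<in> ?B" using b sum_mult_type[of \<alpha>] by (simp add: idx_def)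
  qed
  have "mon n \<mu> * len_sum n l = (\<Sum>z\<in>?D. JMs ((\<lambda>(\<alpha>, S). \<alpha> + mset_set S) z))"
    unfolding mon_def len_sum_eq_elementary sum_product sum.cartesian_product
    by (rule sum.cong[OF refl]) (auto simp: JMs_union)
  also have "\<dots> = (\<Sum>\<beta>\<in>?B. \<Sum>z\<in>{z\<in>?D. (\<lambda>(\<alpha>, S). \<alpha> + mset_set S) z = \<beta>}. JMs ((\<lambda>(\<alpha>, S). \<alpha> + mset_set S) z))"
    by (rule sum.group[OF fD fB sub, symmetric])
  also have "\<dots> = (\<Sum>\<beta>\<in>?B. frag_cmul (int (?N \<beta>)) (JMs \<beta>))"
  proof (rule sum.cong[OF refl])
    fix \<beta>
    have "{z\<in>?D. (\<lambda>(\<alpha>, S). \<alpha> + mset_set S) z = \<beta>} = add_ones n \<mu> l \<beta>"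
      by (auto simp: add_ones_def)
    moreover have "(\<Sum>z\<in>add_ones n \<mu> l \<beta>. JMs ((\<lambda>(\<alpha>, S). \<alpha> + mset_set S) z)) = (\<Sum>z\<in>add_ones n \<mu> l \<beta>. JMs \<beta>)"
      by (rule sum.cong[OF refl]) (auto simp: add_ones_def)
    ultimately show "(\<Sum>z\<in>{z\<in>?D. (\<lambda>(\<alpha>, S). \<alpha> + mset_set S) z = \<beta>}. JMs ((\<lambda>(\<alpha>, S). \<alpha> + mset_set S) z))
        = frag_cmul (int (?N \<beta>)) (JMs \<beta>)"
      by (simp add: frag_cmul_of_nat)
  qed
  also have "\<dots> = (\<Sum>P\<in>mult_type ` ?B. \<Sum>\<beta>\<in>{\<beta>\<in>?B. mult_type \<beta> = P}. frag_cmul (int (?N \<beta>)) (JMs \<beta>))"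
    by (rule sum.group[OF fB finite_imageI[OF fB] subset_refl, symmetric])
  also have "\<dots> = (\<Sum>P\<in>mult_type ` ?B. frag_cmul (c P) (mon n P))"
  proof (rule sum.cong[OF refl])
    fix P assume "P \<in> mult_type ` ?B"
    then have "sum_mset P = sum_mset \<mu> + l" by (auto simp: sum_mult_type)
    then have "{\<beta>\<in>?B. mult_type \<beta> = P} = idx n P" by (auto simp: idx_def sum_mult_type[symmetric])
    then show "(\<Sum>\<beta>\<in>{\<beta>\<in>?B. mult_type \<beta> = P}. frag_cmul (int (?N \<beta>)) (JMs \<beta>)) = frag_cmul (c P) (mon n P)"
      by (simp add: mon_def frag_cmul_sum comp_def c)
  qed
  finally have 1: "mon n \<mu> * len_sum n l = (\<Sum>P\<in>mult_type ` ?B. frag_cmul (c P) (mon n P))" .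
  have 2: "(c P \<noteq> 0 \<longrightarrow> l \<le> size P \<and> (size P = l \<longrightarrow> decrement_parts P = \<mu>)) \<and>
      (size P = l \<longrightarrow> decrement_parts P = \<mu> \<longrightarrow> c P = 1)" if "P \<in> mult_type ` ?B" for P
  proof -
    from that obtain \<beta> where "P = mult_type \<beta>" "\<beta> \<in> ?B" by (rule imageE)
    then have b: "set_mset \<beta> \<subseteq> {1..n}" "P = mult_type \<beta>" by simp_all
    have cP: "c P = int (?N \<beta>)" by (rule c) (use b in \<open>simp add: idx_def\<close>)
    have ne: "add_ones n \<mu> l \<beta> \<noteq> {}" if "c P \<noteq> 0" using that cP by auto
    have sz: "size P = card (set_mset \<beta>)" by (simp add: b size_mult_type)
    show ?thesis
      using add_ones_nonempty[of n \<mu> l \<beta>] add_ones_full[OF b(1), of l \<mu>]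
      unfolding sz using ne cP b(2) by auto
  qed
  show ?thesis by (intro exI[of _ c] conjI 1 ballI 2)
qed

section \<open>Structure constants as numbers of factorizations\<close>

definition factor_pairs ::
    "nat \<Rightarrow> partition \<Rightarrow> partition \<Rightarrow> (nat \<Rightarrow> nat) \<Rightarrow> ((nat \<Rightarrow> nat) \<times> (nat \<Rightarrow> nat)) set" where
  "factor_pairs n \<nu> \<mu> w = {(s, t). s permutes {1..n} \<and> reduced_cycle_type n s = \<nu> \<and>
     t permutes {1..n} \<and> reduced_cycle_type n t = \<mu> \<and> s \<circ> t = w}"

lemma finite_factor_pairs: "finite (factor_pairs n \<nu> \<mu> w)"
  by (rule finite_subset[of _ "{s. s permutes {1..n}} \<times> {t. t permutes {1..n}}"])
     (auto simp: factor_pairs_def finite_permutations)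

lemma sum_indicator_pairs:
  assumes "finite A" "finite B"
  shows "(\<Sum>a\<in>A. \<Sum>b\<in>B. if P a b then 1 else (0::int)) = int (card {(a, b). a \<in> A \<and> b \<in> B \<and> P a b})"
proof -
  have "(\<Sum>a\<in>A. \<Sum>b\<in>B. if P a b then 1 else (0::int)) = (\<Sum>z\<in>A \<times> B. if P (fst z) (snd z) then 1 else 0)"
    unfolding sum.cartesian_product by (rule sum.cong[OF refl]) auto
  also have "\<dots> = (\<Sum>z\<in>{z \<in> A \<times> B. P (fst z) (snd z)}. 1)"
    using assms by (intro sum.inter_filter[symmetric]) simp
  also have "{z \<in> A \<times> B. P (fst z) (snd z)} = {(a, b). a \<in> A \<and> b \<in> B \<and> P a b}" by auto
  finally show ?thesis by simp
qed

lemma lookup_class_sum_mult: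
  "poly_mapping.lookup (group_ring_mult (class_sum n \<nu>) (class_sum n \<mu>)) w = int (card (factor_pairs n \<nu> \<mu> w))"
proof -
  let ?A = "\<lambda>\<nu>. {p. p permutes {1..n} \<and> reduced_cycle_type n p = \<nu>}"
  have f: "finite (?A \<nu>)" for \<nu> by (rule finite_perms_such_that)
  have "group_ring_mult (class_sum n \<nu>) (class_sum n \<mu>) = (\<Sum>s\<in>?A \<nu>. \<Sum>t\<in>?A \<mu>. frag_of (s \<circ> t))"
    unfolding group_ring_mult_def class_sum_def by (simp add: frag_extend_sum f)
  then have "poly_mapping.lookup (group_ring_mult (class_sum n \<nu>) (class_sum n \<mu>)) w
      = (\<Sum>s\<in>?A \<nu>. \<Sum>t\<in>?A \<mu>. if s \<circ> t = w then 1 else 0)"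
    by (simp add: lookup_sum eq_commute[of w])
  also have "\<dots> = int (card {(s, t). s \<in> ?A \<nu> \<and> t \<in> ?A \<mu> \<and> s \<circ> t = w})"
    by (rule sum_indicator_pairs[OF f f])
  also have "{(s, t). s \<in> ?A \<nu> \<and> t \<in> ?A \<mu> \<and> s \<circ> t = w} = factor_pairs n \<nu> \<mu> w"
    by (auto simp: factor_pairs_def)
  finally show ?thesis .
qed

lemma card_factor_pairs_le:
  assumes s: "\<sigma> permutes {1..n}" and pq: "\<sigma> \<circ> p = q \<circ> \<sigma>"
  shows "card (factor_pairs n \<nu> \<mu> p) \<le> card (factor_pairs n \<nu> \<mu> q)"
proof (rule card_inj_on_le[where f = "map_prod (\<lambda>x. \<sigma> \<circ> x \<circ> inv \<sigma>) (\<lambda>x. \<sigma> \<circ> x \<circ> inv \<sigma>)"])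
  let ?f = "\<lambda>x. \<sigma> \<circ> x \<circ> inv \<sigma>"
  have i: "\<sigma> \<circ> inv \<sigma> = id" "inv \<sigma> \<circ> \<sigma> = id" using permutes_inv_o[OF s] by auto
  have unconj: "inv \<sigma> \<circ> ?f x \<circ> \<sigma> = x" for x
  proof -
    have "inv \<sigma> \<circ> ?f x \<circ> \<sigma> = (inv \<sigma> \<circ> \<sigma>) \<circ> x \<circ> (inv \<sigma> \<circ> \<sigma>)" by (simp only: comp_assoc)
    then show ?thesis by (simp add: i)
  qed
  have mult: "?f x \<circ> ?f y = ?f (x \<circ> y)" for x y
  proof -
    have "?f x \<circ> ?f y = \<sigma> \<circ> x \<circ> (inv \<sigma> \<circ> \<sigma>) \<circ> y \<circ> inv \<sigma>" by (simp only: comp_assoc)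
    then show ?thesis by (simp add: i comp_assoc)
  qed
  have conj_eq: "\<sigma> \<circ> x = ?f x \<circ> \<sigma>" for x
  proof -
    have "?f x \<circ> \<sigma> = \<sigma> \<circ> x \<circ> (inv \<sigma> \<circ> \<sigma>)" by (simp only: comp_assoc)
    then show ?thesis by (simp add: i)
  qed
  have perm: "?f x permutes {1..n}" if "x permutes {1..n}" for x
    by (rule permutes_compose[OF permutes_inv[OF s] permutes_compose[OF that s]])
  have types_eq: "reduced_cycle_type n (?f x) = reduced_cycle_type n x" if "x permutes {1..n}" for x
    by (rule reduced_cycle_type_conjugate[OF that perm[OF that] s conj_eq, symmetric])
  have fp: "?f p = q"
  proof -
    have "?f p = q \<circ> (\<sigma> \<circ> inv \<sigma>)" unfolding pq by (simp only: comp_assoc)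
    then show ?thesis by (simp add: i)
  qed
  show "inj_on (map_prod ?f ?f) (factor_pairs n \<nu> \<mu> p)"
    by (rule inj_on_inverseI[where g = "map_prod (\<lambda>x. inv \<sigma> \<circ> x \<circ> \<sigma>) (\<lambda>x. inv \<sigma> \<circ> x \<circ> \<sigma>)"])
       (simp add: map_prod_def unconj split: prod.splits)
  show "map_prod ?f ?f ` factor_pairs n \<nu> \<mu> p \<subseteq> factor_pairs n \<nu> \<mu> q"
  proof
    fix z assume "z \<in> map_prod ?f ?f ` factor_pairs n \<nu> \<mu> p"
    then obtain x y where z: "z = (?f x, ?f y)" and xy: "(x, y) \<in> factor_pairs n \<nu> \<mu> p" by auto
    have "?f x \<circ> ?f y = q" unfolding mult using xy fp by (simp add: factor_pairs_def)
    then show "z \<in> factor_pairs n \<nu> \<mu> q"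
      unfolding z using xy perm types_eq by (simp add: factor_pairs_def)
  qed
qed (rule finite_factor_pairs)

lemma card_factor_pairs_type:
  assumes "p permutes {1..n}" "q permutes {1..n}" "reduced_cycle_type n p = reduced_cycle_type n q"
  shows "card (factor_pairs n \<nu> \<mu> p) = card (factor_pairs n \<nu> \<mu> q)"
proof (rule antisym)
  show "card (factor_pairs n \<nu> \<mu> p) \<le> card (factor_pairs n \<nu> \<mu> q)"
    using conjugate_of_reduced_cycle_type_eq[OF assms] card_factor_pairs_le by blast
  show "card (factor_pairs n \<nu> \<mu> q) \<le> card (factor_pairs n \<nu> \<mu> p)"
    using conjugate_of_reduced_cycle_type_eq[OF assms(2,1) assms(3)[symmetric]] card_factor_pairs_le by blast
qed

text \<open>The description by \<open>THE\<close> has a solution because factorization counts are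
  constant on classes. The solution is unique because each partition within \<open>n\<close> is the
  type of some permutation, at which the coefficient can be read off.\<close>

lemma rho_at_eq:
  assumes w: "w permutes {1..n}" "reduced_cycle_type n w = \<kappa>"
  shows "rho_at n \<nu> \<mu> \<kappa> = int (card (factor_pairs n \<nu> \<mu> w))"
proof -
  let ?W = "partitions_within n"
  let ?L = "group_ring_mult (class_sum n \<nu>) (class_sum n \<mu>)"
  define R where "R a = (\<Sum>\<kappa>\<in>?W. frag_cmul (a \<kappa>) (class_sum n \<kappa>))" for a :: "partition \<Rightarrow> int"
  have lcs: "poly_mapping.lookup (class_sum n \<kappa>) p = (if p permutes {1..n} \<and> reduced_cycle_type n p = \<kappa> then 1 else 0)" for \<kappa> p
    by (simp add: class_sum_def lookup_sum finite_perms_such_that)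
  have lR: "poly_mapping.lookup (R a) p = (if p permutes {1..n} then a (reduced_cycle_type n p) else 0)" for a p
  proof (cases "p permutes {1..n}")
    case True
    have "poly_mapping.lookup (R a) p = (\<Sum>\<kappa>\<in>?W. if \<kappa> = reduced_cycle_type n p then a \<kappa> else 0)"
      unfolding R_def lookup_sum by (rule sum.cong[OF refl]) (use True in \<open>auto simp: lcs\<close>)
    then show ?thesis using True reduced_type_within[OF True] by (simp add: finite_partitions_within)
  next
    case False
    then show ?thesis unfolding R_def lookup_sum by (simp add: lcs)
  qed
  define a where "a \<kappa> = (if \<kappa> \<in> ?W then
    int (card (factor_pairs n \<nu> \<mu> (SOME v. v permutes {1..n} \<and> reduced_cycle_type n v = \<kappa>))) else 0)" for \<kappa>
  have a: "a (reduced_cycle_type n p) = int (card (factor_pairs n \<nu> \<mu> p))" if "p permutes {1..n}" for p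
  proof -
    let ?Q = "\<lambda>v. v permutes {1..n} \<and> reduced_cycle_type n v = reduced_cycle_type n p"
    have "?Q (SOME v. ?Q v)" by (rule someI[of ?Q p]) (use that in simp)
    then show ?thesis
      unfolding a_def using card_factor_pairs_type[OF that, of "SOME v. ?Q v"] reduced_type_within[OF that] by simp
  qed
  have "?L = R a"
  proof (rule poly_mapping_eqI)
    fix p
    show "poly_mapping.lookup ?L p = poly_mapping.lookup (R a) p"
    proof (cases "p permutes {1..n}")
      case False
      then have "factor_pairs n \<nu> \<mu> p = {}" by (auto simp: factor_pairs_def permutes_compose)
      then show ?thesis using False by (simp add: lookup_class_sum_mult lR)
    qed (simp add: lookup_class_sum_mult lR a)
  qed
  then have ex: "(\<forall>\<kappa>. \<kappa> \<notin> ?W \<longrightarrow> a \<kappa> = 0) \<and> ?L = R a" by (simp add: a_def)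
  have uniq: "b = a" if b: "(\<forall>\<kappa>. \<kappa> \<notin> ?W \<longrightarrow> b \<kappa> = 0) \<and> ?L = R b" for b
  proof
    fix \<kappa>
    show "b \<kappa> = a \<kappa>"
    proof (cases "\<kappa> \<in> ?W")
      case True
      then obtain v where v: "v permutes {1..n}" "reduced_cycle_type n v = \<kappa>"
        using exists_perm_of_reduced_cycle_type[of \<kappa> n] by (auto simp: partitions_within_def)
      have "R b = R a" using b ex by simp
      from arg_cong[OF this, of "\<lambda>z. poly_mapping.lookup z v"] show ?thesis using v by (simp add: lR)
    qed (use b ex in simp)
  qed
  have "rho_at n \<nu> \<mu> = a"
    unfolding rho_at_def R_def[symmetric] by (rule the_equality) (use ex uniq in blast)+
  then show ?thesis using a[OF w(1)] w(2) by simp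
qed

text \<open>In top degree the lengths of the factors add up, so the factors fix all points beyond
  \<open>m\<close>, just as \<open>w\<close> does.\<close>

lemma factor_pairs_stable:
  assumes w: "w permutes {1..m}" "m \<le> n" and d: "psize (reduced_cycle_type m w) = psize \<nu> + psize \<mu>"
  shows "factor_pairs n \<nu> \<mu> w = factor_pairs m \<nu> \<mu> w"
proof -
  have down: "s permutes {1..m} \<and> t permutes {1..m}"
    if st: "s permutes {1..n}" "reduced_cycle_type n s = \<nu>" "t permutes {1..n}" "reduced_cycle_type n t = \<mu>" "s \<circ> t = w" for s t
  proof -
    have l: "perm_len n (s \<circ> t) = perm_len n s + perm_len n t"
      using d reduced_cycle_type_mono[OF w] st by (simp add: psize_reduced_cycle_type[symmetric])
    have "s x = x" "t x = x" if "x \<notin> {1..m}" for x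
      using fixed_of_comp_fixed[OF st(1,3) l, of x] permutes_not_in[OF w(1) that] st(5) by simp_all
    then show ?thesis
      using permutes_superset[OF st(1), of "{1..m}"] permutes_superset[OF st(3), of "{1..m}"] by blast
  qed
  have up: "s permutes {1..n} \<and> reduced_cycle_type n s = reduced_cycle_type m s" if "s permutes {1..m}" for s
    using permutes_mono_interval[OF that w(2)] reduced_cycle_type_mono[OF that w(2)] by blast
  have "(s, t) \<in> factor_pairs n \<nu> \<mu> w \<longleftrightarrow> (s, t) \<in> factor_pairs m \<nu> \<mu> w" for s t
    unfolding factor_pairs_def mem_Collect_eq prod.case using down[of s t] up[of s] up[of t] by metis
  then show ?thesis by (intro set_eqI) (metis surj_pair)
qed

lemma rho_eq:
  assumes d: "psize \<kappa> = psize \<nu> + psize \<mu>"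
    and w: "w permutes {1..n}" "reduced_cycle_type n w = \<kappa>"
  shows "rho \<nu> \<mu> \<kappa> = int (card (factor_pairs n \<nu> \<mu> w))"
proof -
  let ?m = "psize \<kappa> + plength \<kappa>"
  obtain v where v: "v permutes {1..?m}" "reduced_cycle_type ?m v = \<kappa>"
    using exists_perm_of_reduced_cycle_type[of \<kappa> ?m] by auto
  have stable: "rho_at k \<nu> \<mu> \<kappa> = int (card (factor_pairs ?m \<nu> \<mu> v))" if "?m \<le> k" for k
  proof -
    have "rho_at k \<nu> \<mu> \<kappa> = int (card (factor_pairs k \<nu> \<mu> v))"
      by (rule rho_at_eq) (use permutes_mono_interval[OF v(1) that] reduced_cycle_type_mono[OF v(1) that] v(2) in simp_all)
    then show ?thesis using factor_pairs_stable[OF v(1) that] v(2) d by simp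
  qed
  have "rho \<nu> \<mu> \<kappa> = int (card (factor_pairs ?m \<nu> \<mu> v))"
    unfolding rho_def
  proof (rule the_equality)
    fix c assume "\<forall>n\<ge>?m. rho_at n \<nu> \<mu> \<kappa> = c"
    then show "c = int (card (factor_pairs ?m \<nu> \<mu> v))" using stable[of ?m] by auto
  qed (use stable in blast)
  moreover have "?m \<le> n" using reduced_type_within[OF w(1)] w(2) by (simp add: partitions_within_def)
  ultimately show ?thesis using stable[of n] rho_at_eq[OF w] by simp
qed

text \<open>Reads the coefficients on the classes of degree \<open>r\<close>. For a central element
  of degree at most \<open>r\<close> and \<open>2 * r \<le> n\<close> this is its image in the
  graded component; the map is kept total and linear so that sums may be projected term by
  term.\<close>

definition proj :: "nat \<Rightarrow> nat \<Rightarrow> gring \<Rightarrow> fh_algebra" where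
  "proj n r x = (\<Sum>\<kappa>\<in>partitions_of r. frag_cmul (cf x (rep n (parts \<kappa>))) (fh_c \<kappa>))"

lemma proj_add: "proj n r (x + y) = proj n r x + proj n r y"
  and proj_diff: "proj n r (x - y) = proj n r x - proj n r y"
  and proj_cmul: "proj n r (frag_cmul k x) = frag_cmul k (proj n r x)"
  and proj_zero: "proj n r 0 = 0"
  by (simp_all add: proj_def frag_cmul_distrib frag_cmul_diff_distrib sum.distrib sum_subtractf
      frag_cmul_sum comp_def)

lemma proj_sum: "proj n r (sum f I) = (\<Sum>i\<in>I. proj n r (f i))"
  by (induction I rule: infinite_finite_induct) (simp_all add: proj_add proj_zero)

lemma plength_le_psize: "plength \<kappa> \<le> psize \<kappa>"
proof -
  have "size P \<le> sum_mset P" if "0 \<notin># P" for P :: "nat multiset"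
    using that by (induction P) auto
  then show ?thesis using parts[of \<kappa>] by (simp add: plength.rep_eq psize.rep_eq)
qed

lemma rep_partition:
  assumes "2 * psize \<kappa> \<le> n"
  shows "rep n (parts \<kappa>) permutes {1..n}" "red_type n (rep n (parts \<kappa>)) = parts \<kappa>"
    and "reduced_cycle_type n (rep n (parts \<kappa>)) = \<kappa>" "perm_len n (rep n (parts \<kappa>)) = psize \<kappa>"
proof -
  have "psize \<kappa> + plength \<kappa> \<le> n" using assms plength_le_psize[of \<kappa>] by simp
  then obtain w where w: "w permutes {1..n}" "reduced_cycle_type n w = \<kappa>"
    using exists_perm_of_reduced_cycle_type by blast
  have "red_type n w = parts \<kappa>" using w(2) parts_reduced_cycle_type by metis
  note r = rep[OF w(1) this]
  show "rep n (parts \<kappa>) permutes {1..n}" "red_type n (rep n (parts \<kappa>)) = parts \<kappa>" by (rule r)+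
  then show "reduced_cycle_type n (rep n (parts \<kappa>)) = \<kappa>"
    by (simp add: parts_inject[symmetric] parts_reduced_cycle_type)
  then show "perm_len n (rep n (parts \<kappa>)) = psize \<kappa>" using psize_reduced_cycle_type by metis
qed

text \<open>The bound on \<open>n\<close> ensures that each representative really has length
  \<open>r\<close>, where an element of smaller degree has coefficient zero.\<close>

lemma proj_below:
  assumes "2 * r \<le> n" "below n r x"
  shows "proj n r x = 0"
proof -
  have "cf x (rep n (parts \<kappa>)) = 0" if "\<kappa> \<in> partitions_of r" for \<kappa>
    using belowD[OF assms(2), of "rep n (parts \<kappa>)"] rep_partition(4)[of \<kappa> n] assms(1) that
    by (auto simp: partitions_of_def)
  then show ?thesis by (simp add: proj_def)
qed

lemma fh_f_eq: "fh_f l = (\<Sum>\<mu>\<in>partitions_of l. fh_c \<mu>)"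
proof (cases "l = 0")
  case True
  have "sum_mset P = 0 \<longleftrightarrow> P = {#}" if "0 \<notin># P" for P :: "nat multiset"
    using that by (induction P) auto
  then have "partitions_of 0 = {empty_partition}"
    using parts by (auto simp: partitions_of_def psize.rep_eq empty_partition.rep_eq parts_inject[symmetric])
  then show ?thesis using True by (simp add: fh_f_def)
qed (simp add: fh_f_def)

text \<open>Both sides count, for a permutation of type \<open>\<kappa>\<close>, its factorizations
  into one factor of type \<open>\<nu>\<close> and one of length \<open>l\<close>; on the left they
  are sorted by the type of the second factor.\<close>

lemma fh_mult_eq_proj:
  assumes "2 * (psize \<nu> + l) \<le> n"
  shows "fh_mult (fh_c \<nu>) (fh_f l) = proj n (psize \<nu> + l) (class_el n (parts \<nu>) * len_sum n l)"
proof -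
  let ?r = "psize \<nu> + l"
  have type_iff: "red_type n s = parts \<nu> \<longleftrightarrow> reduced_cycle_type n s = \<nu>" for s \<nu>
    by (simp add: parts_inject[symmetric] parts_reduced_cycle_type)
  have coeff: "(\<Sum>\<mu>\<in>partitions_of l. rho \<nu> \<mu> \<kappa>) = cf (class_el n (parts \<nu>) * len_sum n l) (rep n (parts \<kappa>))"
    if k: "\<kappa> \<in> partitions_of ?r" for \<kappa>
  proof -
    let ?w = "rep n (parts \<kappa>)"
    let ?A = "{s. s permutes {1..n} \<and> red_type n s = parts \<nu>}" and ?B = "{t. t permutes {1..n} \<and> perm_len n t = l}"
    have w: "?w permutes {1..n}" "reduced_cycle_type n ?w = \<kappa>"
      using rep_partition[of \<kappa> n] assms k by (simp_all add: partitions_of_def)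
    have "cf (class_el n (parts \<nu>) * len_sum n l) ?w = (\<Sum>s\<in>?A. \<Sum>t\<in>?B. if s \<circ> t = ?w then 1 else 0)"
      unfolding class_el_def len_sum_def sum_product cf_sum E_mult cf_E ..
    also have "\<dots> = int (card {(s, t). s \<in> ?A \<and> t \<in> ?B \<and> s \<circ> t = ?w})"
      by (rule sum_indicator_pairs) (rule finite_perms_such_that)+
    also have "{(s, t). s \<in> ?A \<and> t \<in> ?B \<and> s \<circ> t = ?w} = (\<Union>\<mu>\<in>partitions_of l. factor_pairs n \<nu> \<mu> ?w)"
      by (auto simp: factor_pairs_def type_iff partitions_of_def psize_reduced_cycle_type)
    also have "card \<dots> = (\<Sum>\<mu>\<in>partitions_of l. card (factor_pairs n \<nu> \<mu> ?w))"
      by (rule card_UN_disjoint) (auto simp: finite_partitions_of finite_factor_pairs, auto simp: factor_pairs_def)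
    finally show ?thesis
      using rho_eq[OF _ w] k by (simp add: partitions_of_def)
  qed
  have "fh_mult (fh_c \<nu>) (fh_f l) = (\<Sum>\<mu>\<in>partitions_of l. \<Sum>\<kappa>\<in>partitions_of (psize \<nu> + psize \<mu>). frag_cmul (rho \<nu> \<mu> \<kappa>) (fh_c \<kappa>))"
    unfolding fh_mult_def fh_f_eq by (simp add: fh_c_def frag_extend_sum finite_partitions_of)
  also have "\<dots> = (\<Sum>\<mu>\<in>partitions_of l. \<Sum>\<kappa>\<in>partitions_of ?r. frag_cmul (rho \<nu> \<mu> \<kappa>) (fh_c \<kappa>))"
    by (rule sum.cong[OF refl]) (simp add: partitions_of_def)
  also have "\<dots> = (\<Sum>\<kappa>\<in>partitions_of ?r. frag_cmul (\<Sum>\<mu>\<in>partitions_of l. rho \<nu> \<mu> \<kappa>) (fh_c \<kappa>))"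
    by (subst sum.swap) (simp add: int_module.scale_sum_left)
  also have "\<dots> = proj n ?r (class_el n (parts \<nu>) * len_sum n l)"
    unfolding proj_def by (rule sum.cong[OF refl]) (simp add: coeff)
  finally show ?thesis .
qed

section \<open>Unitriangular changes of basis\<close>

text \<open>Independence of an indexed family; unlike independence of the image set, it includes
  injectivity.\<close>

definition lin_indep_family :: "('i \<Rightarrow> fh_algebra) \<Rightarrow> 'i set \<Rightarrow> bool" where
  "lin_indep_family x I \<longleftrightarrow> (\<forall>a. (\<Sum>i\<in>I. frag_cmul (a i) (x i)) = 0 \<longrightarrow> (\<forall>i\<in>I. a i = 0))"

lemma span_image_obtain:
  assumes "finite J" "v \<in> int_module.span (y ` J)"
  shows "\<exists>c. v = (\<Sum>j\<in>J. frag_cmul (c j) (y j))"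
  using assms(2)
proof (induction rule: int_module.span_induct_alt)
  case base
  show ?case by (rule exI[of _ "\<lambda>_. 0"]) simp
next
  case (step k u v)
  then obtain j c where j: "j \<in> J" "u = y j" and c: "v = (\<Sum>j\<in>J. frag_cmul (c j) (y j))" by blast
  have "(\<Sum>i\<in>J. frag_cmul ((c(j := c j + k)) i) (y i)) = frag_cmul (c j + k) (y j) + (\<Sum>i\<in>J - {j}. frag_cmul (c i) (y i))"
    using assms(1) j(1) by (subst sum.remove[of _ j]) auto
  also have "\<dots> = frag_cmul k (y j) + v"
    using assms(1) j(1) unfolding c by (subst (2) sum.remove[of _ j]) (auto simp: frag_cmul_distrib)
  finally show ?case using j by metis
qed

text \<open>The inclusion of \<open>y\<close> in the span of \<open>x\<close> is solved upwards
  along the rank: \<open>y i\<close> is \<open>x i\<close> minus terms already expressed.\<close>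

lemma unitriangular_span:
  assumes tri: "\<And>i. i \<in> I \<Longrightarrow> x i - y i \<in> int_module.span (y ` {j\<in>I. rank j < (rank i :: nat)})"
  shows "int_module.span (x ` I) = int_module.span (y ` I)"
  unfolding int_module.span_eq
proof
  show "x ` I \<subseteq> int_module.span (y ` I)"
  proof
    fix v assume "v \<in> x ` I"
    then obtain i where i: "i \<in> I" "v = x i" by blast
    have "x i - y i \<in> int_module.span (y ` I)"
      by (rule set_mp[OF int_module.span_mono tri[OF i(1)]]) blast
    moreover have "y i \<in> int_module.span (y ` I)" using i by (intro int_module.span_base) blast
    ultimately have "(x i - y i) + y i \<in> int_module.span (y ` I)" by (rule int_module.span_add)
    then show "v \<in> int_module.span (y ` I)" using i by simp
  qed
  have "y i \<in> int_module.span (x ` I)" if "i \<in> I" for i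
    using that
  proof (induction "rank i" arbitrary: i rule: less_induct)
    case less
    have "int_module.span (y ` {j\<in>I. rank j < rank i}) \<subseteq> int_module.span (x ` I)"
      by (rule int_module.span_minimal) (use less.hyps in auto)
    then have "x i - y i \<in> int_module.span (x ` I)" using tri[OF less.prems] by blast
    moreover have "x i \<in> int_module.span (x ` I)" using less.prems by (intro int_module.span_base) blast
    ultimately have "x i - (x i - y i) \<in> int_module.span (x ` I)"
      by (rule int_module.span_diff[rotated])
    then show ?case by simp
  qed
  then show "y ` I \<subseteq> int_module.span (x ` I)" by blast
qed

text \<open>Rewritten in \<open>y\<close>, a relation keeps its coefficient unchanged at an index of
  greatest rank among the nonzero ones.\<close>

lemma unitriangular_lin_indep:
  assumes fin: "finite I" and y: "lin_indep_family y I"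
    and tri: "\<And>i. i \<in> I \<Longrightarrow> x i - y i \<in> int_module.span (y ` {j\<in>I. rank j < (rank i :: nat)})"
  shows "lin_indep_family x I"
  unfolding lin_indep_family_def
proof (intro allI impI)
  fix a assume 0: "(\<Sum>i\<in>I. frag_cmul (a i) (x i)) = 0"
  have "\<exists>c. x i - y i = (\<Sum>j\<in>{j\<in>I. rank j < rank i}. frag_cmul (c j) (y j))" if "i \<in> I" for i
    by (rule span_image_obtain[OF _ tri[OF that]]) (use fin in simp)
  then obtain c where c: "\<And>i. i \<in> I \<Longrightarrow> x i - y i = (\<Sum>j\<in>{j\<in>I. rank j < rank i}. frag_cmul (c i j) (y j))"
    by metis
  define d where "d i j = (if rank j < rank i then c i j else 0)" for i j
  have x: "x i = y i + (\<Sum>j\<in>I. frag_cmul (d i j) (y j))" if "i \<in> I" for i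
  proof -
    have "(\<Sum>j\<in>I. frag_cmul (d i j) (y j)) = (\<Sum>j\<in>I. if rank j < rank i then frag_cmul (c i j) (y j) else 0)"
      by (rule sum.cong[OF refl]) (simp add: d_def)
    also have "\<dots> = x i - y i" using c[OF that] fin by (simp add: sum.inter_filter)
    finally show ?thesis by simp
  qed
  have "(\<Sum>i\<in>I. frag_cmul (a i) (x i))
      = (\<Sum>i\<in>I. frag_cmul (a i) (y i)) + (\<Sum>i\<in>I. \<Sum>j\<in>I. frag_cmul (a i * d i j) (y j))"
    by (simp add: x frag_cmul_distrib2 frag_cmul_sum comp_def sum.distrib)
  also have "(\<Sum>i\<in>I. \<Sum>j\<in>I. frag_cmul (a i * d i j) (y j)) = (\<Sum>j\<in>I. frag_cmul (\<Sum>i\<in>I. a i * d i j) (y j))"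
    by (subst sum.swap) (simp add: int_module.scale_sum_left)
  also have "(\<Sum>i\<in>I. frag_cmul (a i) (y i)) + \<dots> = (\<Sum>j\<in>I. frag_cmul (a j + (\<Sum>i\<in>I. a i * d i j)) (y j))"
    by (simp add: sum.distrib frag_cmul_distrib)
  finally have "(\<Sum>j\<in>I. frag_cmul (a j + (\<Sum>i\<in>I. a i * d i j)) (y j)) = 0" using 0 by simp
  then have "\<forall>j\<in>I. a j + (\<Sum>i\<in>I. a i * d i j) = 0"
    using y[unfolded lin_indep_family_def, rule_format, of "\<lambda>j. a j + (\<Sum>i\<in>I. a i * d i j)"] by blast
  then have rel: "a j = - (\<Sum>i\<in>I. a i * d i j)" if "j \<in> I" for j using that by (simp add: eq_neg_iff_add_eq_0)
  show "\<forall>i\<in>I. a i = 0"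
  proof (rule ccontr)
    assume "\<not> (\<forall>i\<in>I. a i = 0)"
    then have ne: "{i\<in>I. a i \<noteq> 0} \<noteq> {}" by blast
    have f: "finite {i\<in>I. a i \<noteq> 0}" using fin by simp
    \<comment> \<open>A contribution to \<open>y j\<close> could come only from indices of larger
      rank, where \<open>a\<close> vanishes by the choice of \<open>j\<close>.\<close>
    obtain j where j: "j \<in> I" "a j \<noteq> 0" and mx: "\<And>i. i \<in> I \<Longrightarrow> a i \<noteq> 0 \<Longrightarrow> rank i \<le> rank j"
      using ex_is_arg_min_if_finite[OF f ne, of "\<lambda>i. - int (rank i)"]
      by (auto simp: is_arg_min_linorder)
    have "(\<Sum>i\<in>I. a i * d i j) = 0"
      by (rule sum.neutral) (use mx in \<open>force simp: d_def\<close>)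
    then show False using rel[OF j(1)] j(2) by simp
  qed
qed

lemma lin_indep_familyD:
  assumes fin: "finite I" and x: "lin_indep_family x I"
  shows "inj_on x I" "\<not> int_module.dependent (x ` I)"
proof -
  show inj: "inj_on x I"
  proof (rule inj_onI, rule ccontr)
    fix i j assume ij: "i \<in> I" "j \<in> I" "x i = x j" "i \<noteq> j"
    define a where "a k = (if k = i then 1 else if k = j then - 1 else (0::int))" for k
    have "(\<Sum>k\<in>I. frag_cmul (a k) (x k)) = (\<Sum>k\<in>{i, j}. frag_cmul (a k) (x k))"
      by (rule sum.mono_neutral_right) (use fin ij in \<open>auto simp: a_def\<close>)
    also have "\<dots> = 0" using ij by (simp add: a_def)
    finally show False using x ij(1) unfolding lin_indep_family_def by (force simp: a_def)
  qed
  show "\<not> int_module.dependent (x ` I)"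
  proof
    assume "int_module.dependent (x ` I)"
    then obtain u where u: "\<exists>v\<in>x ` I. u v \<noteq> 0" "(\<Sum>v\<in>x ` I. frag_cmul (u v) v) = 0"
      unfolding int_module.dependent_finite[OF finite_imageI[OF fin]] by blast
    from u(2) have "(\<Sum>i\<in>I. frag_cmul (u (x i)) (x i)) = 0" by (simp add: sum.reindex[OF inj])
    then have "\<forall>i\<in>I. u (x i) = 0"
      using x[unfolded lin_indep_family_def, rule_format, of "\<lambda>i. u (x i)"] by blast
    then show False using u(1) by blast
  qed
qed

lemma lin_indep_family_fh_c:
  assumes "finite I"
  shows "lin_indep_family fh_c I"
  unfolding lin_indep_family_def
proof (intro allI impI ballI)
  fix a i assume 0: "(\<Sum>i\<in>I. frag_cmul (a i) (fh_c i)) = 0" and i: "i \<in> I"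
  have "poly_mapping.lookup (\<Sum>i\<in>I. frag_cmul (a i) (fh_c i)) i = (\<Sum>j\<in>I. if j = i then a j else 0)"
    unfolding lookup_sum by (rule sum.cong[OF refl]) (auto simp: fh_c_def)
  then show "a i = 0" using 0 i assms by simp
qed

section \<open>The intermediate basis of monomial symmetric functions, and the family
  \<open>fh_g\<close>\<close>

definition fh_m :: "nat \<Rightarrow> partition \<Rightarrow> fh_algebra" where
  "fh_m r \<nu> = proj (2 * r) r (mon (2 * r) (parts \<nu>))"

lemma fh_m_triangular:
  assumes l: "\<nu> \<in> partitions_of r"
  shows "fh_m r \<nu> - fh_c \<nu> \<in> int_module.span (fh_c ` {\<kappa>\<in>partitions_of r. plength \<kappa> < plength \<nu>})"
proof -
  let ?c = "\<lambda>\<kappa>. cf (mon (2 * r) (parts \<nu>)) (rep (2 * r) (parts \<kappa>))"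
  have rp: "rep (2 * r) (parts \<kappa>) permutes {1..2 * r}" "red_type (2 * r) (rep (2 * r) (parts \<kappa>)) = parts \<kappa>"
    "perm_len (2 * r) (rep (2 * r) (parts \<kappa>)) = r" if "\<kappa> \<in> partitions_of r" for \<kappa>
    using rep_partition[of \<kappa> "2 * r"] that by (simp_all add: partitions_of_def)
  have "fh_m r \<nu> = frag_cmul (?c \<nu>) (fh_c \<nu>) + (\<Sum>\<kappa>\<in>partitions_of r - {\<nu>}. frag_cmul (?c \<kappa>) (fh_c \<kappa>))"
    unfolding fh_m_def proj_def by (rule sum.remove[OF finite_partitions_of l])
  also have "?c \<nu> = 1" by (rule cf_mon_diagonal[OF rp(1,2)[OF l]])
  finally have "fh_m r \<nu> - fh_c \<nu> = (\<Sum>\<kappa>\<in>partitions_of r - {\<nu>}. frag_cmul (?c \<kappa>) (fh_c \<kappa>))" by simp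
  also have "\<dots> \<in> int_module.span (fh_c ` {\<kappa>\<in>partitions_of r. plength \<kappa> < plength \<nu>})"
  proof (rule int_module.span_sum)
    fix \<kappa> assume k: "\<kappa> \<in> partitions_of r - {\<nu>}"
    show "frag_cmul (?c \<kappa>) (fh_c \<kappa>) \<in> int_module.span (fh_c ` {\<kappa>\<in>partitions_of r. plength \<kappa> < plength \<nu>})"
    proof (cases "?c \<kappa> = 0")
      case True
      then show ?thesis by (simp add: int_module.span_zero)
    next
      case False
      have kr: "\<kappa> \<in> partitions_of r" using k by blast
      have "sum_mset (parts \<nu>) = r" using l by (simp add: partitions_of_def psize.rep_eq)
      then have "size (parts \<kappa>) < size (parts \<nu>) \<or> parts \<kappa> = parts \<nu>"
        using cf_mon_nonzero[OF _ False] rp[OF kr] by simp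
      then have "plength \<kappa> < plength \<nu>" using k by (simp add: plength.rep_eq parts_inject)
      then show ?thesis using kr by (intro int_module.span_scale int_module.span_base) blast
    qed
  qed
  finally show ?thesis .
qed

text \<open>
  Orders partitions of \<open>r\<close> by decreasing length and then by increasing length of
  \<open>minus_one \<pi>\<close>.
\<close>

definition g_rank :: "nat \<Rightarrow> partition \<Rightarrow> nat" where
  "g_rank r \<pi> = (r - plength \<pi>) * Suc r + plength (minus_one \<pi>)"

lemma plength_minus_one_le: "plength (minus_one \<pi>) \<le> plength \<pi>"
  unfolding plength.rep_eq minus_one.rep_eq decrement_parts_def
  by (metis size_filter_mset_lesseq size_image_mset)

text \<open>The second summand of the rank is at most \<open>r\<close>, so the weight
  \<open>Suc r\<close> makes the comparison lexicographic.\<close>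

lemma g_rank_less:
  assumes "\<pi> \<in> partitions_of r" "\<rho> \<in> partitions_of r"
    and "plength \<pi> < plength \<rho> \<or>
      plength \<rho> = plength \<pi> \<and> plength (minus_one \<rho>) < plength (minus_one \<pi>)"
  shows "g_rank r \<rho> < g_rank r \<pi>"
proof -
  have le: "plength \<pi> \<le> r" "plength \<rho> \<le> r"
    using plength_le_psize[of \<pi>] plength_le_psize[of \<rho>] assms(1,2) by (simp_all add: partitions_of_def)
  from assms(3) show ?thesis
  proof
    assume lt: "plength \<pi> < plength \<rho>"
    have "plength (minus_one \<rho>) < Suc r" using plength_minus_one_le[of \<rho>] le by simp
    moreover have "(r - plength \<rho>) * Suc r + Suc r \<le> (r - plength \<pi>) * Suc r"
    proof -
      have "Suc (r - plength \<rho>) \<le> r - plength \<pi>" using lt le by simp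
      from mult_le_mono1[OF this, of "Suc r"] show ?thesis by simp
    qed
    ultimately show ?thesis unfolding g_rank_def by linarith
  qed (simp add: g_rank_def)
qed

lemma psize_minus_one: "psize (minus_one \<pi>) + plength \<pi> = psize \<pi>"
  using size_decrement_parts[of "parts \<pi>"] parts[of \<pi>]
  by (simp add: psize.rep_eq plength.rep_eq minus_one.rep_eq)

lemma eq_of_decrement_parts_eq:
  assumes "0 \<notin># P" "0 \<notin># Q" "decrement_parts P = decrement_parts Q" "sum_mset P = sum_mset Q"
  shows "P = Q"
  using cycle_type_eq_of_red_type[OF assms(1)] cycle_type_eq_of_red_type[OF assms(2)] assms(3,4) by simp

text \<open>A term with more than \<open>plength \<pi>\<close> parts has smaller rank. One with
  equally many parts decrements to \<open>\<nu>\<close>, so it has smaller rank if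
  \<open>\<nu>\<close> is shorter than \<open>minus_one \<pi>\<close>, and otherwise it is
  \<open>\<pi>\<close> itself, with coefficient 1.\<close>

lemma mon_mult_len_sum_triangular:
  assumes p: "\<pi> \<in> partitions_of r"
    and \<nu>: "sum_mset \<nu> + plength \<pi> = r" "size \<nu> < plength (minus_one \<pi>) \<or> \<nu> = parts (minus_one \<pi>)"
  shows "proj (2 * r) r (mon (2 * r) \<nu> * len_sum (2 * r) (plength \<pi>))
      - (if \<nu> = parts (minus_one \<pi>) then fh_m r \<pi> else 0)
    \<in> int_module.span (fh_m r ` {\<rho>\<in>partitions_of r. g_rank r \<rho> < g_rank r \<pi>})"
    (is "?L \<in> ?S")
proof -
  let ?n = "2 * r" and ?l = "plength \<pi>"
  let ?B = "{\<beta>. set_mset \<beta> \<subseteq> {1..?n} \<and> size \<beta> = sum_mset \<nu> + ?l}"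
  let ?T = "mult_type ` ?B"
  let ?m = "\<lambda>P. proj ?n r (mon ?n P)"
  obtain c where e: "mon ?n \<nu> * len_sum ?n ?l = (\<Sum>P\<in>?T. frag_cmul (c P) (mon ?n P))"
    and c: "\<forall>P\<in>?T. (c P \<noteq> 0 \<longrightarrow> ?l \<le> size P \<and> (size P = ?l \<longrightarrow> decrement_parts P = \<nu>)) \<and>
      (size P = ?l \<longrightarrow> decrement_parts P = \<nu> \<longrightarrow> c P = 1)"
    using mon_mult_len_sum[of ?n \<nu> ?l] by blast
  have fT: "finite ?T" by (intro finite_imageI finite_multisets_bounded)
  have T: "sum_mset P = r" "0 \<notin># P" if "P \<in> ?T" for P
  proof -
    obtain \<beta> where b: "P = mult_type \<beta>" "size \<beta> = sum_mset \<nu> + ?l" using \<open>P \<in> ?T\<close> by auto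
    show "sum_mset P = r" using b \<nu>(1) by (simp add: sum_mult_type)
    show "0 \<notin># P" unfolding b(1) mult_type_def by (auto simp: count_eq_zero_iff)
  qed
  have low: "frag_cmul (c P) (?m P) \<in> ?S"
    if P: "P \<in> ?T" and ne: "\<not> (\<nu> = parts (minus_one \<pi>) \<and> P = parts \<pi>)" for P
  proof (cases "c P = 0")
    case False
    define \<rho> where "\<rho> = Partition P"
    have \<rho>: "parts \<rho> = P" unfolding \<rho>_def using T(2)[OF P] by (simp add: Partition_inverse)
    have \<rho>r: "\<rho> \<in> partitions_of r" using T(1)[OF P] \<rho> by (simp add: partitions_of_def psize.rep_eq)
    have cP: "?l \<le> plength \<rho>" "plength \<rho> = ?l \<Longrightarrow> parts (minus_one \<rho>) = \<nu>"
      using bspec[OF c P] False \<rho> by (simp_all add: plength.rep_eq[of \<rho>] minus_one.rep_eq)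
    have "g_rank r \<rho> < g_rank r \<pi>"
    proof (rule g_rank_less[OF p \<rho>r])
      show "?l < plength \<rho> \<or> plength \<rho> = ?l \<and> plength (minus_one \<rho>) < plength (minus_one \<pi>)"
      proof (cases "plength \<rho> = ?l")
        case True
        then have mr: "parts (minus_one \<rho>) = \<nu>" by (rule cP(2))
        have "\<nu> \<noteq> parts (minus_one \<pi>)"
        proof
          assume v: "\<nu> = parts (minus_one \<pi>)"
          then have d: "decrement_parts P = decrement_parts (parts \<pi>)"
            using mr \<rho> by (simp add: minus_one.rep_eq)
          have "sum_mset (parts \<pi>) = r" using p by (simp add: partitions_of_def psize.rep_eq)
          then have s: "sum_mset P = sum_mset (parts \<pi>)" using T(1)[OF P] by simp
          have "0 \<notin># parts \<pi>" using parts[of \<pi>] by simp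
          then have "P = parts \<pi>" by (rule eq_of_decrement_parts_eq[OF T(2)[OF P] _ d s])
          then show False using ne v by blast
        qed
        then show ?thesis using True mr \<nu>(2) by (simp add: plength.rep_eq)
      qed (use cP(1) in simp)
    qed
    then show ?thesis
      using \<rho>r \<rho> by (intro int_module.span_scale int_module.span_base) (auto simp: fh_m_def)
  qed (simp add: int_module.span_zero)
  have sum: "proj ?n r (mon ?n \<nu> * len_sum ?n ?l) = (\<Sum>P\<in>?T. frag_cmul (c P) (?m P))"
    unfolding e by (simp add: proj_sum proj_cmul)
  show ?thesis
  proof (cases "\<nu> = parts (minus_one \<pi>)")
    case False
    then show ?thesis unfolding sum using low by (auto intro!: int_module.span_sum)
  next
    case v: True
    show ?thesis
    proof (cases "parts \<pi> \<in> ?T")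
      case True
      have "c (parts \<pi>) = 1"
        using bspec[OF c True] v by (simp add: plength.rep_eq minus_one.rep_eq)
      then have "(\<Sum>P\<in>?T. frag_cmul (c P) (?m P)) = fh_m r \<pi> + (\<Sum>P\<in>?T - {parts \<pi>}. frag_cmul (c P) (?m P))"
        by (subst sum.remove[OF fT True]) (simp add: fh_m_def)
      then have "?L = (\<Sum>P\<in>?T - {parts \<pi>}. frag_cmul (c P) (?m P))"
        unfolding sum if_P[OF v] by (simp only: add_diff_cancel_left')
      moreover have "(\<Sum>P\<in>?T - {parts \<pi>}. frag_cmul (c P) (?m P)) \<in> ?S"
      proof (rule int_module.span_sum)
        fix P assume P: "P \<in> ?T - {parts \<pi>}"
        show "frag_cmul (c P) (?m P) \<in> ?S" by (rule low) (use P in simp_all)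
      qed
      ultimately show ?thesis by (simp only:)
    next
      \<comment> \<open>If no monomial has type \<open>\<pi>\<close>, then
        \<open>fh_m r \<pi>\<close> is an empty sum and subtracting it changes nothing.\<close>
      case False
      have "idx ?n (parts \<pi>) = {}"
      proof (rule ccontr)
        assume "idx ?n (parts \<pi>) \<noteq> {}"
        then obtain \<beta> where b: "set_mset \<beta> \<subseteq> {1..?n}" "mult_type \<beta> = parts \<pi>" by (auto simp: idx_def)
        have "size \<beta> = r" using b(2) sum_mult_type[of \<beta>] p by (simp add: partitions_of_def psize.rep_eq)
        then have "\<beta> \<in> ?B" using b(1) \<nu>(1) by simp
        then have "mult_type \<beta> \<in> ?T" by (rule imageI)
        then show False using False b(2) by simp
      qed
      then have "fh_m r \<pi> = 0" by (simp add: fh_m_def mon_def proj_zero)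
      then have "?L = (\<Sum>P\<in>?T. frag_cmul (c P) (?m P))" unfolding sum by simp
      moreover have "(\<Sum>P\<in>?T. frag_cmul (c P) (?m P)) \<in> ?S"
      proof (rule int_module.span_sum)
        fix P assume P: "P \<in> ?T"
        then have "P \<noteq> parts \<pi>" using False by metis
        then show "frag_cmul (c P) (?m P) \<in> ?S" by (intro low P) simp
      qed
      ultimately show ?thesis by (simp only:)
    qed
  qed
qed

text \<open>The expansion of the class sum of \<open>minus_one \<pi>\<close> is multiplied by
  \<open>len_sum\<close> and projected to degree \<open>r\<close>; each generator of its span lands
  in the span of smaller rank.\<close>

lemma fh_g_triangular:
  assumes p: "\<pi> \<in> partitions_of r"
  shows "fh_g \<pi> - fh_m r \<pi> \<in> int_module.span (fh_m r ` {\<rho>\<in>partitions_of r. g_rank r \<rho> < g_rank r \<pi>})"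
    (is "_ \<in> ?S")
proof -
  let ?n = "2 * r" and ?l = "plength \<pi>" and ?\<mu> = "parts (minus_one \<pi>)"
  let ?a = "sum_mset ?\<mu>"
  have al: "?a + ?l = r"
    using psize_minus_one[of \<pi>] p by (simp add: partitions_of_def psize.rep_eq[of "minus_one \<pi>"])
  let ?h = "\<lambda>z. proj ?n r (z * len_sum ?n ?l)"
  have g: "fh_g \<pi> = ?h (class_el ?n ?\<mu>)"
    using fh_mult_eq_proj[of "minus_one \<pi>" ?l ?n] al by (simp add: fh_g_def psize.rep_eq[of "minus_one \<pi>"])
  have gens: "?h z \<in> ?S"
    if "z \<in> mon ?n ` {Q. sum_mset Q = ?a \<and> 0 \<notin># Q \<and> size Q < size ?\<mu>} \<union> {x. below ?n ?a x}" for z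
    using that
  proof
    assume "z \<in> mon ?n ` {Q. sum_mset Q = ?a \<and> 0 \<notin># Q \<and> size Q < size ?\<mu>}"
    then obtain Q where Q: "z = mon ?n Q" "sum_mset Q = ?a" "size Q < size ?\<mu>" by blast
    have "Q \<noteq> ?\<mu>" using Q(3) by blast
    then show "?h z \<in> ?S"
      using mon_mult_len_sum_triangular[OF p, of Q] Q al by (simp add: plength.rep_eq[of "minus_one \<pi>"])
  next
    assume "z \<in> {x. below ?n ?a x}"
    moreover have "below ?n (Suc ?l) (len_sum ?n ?l)"
      by (auto simp: below_def cf_len_sum split: if_splits)
    \<comment> \<open>The strict bounds \<open>?a\<close> and \<open>Suc ?l\<close> combine to
      exactly \<open>r\<close>, so these terms miss degree \<open>r\<close>.\<close>
    ultimately have "below ?n (?a + Suc ?l - 1) (z * len_sum ?n ?l)" by (intro below_mult) simp_all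
    then have "below ?n r (z * len_sum ?n ?l)" using al by simp
    then show "?h z \<in> ?S" by (simp add: proj_below int_module.span_zero)
  qed
  have "?h (class_el ?n ?\<mu> - mon ?n ?\<mu>) \<in> ?S"
    using class_el_triangular[OF refl, of ?n ?\<mu>]
  proof (induction rule: gring_module.span_induct_alt)
    case base
    show ?case by (simp add: proj_zero int_module.span_zero)
  next
    case (step k u v)
    have "?h (frag_cmul k u + v) = frag_cmul k (?h u) + ?h v"
      by (simp add: distrib_right frag_cmul_mult_left proj_add proj_cmul)
    then show ?case using gens[OF step(1)] step(2) by (simp add: int_module.span_add int_module.span_scale)
  qed
  moreover have "?h (mon ?n ?\<mu>) - fh_m r \<pi> \<in> ?S"
    using mon_mult_len_sum_triangular[OF p, of ?\<mu>] al by simp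
  ultimately have "?h (class_el ?n ?\<mu> - mon ?n ?\<mu>) + (?h (mon ?n ?\<mu>) - fh_m r \<pi>) \<in> ?S"
    by (rule int_module.span_add)
  then show ?thesis by (simp add: g left_diff_distrib proj_diff)
qed

theorem theorem4p5:
  fixes r :: nat
  shows "inj_on fh_g (partitions_of r) \<and>
         \<not> int_module.dependent (fh_g ` partitions_of r) \<and>
         int_module.span (fh_g ` partitions_of r) = fh_degree r"
proof -
  note fin = finite_partitions_of[of r]
  have m: "lin_indep_family (fh_m r) (partitions_of r)"
    by (rule unitriangular_lin_indep[OF fin lin_indep_family_fh_c[OF fin] fh_m_triangular])
  have g: "lin_indep_family fh_g (partitions_of r)"
    by (rule unitriangular_lin_indep[OF fin m fh_g_triangular])
  have "int_module.span (fh_g ` partitions_of r) = int_module.span (fh_m r ` partitions_of r)"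
    by (rule unitriangular_span[OF fh_g_triangular])
  also have "\<dots> = fh_degree r"
    unfolding fh_degree_def by (rule unitriangular_span[OF fh_m_triangular])
  finally show ?thesis using lin_indep_familyD[OF fin g] by blast
qed

end
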